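(* Let $\mu(\cdot)$ be the effective form at the beginning of the spectrum of the discrete normalized Laplacian $\Delta$ on the $\mathbb Z^d$-periodic graph $\Gamma$, i.e. $\mu(\omega)=\frac12\frac{\partial^2}{\partial\varepsilon^2}\lambda_1(\varepsilon\omega)\big|_{\varepsilon=0}$. Then for each $\omega\in\mathbb S^{d-1}$, $$\mu(\omega)=\|P_*h(\omega)\|_*^2,$$ $$0<\frac{\Lambda_0}{\varkappa\,\nu\,d}\le\mu(\omega)\le\|h(\omega)\|_*^2=\frac1\varkappa\sum_{\mathbf e\in\mathcal B_*}\langle\tau(\mathbf e),\omega\rangle^2\le\frac{\Lambda_1}{\varkappa},$$ where $P_*$ is the orthogonal projection of $\mathbb C^{\nu_*}$ onto the kernel of $\partial^*$, and $$h(\omega)=\frac{i}{\sqrt\varkappa}\big(\langle\tau(\mathbf e),\omega\rangle\big)_{\mathbf e\in\mathcal E_*}\in\mathbb C^{\nu_*},\qquad \varkappa=\sum_{v\in V_*}\varkappa_v .$$ Moreover, $\Lambda_0$ and $\Lambda_1$ satisfy $$\Big(\frac{d-1}{C}\Big)^{d-1}\le\Lambda_0\le\Lambda_1\le\max_{\mathbf e_0\in\mathcal B_*}\Big\langle\tau^+(\mathbf e_0),\sum_{\mathbf e\in\mathcal B_*}\tau^+(\mathbf e)\Big\rangle,\qquad C=\sum_{j=1}^d\|\tau(\mathbf e_j)\|^2 .$$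
   Context: Graph. Let $d\ge2$ and let $\Gamma=(V,\mathcal E)$ be a connected infinite graph, possibly with loops and multiple edges, with vertex set $V$ and set $\mathcal E$ of unoriented edges. The degree $\varkappa_v$ of a vertex is the number of edges incident to it, a loop being counted twice. $\Gamma$ is $\mathbb Z^d$-periodic: it is equipped with an action of $\mathbb Z^d$ by graph automorphisms, written $v\mapsto v+m$, free on vertices; all degrees are finite; and the quotient (fundamental) graph $\Gamma_*=\Gamma/\mathbb Z^d=(V_*,\mathcal E_* )$ is finite. Put $\nu=\#V_*$, $\nu_*=\#\mathcal E_*$. The degree of a vertex of $\Gamma_*$ equals that of any of its representatives in $V$. Oriented edges and indices. Each unoriented edge with endpoints $u,v$ yields two oriented edges $(u,v)$ and $(v,u)$ (also for loops); $\mathcal A$ and $\mathcal A_*$ denote the sets of oriented edges of $\Gamma$ and $\Gamma_*$. A fundamental vertex set $V_0\subset V$ is a set of $\nu$ pairwise non-$\mathbb Z^d$-equivalent vertices. Each $v\in V$ is uniquely $v=v_0+[v]$ with $v_0\in V_0$, $[v]\in\mathbb Z^d$. The index of $\mathbf e=(u,v)\in\mathcal A$ is $\tau(\mathbf e)=[v]-[u]\in\mathbb Z^d$; it is $\mathbb Z^d$-invariant, so it defines the index $\tau(\mathbf e_* )$ of each $\mathbf e_*\in\mathcal A_*$. Choice of $V_0$. $V_0$ is the vertex set $V_T$ of a subgraph $T=(V_T,\mathcal E_T)$ of $\Gamma$ that is a tree and whose vertex set is a fundamental vertex set (such $T$ exists). Then $T_*=T/\mathbb Z^d$ is a spanning tree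 of $\Gamma_*$ all of whose edges have zero index. Bridges. Orient each edge of $\mathcal E_*$ in an arbitrary way; indices of edges of $\mathcal E_*$ refer to this orientation. $\mathcal B_*\subset\mathcal E_*$ is the set of bridges, i.e. edges with nonzero index; $\nu_1=\#\mathcal B_*$. Since $\Gamma$ is connected, there exist bridges $\mathbf e_1,\dots,\mathbf e_d\in\mathcal B_*$ with linearly independent indices; fix such bridges and write $\mathcal B_*=\{\mathbf e_1,\dots,\mathbf e_{\nu_1}\}$. Let $\mathcal T_0$ be the $d\times d$ matrix with rows $\tau(\mathbf e_1),\dots,\tau(\mathbf e_d)$ and $\mathcal T_1$ the $\nu_1\times d$ matrix with rows $\tau(\mathbf e_1),\dots,\tau(\mathbf e_{\nu_1})$. $\Lambda_0>0$ is the smallest eigenvalue of $\mathcal T_0^*\mathcal T_0$, $\Lambda_1$ the largest eigenvalue of $\mathcal T_1^*\mathcal T_1$. For $\tau=(\tau_1,\dots,\tau_d)\in\mathbb Z^d$ put $\tau^+=(|\tau_1|,\dots,|\tau_d|)$. The matrix $\partial=\{\partial_{\mathbf e,v}\}_{\mathbf e\in\mathcal E_*,v\in V_*}$ is the $\nu_*\times\nu$ matrix with $\partial_{\mathbf e,v}=\frac1{\sqrt{\varkappa_v}}$ if $v$ is the terminal vertex of the non-loop edge $\mathbf e$, $-\frac1{\sqrt{\varkappa_v}}$ if $v$ is the initial vertex of the non-loop edge $\mathbf e$, and $0$ otherwise (in particular for loops). Laplacian. On $\ell^2(V)$, $(\Delta f)(v)=\frac1{\sqrt{\varkappa_v}}\sum_{(v,u)_e\in\mathcal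 E}\Big(\frac{f(v)}{\sqrt{\varkappa_v}}-\frac{f(u)}{\sqrt{\varkappa_u}}\Big)$, loops counted twice. It decomposes into a direct integral over $\mathbb T^d=\mathbb R^d/(2\pi\mathbb Z)^d$ with fibers the $\nu\times\nu$ Hermitian Floquet matrices $\Delta(\vartheta)$, $$\Delta_{uv}(\vartheta)=\delta_{uv}-\frac1{\sqrt{\varkappa_u\varkappa_v}}\sum_{\mathbf e=(u,v)\in\mathcal A_*}e^{i\langle\tau(\mathbf e),\vartheta\rangle},\qquad u,v\in V_*$$ (empty sum $=0$). $\lambda_1(\vartheta)$ denotes the lowest eigenvalue (first band function) of $\Delta(\vartheta)$ near $\vartheta=0$. The beginning of the spectrum of $\Delta$ is $\lambda_1(0)=0$, which is a simple eigenvalue of $\Delta(0)$, and the effective form $\mu$ there is defined by $\lambda_1(\varepsilon\omega)=\varepsilon^2\mu(\omega)+O(\varepsilon^3)$ as $\varepsilon\to0^+$, $\omega\in\mathbb S^{d-1}$ (the unit sphere of $\mathbb R^d$). $\|\cdot\|_*$ is the standard norm on $\mathbb C^{\nu_*}$; $\|\cdot\|$, $\langle\cdot,\cdot\rangle$ are the Euclidean norm and inner product on $\mathbb R^d$. *)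

theory Defs
  imports
    "Graph_Theory.Digraph_Component"
    "Graph_Theory.Bidirected_Digraph"
    "HOL-Analysis.Analysis"
    "HOL-Library.Landau_Symbols"
begin

section \<open>Matrices and vectors indexed by finite sets\<close>

text \<open>
  A complex matrix with rows indexed by \<open>I\<close> and columns indexed by \<open>J\<close> is a function
  \<open>'i \<Rightarrow> 'j \<Rightarrow> complex\<close>; the index sets are passed explicitly, and entries outside
  \<open>I \<times> J\<close> are irrelevant.  Vectors are functions that vanish off their index set, so that
  equality of vectors is equality of functions.
\<close>

definition cvecs :: "'i set \<Rightarrow> ('i \<Rightarrow> complex) set" where
  "cvecs I = {x. \<forall>i. i \<notin> I \<longrightarrow> x i = 0}"

definition cvec_inner :: "'i set \<Rightarrow> ('i \<Rightarrow> complex) \<Rightarrow> ('i \<Rightarrow> complex) \<Rightarrow> complex" where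
  "cvec_inner I x y = (\<Sum>i\<in>I. x i * cnj (y i))"

definition cvec_norm :: "'i set \<Rightarrow> ('i \<Rightarrow> complex) \<Rightarrow> real" where
  "cvec_norm I x = L2_set (\<lambda>i. cmod (x i)) I"

definition mat_vec :: "'j set \<Rightarrow> ('i \<Rightarrow> 'j \<Rightarrow> complex) \<Rightarrow> ('j \<Rightarrow> complex) \<Rightarrow> 'i \<Rightarrow> complex" where
  "mat_vec J M x = (\<lambda>i. \<Sum>j\<in>J. M i j * x j)"

definition mat_mul ::
  "'j set \<Rightarrow> ('i \<Rightarrow> 'j \<Rightarrow> complex) \<Rightarrow> ('j \<Rightarrow> 'k \<Rightarrow> complex) \<Rightarrow> 'i \<Rightarrow> 'k \<Rightarrow> complex" where
  "mat_mul J A B = (\<lambda>i k. \<Sum>j\<in>J. A i j * B j k)"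

definition mat_adj :: "('i \<Rightarrow> 'j \<Rightarrow> complex) \<Rightarrow> 'j \<Rightarrow> 'i \<Rightarrow> complex" where
  "mat_adj M = (\<lambda>j i. cnj (M i j))"

definition mat_kernel :: "'i set \<Rightarrow> 'j set \<Rightarrow> ('i \<Rightarrow> 'j \<Rightarrow> complex) \<Rightarrow> ('j \<Rightarrow> complex) set" where
  "mat_kernel I J M = {x \<in> cvecs J. \<forall>i\<in>I. mat_vec J M x i = 0}"

definition orth_proj ::
  "'i set \<Rightarrow> ('i \<Rightarrow> complex) set \<Rightarrow> ('i \<Rightarrow> complex) \<Rightarrow> 'i \<Rightarrow> complex" where
  "orth_proj I W x = (THE w. w \<in> W \<and> (\<forall>y\<in>W. cvec_inner I (\<lambda>i. x i - w i) y = 0))"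

definition is_eigenvalue :: "'i set \<Rightarrow> ('i \<Rightarrow> 'i \<Rightarrow> complex) \<Rightarrow> complex \<Rightarrow> bool" where
  "is_eigenvalue I M c \<longleftrightarrow>
     (\<exists>x\<in>cvecs I. x \<noteq> (\<lambda>_. 0) \<and> (\<forall>i\<in>I. mat_vec I M x i = c * x i))"

text \<open>Only applied to Hermitian matrices, all of whose eigenvalues are real.\<close>

definition smallest_eigenvalue :: "'i set \<Rightarrow> ('i \<Rightarrow> 'i \<Rightarrow> complex) \<Rightarrow> real" where
  "smallest_eigenvalue I M = Min {c::real. is_eigenvalue I M (of_real c)}"

definition largest_eigenvalue :: "'i set \<Rightarrow> ('i \<Rightarrow> 'i \<Rightarrow> complex) \<Rightarrow> real" where
  "largest_eigenvalue I M = Max {c::real. is_eigenvalue I M (of_real c)}"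

definition int_vec :: "int^'d \<Rightarrow> real^'d" where
  "int_vec t = (\<chi> j. real_of_int (t $ j))"

definition abs_vec :: "int^'d \<Rightarrow> real^'d" where
  "abs_vec t = (\<chi> j. \<bar>real_of_int (t $ j)\<bar>)"

text \<open>The matrix whose row with index \<open>i\<close> is the integer vector \<open>r i\<close>.\<close>

definition rows_mat :: "('i \<Rightarrow> int^'d) \<Rightarrow> 'i \<Rightarrow> 'd \<Rightarrow> complex" where
  "rows_mat r = (\<lambda>i j. of_int (r i $ j))"


section \<open>Graphs with loops and multiple edges\<close>

text \<open>
  A graph is given by its oriented edges (\<^const>\<open>arcs\<close>) together with the fixed-point-free
  orientation reversal \<open>rv\<close> of \<^locale>\<open>bidirected_digraph\<close>.  An unoriented edge is a pair
  \<open>{a, rv a}\<close>; thus every unoriented edge, loops included, carries exactly two oriented edges.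
  The set of endpoints of an unoriented edge \<open>e\<close> is \<open>tail G ` e\<close>.
\<close>

definition uedges :: "('v,'a) pre_digraph \<Rightarrow> ('a \<Rightarrow> 'a) \<Rightarrow> 'a set set" where
  "uedges G rv = (\<lambda>a. {a, rv a}) ` arcs G"

text \<open>The second summand makes loops count twice.\<close>

definition degree :: "('v,'a) pre_digraph \<Rightarrow> ('a \<Rightarrow> 'a) \<Rightarrow> 'v \<Rightarrow> nat" where
  "degree G rv v =
     card {e \<in> uedges G rv. v \<in> tail G ` e} + card {e \<in> uedges G rv. tail G ` e = {v}}"

text \<open>
  \<^const>\<open>forest\<close> and \<^const>\<open>tree\<close> regard the walk \<open>a, rv a\<close> as a cycle and so are not usable
  for bidirected graphs: here only cycles that do not traverse an edge in both directions count.
\<close>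

definition is_tree :: "('v,'a) pre_digraph \<Rightarrow> ('a \<Rightarrow> 'a) \<Rightarrow> bool" where
  "is_tree G rv \<longleftrightarrow> Digraph_Component.connected G \<and>
     \<not> (\<exists>p. pre_digraph.cycle G p \<and> (\<forall>a\<in>set p. rv a \<notin> set p))"

text \<open>An orientation of the unoriented edges: exactly one of \<open>a\<close>, \<open>rv a\<close> is chosen.\<close>

definition is_orientation :: "('v,'a) pre_digraph \<Rightarrow> ('a \<Rightarrow> 'a) \<Rightarrow> 'a set \<Rightarrow> bool" where
  "is_orientation G rv S \<longleftrightarrow> S \<subseteq> arcs G \<and> (\<forall>a\<in>arcs G. a \<in> S \<longleftrightarrow> rv a \<notin> S)"


section \<open>Periodic graphs\<close>

text \<open>\<open>vshift \<Gamma> m v\<close> is \<open>v + m\<close>, and \<open>ashift\<close> is the action on oriented edges.\<close>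

record ('v, 'a, 'd) periodic_data =
  base :: "('v, 'a) pre_digraph"
  flip :: "'a \<Rightarrow> 'a"
  vshift :: "int^'d \<Rightarrow> 'v \<Rightarrow> 'v"
  ashift :: "int^'d \<Rightarrow> 'a \<Rightarrow> 'a"

definition vorbit :: "('v,'a,'d::finite) periodic_data \<Rightarrow> 'v \<Rightarrow> 'v set" where
  "vorbit \<Gamma> v = range (\<lambda>m. vshift \<Gamma> m v)"

definition aorbit :: "('v,'a,'d::finite) periodic_data \<Rightarrow> 'a \<Rightarrow> 'a set" where
  "aorbit \<Gamma> a = range (\<lambda>m. ashift \<Gamma> m a)"

text \<open>
  The fundamental graph.  The tails of the arcs in one orbit form one vertex orbit, hence the tail
  of an arc orbit is its image under \<open>tail\<close>; similarly for the head and the orientation reversal.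
\<close>

definition fund_graph :: "('v,'a,'d::finite) periodic_data \<Rightarrow> ('v set, 'a set) pre_digraph" where
  "fund_graph \<Gamma> =
     \<lparr> verts = vorbit \<Gamma> ` verts (base \<Gamma>), arcs = aorbit \<Gamma> ` arcs (base \<Gamma>),
       tail = (\<lambda>X. tail (base \<Gamma>) ` X), head = (\<lambda>X. head (base \<Gamma>) ` X) \<rparr>"

definition fund_flip :: "('v,'a,'d::finite) periodic_data \<Rightarrow> 'a set \<Rightarrow> 'a set" where
  "fund_flip \<Gamma> X = flip \<Gamma> ` X"

locale periodic_graph = bidirected_digraph "base \<Gamma>" "flip \<Gamma>"
  for \<Gamma> :: "('v,'a,'d::finite) periodic_data" +
  assumes connected: "Digraph_Component.connected (base \<Gamma>)"
    and infinite_verts: "infinite (verts (base \<Gamma>))"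
    and finite_degrees:
      "v \<in> verts (base \<Gamma>) \<Longrightarrow> finite {e \<in> uedges (base \<Gamma>) (flip \<Gamma>). v \<in> tail (base \<Gamma>) ` e}"
    and vshift_verts: "v \<in> verts (base \<Gamma>) \<Longrightarrow> vshift \<Gamma> m v \<in> verts (base \<Gamma>)"
    and vshift_zero: "v \<in> verts (base \<Gamma>) \<Longrightarrow> vshift \<Gamma> 0 v = v"
    and vshift_add: "v \<in> verts (base \<Gamma>) \<Longrightarrow> vshift \<Gamma> (m + n) v = vshift \<Gamma> m (vshift \<Gamma> n v)"
    and vshift_free: "v \<in> verts (base \<Gamma>) \<Longrightarrow> vshift \<Gamma> m v = v \<Longrightarrow> m = 0"
    and ashift_arcs: "a \<in> arcs (base \<Gamma>) \<Longrightarrow> ashift \<Gamma> m a \<in> arcs (base \<Gamma>)"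
    and ashift_zero: "a \<in> arcs (base \<Gamma>) \<Longrightarrow> ashift \<Gamma> 0 a = a"
    and ashift_add: "a \<in> arcs (base \<Gamma>) \<Longrightarrow> ashift \<Gamma> (m + n) a = ashift \<Gamma> m (ashift \<Gamma> n a)"
    and tail_ashift: "a \<in> arcs (base \<Gamma>) \<Longrightarrow> tail (base \<Gamma>) (ashift \<Gamma> m a) = vshift \<Gamma> m (tail (base \<Gamma>) a)"
    and head_ashift: "a \<in> arcs (base \<Gamma>) \<Longrightarrow> head (base \<Gamma>) (ashift \<Gamma> m a) = vshift \<Gamma> m (head (base \<Gamma>) a)"
    and flip_ashift: "a \<in> arcs (base \<Gamma>) \<Longrightarrow> flip \<Gamma> (ashift \<Gamma> m a) = ashift \<Gamma> m (flip \<Gamma> a)"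
    and finite_fund_verts: "finite (verts (fund_graph \<Gamma>))"
    and finite_fund_arcs: "finite (arcs (fund_graph \<Gamma>))"

definition fundamental_vertex_set :: "('v,'a,'d::finite) periodic_data \<Rightarrow> 'v set \<Rightarrow> bool" where
  "fundamental_vertex_set \<Gamma> V0 \<longleftrightarrow>
     V0 \<subseteq> verts (base \<Gamma>) \<and> card V0 = card (verts (fund_graph \<Gamma>)) \<and>
     (\<forall>u\<in>V0. \<forall>v\<in>V0. u \<noteq> v \<longrightarrow> \<not> (\<exists>m. v = vshift \<Gamma> m u))"

definition fundamental_tree ::
  "('v,'a,'d::finite) periodic_data \<Rightarrow> ('v,'a) pre_digraph \<Rightarrow> bool" where
  "fundamental_tree \<Gamma> T \<longleftrightarrow>
     subgraph T (base \<Gamma>) \<and> flip \<Gamma> ` arcs T \<subseteq> arcs T \<and> is_tree T (flip \<Gamma>) \<and>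
     fundamental_vertex_set \<Gamma> (verts T)"

text \<open>\<open>cell \<Gamma> V0 v\<close> is \<open>[v]\<close>, the \<open>m\<close> in the unique decomposition \<open>v = v\<^sub>0 + m\<close> with \<open>v\<^sub>0 \<in> V0\<close>.\<close>

definition cell :: "('v,'a,'d::finite) periodic_data \<Rightarrow> 'v set \<Rightarrow> 'v \<Rightarrow> int^'d" where
  "cell \<Gamma> V0 v = (THE m. \<exists>v0\<in>V0. v = vshift \<Gamma> m v0)"

definition arc_index :: "('v,'a,'d::finite) periodic_data \<Rightarrow> 'v set \<Rightarrow> 'a \<Rightarrow> int^'d" where
  "arc_index \<Gamma> V0 a = cell \<Gamma> V0 (head (base \<Gamma>) a) - cell \<Gamma> V0 (tail (base \<Gamma>) a)"

text \<open>The index of an arc of the fundamental graph: the common index of the arcs in the orbit.\<close>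

definition index :: "('v,'a,'d::finite) periodic_data \<Rightarrow> 'v set \<Rightarrow> 'a set \<Rightarrow> int^'d" where
  "index \<Gamma> V0 X = the_elem (arc_index \<Gamma> V0 ` X)"

definition bridges :: "('v,'a,'d::finite) periodic_data \<Rightarrow> 'v set \<Rightarrow> 'a set set \<Rightarrow> 'a set set" where
  "bridges \<Gamma> V0 E = {e \<in> E. index \<Gamma> V0 e \<noteq> 0}"

definition fund_degree :: "('v,'a,'d::finite) periodic_data \<Rightarrow> 'v set \<Rightarrow> real" where
  "fund_degree \<Gamma> v = real (degree (fund_graph \<Gamma>) (fund_flip \<Gamma>) v)"

definition total_degree :: "('v,'a,'d::finite) periodic_data \<Rightarrow> real" where
  "total_degree \<Gamma> = (\<Sum>v\<in>verts (fund_graph \<Gamma>). fund_degree \<Gamma> v)"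


section \<open>Floquet matrices and the effective form\<close>

definition floquet ::
  "('v,'a,'d::finite) periodic_data \<Rightarrow> 'v set \<Rightarrow> real^'d \<Rightarrow> 'v set \<Rightarrow> 'v set \<Rightarrow> complex" where
  "floquet \<Gamma> V0 \<theta> = (\<lambda>u v. (if u = v then 1 else 0) -
     1 / of_real (sqrt (fund_degree \<Gamma> u * fund_degree \<Gamma> v)) *
     (\<Sum>e | e \<in> arcs (fund_graph \<Gamma>) \<and> tail (fund_graph \<Gamma>) e = u \<and> head (fund_graph \<Gamma>) e = v.
        exp (\<i> * of_real (int_vec (index \<Gamma> V0 e) \<bullet> \<theta>))))"

definition band1 :: "('v,'a,'d::finite) periodic_data \<Rightarrow> 'v set \<Rightarrow> real^'d \<Rightarrow> real" where
  "band1 \<Gamma> V0 \<theta> = smallest_eigenvalue (verts (fund_graph \<Gamma>)) (floquet \<Gamma> V0 \<theta>)"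

definition effective_form :: "('v,'a,'d::finite) periodic_data \<Rightarrow> 'v set \<Rightarrow> real^'d \<Rightarrow> real" where
  "effective_form \<Gamma> V0 \<omega> =
     (THE c. (\<lambda>\<epsilon>. band1 \<Gamma> V0 (\<epsilon> *\<^sub>R \<omega>) - \<epsilon>^2 * c) \<in> O[at_right 0](\<lambda>\<epsilon>. \<epsilon>^3))"

definition incidence ::
  "('v,'a,'d::finite) periodic_data \<Rightarrow> 'a set \<Rightarrow> 'v set \<Rightarrow> complex" where
  "incidence \<Gamma> = (\<lambda>e v.
     if tail (fund_graph \<Gamma>) e = head (fund_graph \<Gamma>) e then 0
     else if v = head (fund_graph \<Gamma>) e then of_real (1 / sqrt (fund_degree \<Gamma> v))
     else if v = tail (fund_graph \<Gamma>) e then - of_real (1 / sqrt (fund_degree \<Gamma> v))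
     else 0)"

text \<open>The vector \<open>h(\<omega>)\<close> and the projection \<open>P\<^sub>*\<close>; \<open>E\<close> is the set of oriented representatives
  of the unoriented edges of the fundamental graph.\<close>

definition hvec ::
  "('v,'a,'d::finite) periodic_data \<Rightarrow> 'v set \<Rightarrow> 'a set set \<Rightarrow> real^'d \<Rightarrow> 'a set \<Rightarrow> complex" where
  "hvec \<Gamma> V0 E \<omega> = (\<lambda>e. if e \<in> E
     then \<i> / of_real (sqrt (total_degree \<Gamma>)) * of_real (int_vec (index \<Gamma> V0 e) \<bullet> \<omega>) else 0)"

definition Pstar ::
  "('v,'a,'d::finite) periodic_data \<Rightarrow> 'a set set \<Rightarrow> ('a set \<Rightarrow> complex) \<Rightarrow> 'a set \<Rightarrow> complex" where
  "Pstar \<Gamma> E = orth_proj E (mat_kernel (verts (fund_graph \<Gamma>)) E (mat_adj (incidence \<Gamma>)))"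

text \<open>\<open>b\<close> is the family of the chosen bridges with linearly independent indices, indexed by \<open>'d\<close>.\<close>

definition Lambda0 ::
  "('v,'a,'d::finite) periodic_data \<Rightarrow> 'v set \<Rightarrow> ('d \<Rightarrow> 'a set) \<Rightarrow> real" where
  "Lambda0 \<Gamma> V0 b = (let T0 = rows_mat (\<lambda>j. index \<Gamma> V0 (b j))
     in smallest_eigenvalue UNIV (mat_mul UNIV (mat_adj T0) T0))"

definition Lambda1 ::
  "('v,'a,'d::finite) periodic_data \<Rightarrow> 'v set \<Rightarrow> 'a set set \<Rightarrow> real" where
  "Lambda1 \<Gamma> V0 E = (let T1 = rows_mat (index \<Gamma> V0)
     in largest_eigenvalue UNIV (mat_mul (bridges \<Gamma> V0 E) (mat_adj T1) T1))"

end

theory Submission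
  imports Defs "HOL-Library.Poly_Mapping"
begin

text \<open>
  The Floquet matrices live on the finite fundamental graph.  For a direction
  \<open>\<omega>\<close> let \<open>D(\<epsilon>)\<close> be its incidence operator in which the terminal vertex of each edge \<open>e\<close> is
  weighted with the phase \<open>exp(\<i> \<epsilon> \<langle>\<tau>(e), \<omega>\<rangle>)\<close>.  Expanding squares shows that the Floquet
  matrix at \<open>\<epsilon> \<omega>\<close> is \<open>D(\<epsilon>)\<^sup>* D(\<epsilon>)\<close> (lemma \<open>fiber_form\<close>).  At \<open>\<epsilon> = 0\<close> the operator is the matrix
  \<open>\<partial>\<close>, its kernel is spanned by the ground state \<open>f\<^sub>0\<close> with entries \<open>\<surd>(\<kappa>\<^sub>v / \<kappa>)\<close>, and \<open>D'(0) f\<^sub>0\<close>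
  is the vector \<open>h(\<omega>)\<close>.  Hence for an approximate eigenvector \<open>f\<^sub>0 + \<epsilon> g\<close>
  the form equals \<open>\<epsilon>\<^sup>2 \<parallel>h(\<omega>) + \<partial> g\<parallel>\<^sup>2\<close> up to \<open>O(\<epsilon>\<^sup>3)\<close>, and the best \<open>g\<close> leaves exactly the component of
  \<open>h(\<omega>)\<close> orthogonal to the range of \<open>\<partial>\<close>, which is \<open>P\<^sub>* h(\<omega>)\<close>.

  The perturbation argument is carried out with quadratic forms only, for an abstract
  family \<open>D(\<epsilon>)\<close> with one-dimensional kernel and a gap at \<open>\<epsilon> = 0\<close> (locale \<open>kernel_perturbation\<close>).  The gap
  makes the normalized eigenvector Lipschitz in \<open>\<epsilon>\<close>; the variational principle, used at two nearby
  parameters with exchanged roles, then gives differentiability of the eigenvalue with the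
  Hellmann-Feynman formula.  The key estimate is \<open>D(\<epsilon>) x\<^sub>\<epsilon> / \<epsilon> = P\<^sub>* h(\<omega>) + O(\<epsilon>)\<close> for the normalized
  eigenvector \<open>x\<^sub>\<epsilon>\<close> (lemma \<open>scaled_image_near\<close>); it yields the expansion with error \<open>O(\<epsilon>\<^sup>3)\<close> and the
  second derivative at once.  The gap itself and the variational principle come from compactness
  of unit spheres.

  The upper bound for the effective form is \<open>\<parallel>P\<^sub>* h\<parallel> \<le> \<parallel>h\<parallel>\<close>.  For the lower bound, each bridge \<open>e\<^sub>j\<close>
  closes a cycle with a path in the spanning tree.  All other edges of the cycle have index zero, so the sum of
  \<open>P\<^sub>* h = h + \<partial> g\<close> around the cycle is \<open>\<i> \<langle>\<tau>(e\<^sub>j), \<omega>\<rangle> / \<surd>\<kappa>\<close> up to sign; the cycle has at most \<open>\<nu>\<close> edges, and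
  Cauchy-Schwarz gives \<open>\<langle>\<tau>(e\<^sub>j), \<omega>\<rangle>\<^sup>2 \<le> \<kappa> \<nu> \<parallel>P\<^sub>* h\<parallel>\<^sup>2\<close> (lemma \<open>harmonic_lower_bound\<close>).  Averaging
  over the \<open>d\<close> chosen bridges brings in \<open>\<Lambda>\<^sub>0\<close>.

  The lower bound for \<open>\<Lambda>\<^sub>0\<close> expresses that a nonsingular integer matrix has determinant at least \<open>1\<close> in
  absolute value, so that its shortest image of a unit vector cannot be too short when
  all rows are bounded (theorem \<open>short_vector_lower_bound\<close>, via Hadamard's inequality).  The upper bound for \<open>\<Lambda>\<^sub>1\<close> is
  Schur's test for the matrix of scalar products of the indices.
\<close>


section \<open>Extreme eigenvalues of Hermitian matrices\<close>

lemma cvec_norm_sq: "(cvec_norm I x)\<^sup>2 = (\<Sum>i\<in>I. (cmod (x i))\<^sup>2)"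
  by (simp add: cvec_norm_def L2_set_def sum_nonneg)

lemma cvec_inner_self: "cvec_inner I x x = of_real ((cvec_norm I x)\<^sup>2)"
  by (simp add: cvec_inner_def cvec_norm_sq complex_norm_square del: of_real_power)

lemma cvecs_eq_zeroI: "x \<in> cvecs I \<Longrightarrow> (\<And>i. i \<in> I \<Longrightarrow> x i = 0) \<Longrightarrow> x = (\<lambda>_. 0)"
  by (force simp: cvecs_def)

lemma cvec_norm_eq_0:
  assumes "finite I" "x \<in> cvecs I" "cvec_norm I x = 0"
  shows "x = (\<lambda>_. 0)"
proof (rule cvecs_eq_zeroI[OF assms(2)])
  fix i assume "i \<in> I"
  then show "x i = 0"
    using assms by (simp add: cvec_norm_def L2_set_eq_0_iff)
qed

text \<open>
  Coordinatewise bounds place the set inside a product of discs, which is compact by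
  Tychonoff's theorem, and all defining conditions are closed.  The index set is not a type, so the
  ambient space is a function space with the product topology and not a Euclidean one; the linear
  conditions later cut out the orthogonal complement of the ground state.
\<close>

lemma compact_unit_sphere_section:
  assumes "finite I" "finite J"
  shows "compact {x \<in> cvecs I. cvec_norm I x = 1 \<and> (\<forall>j\<in>J. (\<Sum>i\<in>I. a j i * x i) = 0)}"
    (is "compact ?S")
proof -
  let ?K = "Pi\<^sub>E UNIV (\<lambda>i. if i \<in> I then cball 0 1 else {0::complex})"
  have "compact ?K"
    using compactin_PiE[of "\<lambda>_. euclidean" UNIV "\<lambda>i. if i \<in> I then cball 0 1 else {0::complex}"]
    by (simp add: euclidean_product_topology)
  have coord: "continuous_on UNIV (\<lambda>x::'a \<Rightarrow> complex. x i)" for i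
    by simp
  have "closed ((\<Inter>i\<in>-I. {x. x i = 0}) \<inter> {x. (\<Sum>i\<in>I. (cmod (x i))\<^sup>2) = 1}
      \<inter> (\<Inter>j\<in>J. {x. (\<Sum>i\<in>I. a j i * x i) = 0}))" (is "closed ?C")
    by (intro closed_Int closed_INT ballI closed_Collect_eq continuous_intros coord)
  moreover have "?S = ?K \<inter> ?C"
  proof (intro equalityI subsetI)
    fix x assume x: "x \<in> ?S"
    have sq: "(\<Sum>i\<in>I. (cmod (x i))\<^sup>2) = 1"
      using x cvec_norm_sq[of I x] by simp
    have "cmod (x i) \<le> 1" if "i \<in> I" for i
    proof -
      have "(cmod (x i))\<^sup>2 \<le> (\<Sum>i\<in>I. (cmod (x i))\<^sup>2)"
        using that assms by (intro member_le_sum) auto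
      then show ?thesis using sq by (simp add: power_le_one_iff abs_square_le_1)
    qed
    then show "x \<in> ?K \<inter> ?C"
      using x sq by (auto simp: cvecs_def)
  next
    fix x assume x: "x \<in> ?K \<inter> ?C"
    then have "(cvec_norm I x)\<^sup>2 = 1" "0 \<le> cvec_norm I x"
      by (auto simp: cvec_norm_sq) (simp add: cvec_norm_def)
    then have "cvec_norm I x = 1" by (simp add: power2_eq_1_iff)
    then show "x \<in> ?S"
      using x by (auto simp: cvecs_def)
  qed
  ultimately show ?thesis
    using \<open>compact ?K\<close> by (simp add: compact_Int_closed)
qed

lemma cvecs_scale: "x \<in> cvecs I \<Longrightarrow> (\<lambda>i. c * x i) \<in> cvecs I"
  by (simp add: cvecs_def)

lemma cvec_norm_scale: "cvec_norm I (\<lambda>i. c * x i) = cmod c * cvec_norm I x"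
  by (simp add: cvec_norm_def norm_mult L2_set_right_distrib)

lemma mat_vec_scale: "mat_vec I M (\<lambda>i. c * x i) = (\<lambda>i. c * mat_vec I M x i)"
  by (simp add: mat_vec_def sum_distrib_left mult.left_commute)

lemma minimizer_on_sphere_section:
  assumes "finite I" "finite J" "x0 \<in> cvecs I" "x0 \<noteq> (\<lambda>_. 0)"
    and "\<forall>j\<in>J. (\<Sum>i\<in>I. a j i * x0 i) = 0"
    and cont: "continuous_on UNIV (q :: ('i \<Rightarrow> complex) \<Rightarrow> real)"
  obtains z where "z \<in> cvecs I" "cvec_norm I z = 1" "\<forall>j\<in>J. (\<Sum>i\<in>I. a j i * z i) = 0"
    "\<And>x. x \<in> cvecs I \<Longrightarrow> cvec_norm I x = 1 \<Longrightarrow> (\<forall>j\<in>J. (\<Sum>i\<in>I. a j i * x i) = 0) \<Longrightarrow> q z \<le> q x"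
proof -
  let ?S = "{x \<in> cvecs I. cvec_norm I x = 1 \<and> (\<forall>j\<in>J. (\<Sum>i\<in>I. a j i * x i) = 0)}"
  have pos: "cvec_norm I x0 > 0"
    using cvec_norm_eq_0[OF assms(1,3)] assms(4) by (metis L2_set_nonneg cvec_norm_def less_eq_real_def)
  have "(\<lambda>i. of_real (1 / cvec_norm I x0) * x0 i) \<in> ?S"
    using assms(3,5) pos unfolding mem_Collect_eq cvec_norm_scale
    by (intro conjI cvecs_scale)
      (simp_all add: norm_divide mult.left_commute[of "a _ _"] sum_divide_distrib[symmetric])
  then have "?S \<noteq> {}" by blast
  from continuous_attains_inf[OF compact_unit_sphere_section[OF assms(1,2)] this
      continuous_on_subset[OF cont subset_UNIV]]
  show ?thesis using that by blast
qed

definition herm_on :: "'i set \<Rightarrow> ('i \<Rightarrow> 'i \<Rightarrow> complex) \<Rightarrow> bool" where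
  "herm_on I M \<longleftrightarrow> (\<forall>i\<in>I. \<forall>j\<in>I. M j i = cnj (M i j))"

lemma herm_on_uminus:
  assumes "herm_on I M"
  shows "herm_on I (\<lambda>i j. - M i j)"
  unfolding herm_on_def
proof (intro ballI)
  fix i j assume "i \<in> I" "j \<in> I"
  then have "M j i = cnj (M i j)" using assms unfolding herm_on_def by blast
  then show "- M j i = cnj (- M i j)" by simp
qed

lemma herm_on_inner:
  assumes "herm_on I M"
  shows "cvec_inner I (mat_vec I M x) y = cvec_inner I x (mat_vec I M y)"
proof -
  have "cvec_inner I (mat_vec I M x) y = (\<Sum>i\<in>I. \<Sum>j\<in>I. M i j * x j * cnj (y i))"
    by (simp add: cvec_inner_def mat_vec_def sum_distrib_right)
  also have "\<dots> = (\<Sum>j\<in>I. \<Sum>i\<in>I. M i j * x j * cnj (y i))"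
    by (rule sum.swap)
  also have "\<dots> = cvec_inner I x (mat_vec I M y)"
    unfolding cvec_inner_def mat_vec_def cnj_sum sum_distrib_left
  proof (intro sum.cong refl)
    fix i j assume "i \<in> I" "j \<in> I"
    then have "M i j = cnj (M j i)" using assms unfolding herm_on_def by blast
    then show "M i j * x j * cnj (y i) = x j * cnj (M j i * y i)" by simp
  qed
  finally show ?thesis .
qed

lemma cvec_inner_commute: "cvec_inner I y x = cnj (cvec_inner I x y)"
  by (simp add: cvec_inner_def mult.commute)

lemma cvec_inner_cong:
  "(\<And>i. i \<in> I \<Longrightarrow> x i = x' i) \<Longrightarrow> (\<And>i. i \<in> I \<Longrightarrow> y i = y' i) \<Longrightarrow> cvec_inner I x y = cvec_inner I x' y'"
  by (simp add: cvec_inner_def)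

lemma eigenvectors_orthogonal:
  assumes H: "herm_on I M" and "\<forall>i\<in>I. mat_vec I M x i = of_real c * x i"
    "\<forall>i\<in>I. mat_vec I M y i = of_real c' * y i" "c \<noteq> c'"
  shows "cvec_inner I x y = 0"
proof -
  have "of_real c * cvec_inner I x y = cvec_inner I (mat_vec I M x) y"
    using assms(2) by (simp add: cvec_inner_def sum_distrib_left mult.assoc)
  also have "\<dots> = of_real c' * cvec_inner I x y"
    using assms(3) by (simp add: herm_on_inner[OF H]) (simp add: cvec_inner_def sum_distrib_left mult.left_commute)
  finally show ?thesis using assms(4) by simp
qed

text \<open>
  Bessel's inequality for each coordinate vector, summed over all coordinates.
\<close>

lemma card_orthonormal_le:
  assumes fin: "finite I" "finite K"
    and on: "\<And>k l. k \<in> K \<Longrightarrow> l \<in> K \<Longrightarrow> cvec_inner I (e k) (e l) = (if k = l then 1 else 0)"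
  shows "card K \<le> card I"
proof -
  have bessel: "(\<Sum>k\<in>K. (cmod (e k i))\<^sup>2) \<le> 1" if i: "i \<in> I" for i
  proof -
    define s where "s = (\<Sum>k\<in>K. (cmod (e k i))\<^sup>2)"
    define p where "p j = (\<Sum>k\<in>K. cnj (e k i) * e k j)" for j
    have "of_real ((cvec_norm I p)\<^sup>2) = cvec_inner I p p"
      by (simp add: cvec_inner_self)
    also have "\<dots> = (\<Sum>j\<in>I. \<Sum>k\<in>K. \<Sum>l\<in>K. cnj (e k i) * e l i * (e k j * cnj (e l j)))"
      unfolding cvec_inner_def p_def cnj_sum sum_product by (simp add: mult_ac)
    also have "\<dots> = (\<Sum>k\<in>K. \<Sum>l\<in>K. cnj (e k i) * e l i * cvec_inner I (e k) (e l))"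
      unfolding cvec_inner_def sum_distrib_left
      by (subst sum.swap, rule sum.cong[OF refl], rule sum.swap)
    also have "\<dots> = of_real s"
      using fin by (simp add: on if_distrib[of "(*) _"] sum.delta cong: if_cong)
        (simp add: s_def complex_norm_square mult.commute del: of_real_power)
    finally have "(\<Sum>j\<in>I. (cmod (p j))\<^sup>2) = s"
      unfolding cvec_norm_sq using of_real_eq_iff by blast
    moreover have "(cmod (p i))\<^sup>2 \<le> (\<Sum>j\<in>I. (cmod (p j))\<^sup>2)"
      using i fin by (intro member_le_sum) auto
    moreover have "p i = of_real s"
      unfolding p_def s_def of_real_sum
      by (intro sum.cong refl) (simp add: complex_norm_square mult.commute del: of_real_power)
    ultimately have "s\<^sup>2 \<le> s * 1" by simp
    moreover have "s \<ge> 0" by (simp add: s_def sum_nonneg)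
    ultimately have "s \<le> 1"
      by (cases "s = 0") (auto simp: power2_eq_square)
    then show ?thesis by (simp add: s_def)
  qed
  have "(\<Sum>i\<in>I. (cmod (e k i))\<^sup>2) = 1" if "k \<in> K" for k
  proof -
    have "complex_of_real ((cvec_norm I (e k))\<^sup>2) = of_real 1"
      unfolding cvec_inner_self[symmetric] using on[OF that that] by simp
    then show ?thesis unfolding of_real_eq_iff cvec_norm_sq .
  qed
  then have "real (card K) = (\<Sum>k\<in>K. \<Sum>i\<in>I. (cmod (e k i))\<^sup>2)"
    by simp
  also have "\<dots> = (\<Sum>i\<in>I. \<Sum>k\<in>K. (cmod (e k i))\<^sup>2)"
    by (rule sum.swap)
  also have "\<dots> \<le> (\<Sum>i\<in>I. 1)"
    by (intro sum_mono bessel)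
  finally show ?thesis by simp
qed

text \<open>
  Eigenvectors to different eigenvalues are orthogonal, hence there are at most \<open>card I\<close>
  eigenvalues.  Without this, \<^const>\<open>Min\<close> and \<^const>\<open>Max\<close> of the set of eigenvalues would carry no information.
\<close>

lemma finite_eigenvalues:
  assumes fin: "finite I" and H: "herm_on I M"
  shows "finite {c::real. is_eigenvalue I M (of_real c)}" (is "finite ?E")
proof -
  have "card K \<le> card I" if K: "K \<subseteq> ?E" "finite K" for K
  proof -
    have "\<exists>x. cvec_norm I x = 1 \<and> (\<forall>i\<in>I. mat_vec I M x i = of_real c * x i)"
      if c: "c \<in> K" for c
    proof -
      obtain x where x: "x \<in> cvecs I" "x \<noteq> (\<lambda>_. 0)" "\<forall>i\<in>I. mat_vec I M x i = of_real c * x i"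
        using c K unfolding is_eigenvalue_def by blast
      then have "cvec_norm I x \<noteq> 0" using cvec_norm_eq_0[OF fin] by blast
      moreover have "cvec_norm I x \<ge> 0" by (simp add: cvec_norm_def)
      ultimately show ?thesis
        using x by (intro exI[of _ "\<lambda>i. of_real (1 / cvec_norm I x) * x i"] conjI)
          (simp_all only: cvec_norm_scale mat_vec_scale norm_of_real, simp_all add: mult.left_commute)
    qed
    then obtain e where e: "\<And>c. c \<in> K \<Longrightarrow> cvec_norm I (e c) = 1"
        "\<And>c. c \<in> K \<Longrightarrow> \<forall>i\<in>I. mat_vec I M (e c) i = of_real c * e c i"
      by metis
    have "cvec_inner I (e k) (e l) = (if k = l then 1 else 0)" if "k \<in> K" "l \<in> K" for k l
      using e that eigenvectors_orthogonal[OF H, of "e k" k "e l" l] by (auto simp: cvec_inner_self)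
    then show ?thesis
      by (rule card_orthonormal_le[OF fin K(2)])
  qed
  then show ?thesis
    using finite_if_finite_subsets_card_bdd by blast
qed

text \<open>
  If \<open>Mz\<close> were nonzero, a small step from \<open>z\<close> in the direction \<open>-Mz\<close> would make
  the form negative: the linear term \<open>-2 t \<parallel>Mz\<parallel>\<^sup>2\<close> beats the quadratic one.
\<close>

lemma nonneg_quadratic_form_zero:
  assumes fin: "finite I" and H: "herm_on I M"
    and nonneg: "\<And>x. x \<in> cvecs I \<Longrightarrow> 0 \<le> Re (cvec_inner I (mat_vec I M x) x)"
    and z: "z \<in> cvecs I" "Re (cvec_inner I (mat_vec I M z) z) = 0"
  shows "\<forall>i\<in>I. mat_vec I M z i = 0"
proof -
  define r where "r = (\<lambda>i. if i \<in> I then mat_vec I M z i else 0)"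
  have r: "r \<in> cvecs I" by (simp add: r_def cvecs_def)
  define A where "A = Re (cvec_inner I (mat_vec I M r) r)"
  define R where "R = (cvec_norm I r)\<^sup>2"
  have Mzr: "cvec_inner I (mat_vec I M z) r = of_real R"
    unfolding R_def cvec_inner_self[symmetric] by (rule cvec_inner_cong) (auto simp: r_def)
  then have Mrz: "cvec_inner I (mat_vec I M r) z = of_real R"
    by (metis herm_on_inner[OF H] cvec_inner_commute complex_cnj_complex_of_real)
  have key: "2 * t * R \<le> t\<^sup>2 * A" for t :: real
  proof -
    define y where "y = (\<lambda>i. z i - of_real t * r i)"
    have y: "y \<in> cvecs I" using z r by (simp add: y_def cvecs_def)
    have "mat_vec I M y = (\<lambda>i. mat_vec I M z i - of_real t * mat_vec I M r i)"
      by (simp add: y_def mat_vec_def algebra_simps sum_subtractf sum_distrib_left)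
    then have "cvec_inner I (mat_vec I M y) y = cvec_inner I (mat_vec I M z) z
        - of_real t * cvec_inner I (mat_vec I M z) r - of_real t * cvec_inner I (mat_vec I M r) z
        + of_real (t\<^sup>2) * cvec_inner I (mat_vec I M r) r"
      by (simp add: y_def cvec_inner_def algebra_simps sum_subtractf sum.distrib sum_distrib_left power2_eq_square)
    then have "Re (cvec_inner I (mat_vec I M y) y) = - 2 * t * R + t\<^sup>2 * A"
      using z(2) by (simp add: Mzr Mrz A_def power2_eq_square)
    then show ?thesis using nonneg[OF y] by simp
  qed
  have "R = 0"
  proof (rule ccontr)
    assume "R \<noteq> 0"
    then have R: "R > 0" by (simp add: R_def)
    have A: "A > 0" using key[of 1] R by simp
    have "2 * (R / A) * R \<le> (R / A)\<^sup>2 * A" by (rule key)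
    then show False using R A by (simp add: power2_eq_square field_simps)
  qed
  then have "r = (\<lambda>_. 0)" using cvec_norm_eq_0[OF fin r] by (simp add: R_def)
  then show ?thesis by (metis r_def)
qed

lemma quadratic_form_shift:
  "Re (cvec_inner I (mat_vec I M x) x) - c * (cvec_norm I x)\<^sup>2
   = Re (cvec_inner I (\<lambda>i. mat_vec I M x i - of_real c * x i) x)"
proof -
  have "cvec_inner I (\<lambda>i. mat_vec I M x i - of_real c * x i) x =
    cvec_inner I (mat_vec I M x) x - of_real c * cvec_inner I x x"
    by (simp add: cvec_inner_def sum_subtractf sum_distrib_left algebra_simps)
  then show ?thesis by (simp add: cvec_inner_self)
qed

lemma eigenvalue_of_minimum:
  assumes fin: "finite I" and H: "herm_on I M"
    and min: "\<And>x. x \<in> cvecs I \<Longrightarrow> c * (cvec_norm I x)\<^sup>2 \<le> Re (cvec_inner I (mat_vec I M x) x)"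
    and z: "z \<in> cvecs I" "Re (cvec_inner I (mat_vec I M z) z) = c * (cvec_norm I z)\<^sup>2"
  shows "\<forall>i\<in>I. mat_vec I M z i = of_real c * z i"
proof -
  define N where "N = (\<lambda>i j. M i j - (if i = j then of_real c else 0))"
  have N: "mat_vec I N x i = mat_vec I M x i - of_real c * x i" if "i \<in> I" for x i
    using that fin
    by (simp add: N_def mat_vec_def left_diff_distrib sum_subtractf if_distrib[of "\<lambda>a. a * _"] cong: if_cong)
  have q: "Re (cvec_inner I (mat_vec I N x) x)
      = Re (cvec_inner I (mat_vec I M x) x) - c * (cvec_norm I x)\<^sup>2" for x
    unfolding quadratic_form_shift
    by (rule arg_cong[where f = Re], rule cvec_inner_cong) (simp_all add: N)
  have "herm_on I N"
    unfolding herm_on_def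
  proof (intro ballI)
    fix i j assume "i \<in> I" "j \<in> I"
    then have "M j i = cnj (M i j)" using H unfolding herm_on_def by blast
    then show "N j i = cnj (N i j)" by (simp add: N_def)
  qed
  then have "\<forall>i\<in>I. mat_vec I N z i = 0"
    by (rule nonneg_quadratic_form_zero[OF fin]) (use min z q in auto)
  then show ?thesis by (simp add: N)
qed

text \<open>
  The Rayleigh quotient attains its minimum on the compact unit sphere, the minimizer is an
  eigenvector by the previous lemma, and inserting any other eigenvector into the form shows that
  its eigenvalue is not smaller.
\<close>

theorem smallest_eigenvalue_variational:
  assumes fin: "finite I" and ne: "I \<noteq> {}" and H: "herm_on I M"
  shows "is_eigenvalue I M (of_real (smallest_eigenvalue I M))"
    and "x \<in> cvecs I \<Longrightarrow>
      smallest_eigenvalue I M * (cvec_norm I x)\<^sup>2 \<le> Re (cvec_inner I (mat_vec I M x) x)"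
proof -
  define q where "q = (\<lambda>x. Re (cvec_inner I (mat_vec I M x) x))"
  have cont: "continuous_on UNIV q"
    unfolding q_def cvec_inner_def mat_vec_def
    by (intro continuous_intros continuous_on_product_coordinates)
  obtain i0 where "i0 \<in> I" using ne by blast
  then have x0: "(\<lambda>i. if i = i0 then 1 else 0) \<in> cvecs I" "(\<lambda>i. if i = i0 then 1 else 0) \<noteq> (\<lambda>_. 0::complex)"
    by (auto simp: cvecs_def fun_eq_iff)
  obtain z where z: "z \<in> cvecs I" "cvec_norm I z = 1"
    and zmin: "\<And>x. x \<in> cvecs I \<Longrightarrow> cvec_norm I x = 1 \<Longrightarrow> q z \<le> q x"
    using minimizer_on_sphere_section[of I "{}", OF fin _ x0 _ cont] by auto
  have min: "q z * (cvec_norm I x)\<^sup>2 \<le> q x" if x: "x \<in> cvecs I" for x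
  proof (cases "cvec_norm I x = 0")
    case True
    then have "x = (\<lambda>_. 0)" using cvec_norm_eq_0[OF fin x] by simp
    with True show ?thesis by (simp add: q_def cvec_inner_def)
  next
    case False
    define c where "c = 1 / cvec_norm I x"
    have n: "cvec_norm I x > 0" using False by (metis L2_set_nonneg cvec_norm_def less_eq_real_def)
    have "q z \<le> q (\<lambda>i. of_real c * x i)"
      using n by (intro zmin cvecs_scale x) (simp only: cvec_norm_scale, simp add: c_def norm_divide)
    also have "cvec_inner I (mat_vec I M (\<lambda>i. of_real c * x i)) (\<lambda>i. of_real c * x i)
       = of_real (c\<^sup>2) * cvec_inner I (mat_vec I M x) x"
      unfolding mat_vec_scale by (simp add: cvec_inner_def sum_distrib_left power2_eq_square mult_ac)
    then have "q (\<lambda>i. of_real c * x i) = c\<^sup>2 * q x" by (simp add: q_def)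
    finally show ?thesis using n by (simp add: c_def field_simps)
  qed
  have eig: "is_eigenvalue I M (of_real (q z))"
    unfolding is_eigenvalue_def
  proof (intro bexI[of _ z] conjI)
    show "z \<noteq> (\<lambda>_. 0)" using z by (auto simp: cvec_norm_def L2_set_def)
    show "\<forall>i\<in>I. mat_vec I M z i = complex_of_real (q z) * z i"
      by (rule eigenvalue_of_minimum[OF fin H _ z(1)]) (use min z(2) in \<open>auto simp: q_def\<close>)
  qed (fact z)
  have least: "q z \<le> c" if c: "is_eigenvalue I M (of_real c)" for c
  proof -
    obtain x where x: "x \<in> cvecs I" "x \<noteq> (\<lambda>_. 0)" "\<forall>i\<in>I. mat_vec I M x i = of_real c * x i"
      using c unfolding is_eigenvalue_def by blast
    have "cvec_inner I (mat_vec I M x) x = of_real c * cvec_inner I x x"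
      using x(3) by (simp add: cvec_inner_def sum_distrib_left mult.assoc)
    then have "q x = c * (cvec_norm I x)\<^sup>2" by (simp add: q_def cvec_inner_self)
    moreover have "(cvec_norm I x)\<^sup>2 > 0" using cvec_norm_eq_0[OF fin x(1)] x(2) by auto
    ultimately show ?thesis using min[OF x(1)] by simp
  qed
  have "smallest_eigenvalue I M = q z"
    unfolding smallest_eigenvalue_def
    by (rule Min_eqI) (use eig least finite_eigenvalues[OF fin H] in auto)
  then show "is_eigenvalue I M (of_real (smallest_eigenvalue I M))"
    and "x \<in> cvecs I \<Longrightarrow> smallest_eigenvalue I M * (cvec_norm I x)\<^sup>2 \<le> Re (cvec_inner I (mat_vec I M x) x)"
    using eig min by (simp_all add: q_def)
qed

lemma is_eigenvalue_uminus: "is_eigenvalue I (\<lambda>i j. - M i j) (- c) \<longleftrightarrow> is_eigenvalue I M c"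
proof -
  have "mat_vec I (\<lambda>i j. - M i j) x i = - mat_vec I M x i" for x i
    by (simp add: mat_vec_def sum_negf)
  then show ?thesis by (simp add: is_eigenvalue_def)
qed

lemma largest_eigenvalue_uminus:
  assumes fin: "finite I" and ne: "I \<noteq> {}" and H: "herm_on I M"
  shows "largest_eigenvalue I M = - smallest_eigenvalue I (\<lambda>i j. - M i j)"
  unfolding largest_eigenvalue_def
proof (rule Max_eqI)
  note H' = herm_on_uminus[OF H]
  let ?s = "smallest_eigenvalue I (\<lambda>i j. - M i j)"
  show "finite {c::real. is_eigenvalue I M (of_real c)}"
    by (rule finite_eigenvalues[OF fin H])
  show "- ?s \<in> {c::real. is_eigenvalue I M (of_real c)}"
    using smallest_eigenvalue_variational(1)[OF fin ne H']
      is_eigenvalue_uminus[of I M "of_real (- ?s)"] by simp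
  fix c :: real assume "c \<in> {c::real. is_eigenvalue I M (of_real c)}"
  then have "is_eigenvalue I (\<lambda>i j. - M i j) (of_real (- c))"
    using is_eigenvalue_uminus[of I M "of_real c"] by simp
  then have "?s \<le> - c"
    unfolding smallest_eigenvalue_def using finite_eigenvalues[OF fin H'] by (intro Min_le) auto
  then show "c \<le> - ?s" by simp
qed

theorem largest_eigenvalue_variational:
  assumes fin: "finite I" and ne: "I \<noteq> {}" and H: "herm_on I M"
  shows "is_eigenvalue I M (of_real (largest_eigenvalue I M))"
    and "x \<in> cvecs I \<Longrightarrow>
      Re (cvec_inner I (mat_vec I M x) x) \<le> largest_eigenvalue I M * (cvec_norm I x)\<^sup>2"
proof -
  have H': "herm_on I (\<lambda>i j. - M i j)" using H by (rule herm_on_uminus)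
  show "is_eigenvalue I M (of_real (largest_eigenvalue I M))"
    using smallest_eigenvalue_variational(1)[OF fin ne H']
      is_eigenvalue_uminus[of I M "of_real (largest_eigenvalue I M)"]
    by (simp add: largest_eigenvalue_uminus[OF fin ne H])
  show "Re (cvec_inner I (mat_vec I M x) x) \<le> largest_eigenvalue I M * (cvec_norm I x)\<^sup>2"
    if "x \<in> cvecs I"
    using smallest_eigenvalue_variational(2)[OF fin ne H' that]
    by (simp add: largest_eigenvalue_uminus[OF fin ne H] mat_vec_def sum_negf cvec_inner_def)
qed


section \<open>Orthogonal projection onto a finite-dimensional span\<close>

text \<open>
  Gram-Schmidt: a new vector \<open>b\<close> is replaced by its component orthogonal to the span of
  the earlier ones, and the projection onto that line is added.  Finiteness of \<open>B\<close> replaces the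
  completeness that projections otherwise need.
\<close>

lemma exists_orthogonal_projection:
  fixes x :: "'x::real_inner"
  assumes "finite B"
  shows "\<exists>y\<in>span B. \<forall>b\<in>span B. inner (x - y) b = 0"
proof -
  have span: "\<forall>b\<in>span B. inner z b = 0" if "\<forall>b\<in>B. inner z b = 0" for z :: 'x and B
  proof
    fix b assume "b \<in> span B"
    then show "inner z b = 0"
      by (rule span_induct) (auto simp: that subspace_def inner_add_right)
  qed
  have "\<exists>y\<in>span B. \<forall>b\<in>B. inner (x - y) b = 0"
    using assms
  proof (induction B arbitrary: x)
    case empty
    then show ?case by auto
  next
    case (insert b B)
    obtain p where p: "p \<in> span B" "\<forall>c\<in>B. inner (b - p) c = 0" using insert.IH by blast
    obtain y where y: "y \<in> span B" "\<forall>c\<in>B. inner (x - y) c = 0" using insert.IH by blast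
    define b' where "b' = b - p"
    define y' where "y' = y + (inner (x - y) b' / inner b' b') *\<^sub>R b'"
    have sub: "span B \<subseteq> span (insert b B)" by (rule span_mono) auto
    have "b' \<in> span (insert b B)"
      unfolding b'_def using p(1) sub by (intro span_diff) (auto intro: span_base)
    then have "y' \<in> span (insert b B)"
      unfolding y'_def using y(1) sub by (intro span_add span_scale) auto
    moreover have B: "\<forall>c\<in>B. inner (x - y') c = 0"
      using p(2) y(2) by (simp add: y'_def b'_def[symmetric] inner_diff_left inner_add_left)
    moreover have "inner (x - y') b' = 0"
      by (cases "b' = 0") (simp_all add: y'_def inner_diff_left inner_add_left)
    then have "inner (x - y') b = 0"
      using span[OF B] p(1) by (simp add: b'_def inner_diff_right)
    ultimately show ?case by blast
  qed
  then show ?thesis using span by blast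
qed


section \<open>Hadamard's inequality and short vectors\<close>

text \<open>
  Subtracting from a row its projection onto the span of the rows treated before does not
  change the determinant and does not lengthen the row.
\<close>

lemma orthogonalize_rows:
  fixes A :: "real^'n^'n"
  assumes "finite S"
  shows "\<exists>B. det B = det A \<and> (\<forall>i. norm (B $ i) \<le> norm (A $ i)) \<and>
    (\<forall>i\<in>S. \<forall>j\<in>S. i \<noteq> j \<longrightarrow> B $ i \<bullet> B $ j = 0)"
  using assms
proof induction
  case empty
  then show ?case by blast
next
  case (insert k S)
  then obtain B where B: "det B = det A" "\<And>i. norm (B $ i) \<le> norm (A $ i)"
    "\<And>i j. i \<in> S \<Longrightarrow> j \<in> S \<Longrightarrow> i \<noteq> j \<Longrightarrow> B $ i \<bullet> B $ j = 0" by blast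
  obtain y where y: "y \<in> span (($) B ` S)" "\<And>b. b \<in> span (($) B ` S) \<Longrightarrow> (B $ k - y) \<bullet> b = 0"
    using exists_orthogonal_projection[of "($) B ` S" "B $ k"] insert.hyps(1) by auto
  define B' where "B' = (\<chi> i. if i = k then row k B + (- y) else row i B)"
  have "($) B ` S \<subseteq> {row j B |j. j \<noteq> k}"
    using insert.hyps(2) by (auto simp: row_def)
  then have "- y \<in> span {row j B |j. j \<noteq> k}"
    using span_mono y(1) by (intro span_neg) blast
  then have "det B' = det B"
    unfolding B'_def by (intro det_row_span) (simp add: span_vec_eq)
  moreover have "norm (B $ k - y) \<le> norm (B $ k)"
  proof (rule power2_le_imp_le)
    have "(B $ k - y) \<bullet> y = 0" by (rule y(2)[OF y(1)])
    then have "(norm (B $ k))\<^sup>2 = (norm (B $ k - y))\<^sup>2 + (norm y)\<^sup>2"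
      by (simp add: power2_norm_eq_inner inner_diff_left inner_diff_right inner_commute)
    then show "(norm (B $ k - y))\<^sup>2 \<le> (norm (B $ k))\<^sup>2" by simp
  qed simp
  then have "norm (B' $ i) \<le> norm (A $ i)" for i
    using B(2)[of i] by (auto simp: B'_def row_def)
  moreover have "(B $ k - y) \<bullet> B $ j = 0" if "j \<in> S" for j
    using y(2) that by (simp add: span_base)
  then have "\<forall>i\<in>insert k S. \<forall>j\<in>insert k S. i \<noteq> j \<longrightarrow> B' $ i \<bullet> B' $ j = 0"
    using B(3) insert.hyps(2) by (auto simp: B'_def row_def inner_commute)
  ultimately show ?case using B(1) by (intro exI[of _ B']) auto
qed

text \<open>
  For pairwise orthogonal rows \<open>B B\<^sup>T\<close> is diagonal and the inequality is an
  equality; the previous lemma reduces to this case.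
\<close>

theorem hadamard_inequality:
  fixes A :: "real^'n^'n"
  shows "(det A)\<^sup>2 \<le> (\<Prod>i\<in>UNIV. (norm (A $ i))\<^sup>2)"
proof -
  obtain B where B: "det B = det A" "\<And>i. norm (B $ i) \<le> norm (A $ i)"
    "\<And>i j. i \<noteq> j \<Longrightarrow> B $ i \<bullet> B $ j = 0"
    using orthogonalize_rows[of UNIV A] by auto
  have entry: "(B ** transpose B) $ i $ j = B $ i \<bullet> B $ j" for i j
    by (simp add: matrix_matrix_mult_def transpose_def inner_vec_def)
  have "(det A)\<^sup>2 = det (B ** transpose B)"
    by (simp add: det_mul B(1) power2_eq_square)
  also have "\<dots> = (\<Prod>i\<in>UNIV. (B ** transpose B) $ i $ i)"
    by (rule det_diagonal) (simp add: entry B(3))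
  also have "\<dots> = (\<Prod>i\<in>UNIV. (norm (B $ i))\<^sup>2)"
    by (simp add: entry power2_norm_eq_inner)
  also have "\<dots> \<le> (\<Prod>i\<in>UNIV. (norm (A $ i))\<^sup>2)"
    by (intro prod_mono conjI power_mono B) auto
  finally show ?thesis .
qed

lemma prod_le_mean_power:
  fixes x :: "'a \<Rightarrow> real"
  assumes "finite S" "S \<noteq> {}" "\<And>i. i \<in> S \<Longrightarrow> x i \<ge> 0"
  shows "(\<Prod>i\<in>S. x i) \<le> ((\<Sum>i\<in>S. x i) / card S) ^ card S"
proof -
  let ?P = "\<Prod>i\<in>S. x i"
  have P: "?P \<ge> 0" by (simp add: prod_nonneg assms)
  have c: "card S > 0" using assms by (simp add: card_gt_0_iff)
  have "?P = (?P powr (1 / card S)) ^ card S"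
    using P c by (cases "?P = 0") (simp_all add: powr_power)
  also have "\<dots> \<le> (\<Sum>i\<in>S. x i / card S) ^ card S"
    using arith_geom_mean[OF assms] by (intro power_mono) auto
  finally show ?thesis by (simp add: sum_divide_distrib)
qed

text \<open>
  Rotate the coordinate system so that \<open>u\<close> becomes a coordinate vector.  One column of the
  rotated matrix is then \<open>A u\<close>.  By Hadamard's inequality the product of the squared lengths of all
  columns is at least \<open>1\<close>; the other \<open>n - 1\<close> factors are controlled by the arithmetic-geometric mean
  inequality, because the sum of the squared column lengths is invariant under rotation.
\<close>

theorem short_vector_lower_bound:
  fixes A :: "real^'n^'n" and u :: "real^'n"
  assumes det: "\<bar>det A\<bar> \<ge> 1" and u: "norm u = 1" and card: "CARD('n) \<ge> 2"
  shows "((real CARD('n) - 1) / (\<Sum>j\<in>UNIV. (norm (A $ j))\<^sup>2)) ^ (CARD('n) - 1) \<le> (norm (A *v u))\<^sup>2"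
proof -
  define n where "n = CARD('n) - 1"
  define C where "C = (\<Sum>j\<in>UNIV. (norm (A $ j))\<^sup>2)"
  obtain k :: 'n where True by simp
  obtain Q :: "real^'n^'n" where Q: "orthogonal_matrix Q" "Q *v axis k 1 = u"
    using orthogonal_matrix_exists_basis[OF u] by blast
  define M where "M = transpose (A ** Q)"
  have Mk: "M $ k = A *v u"
    unfolding Q(2)[symmetric] M_def
    by (simp add: matrix_vector_mul_assoc matrix_vector_mul_component vec_eq_iff transpose_def
        matrix_vector_mult_basis column_def matrix_matrix_mult_def inner_vec_def)
  have "(det M)\<^sup>2 = (det A)\<^sup>2 * (det Q)\<^sup>2"
    by (simp add: M_def det_mul power_mult_distrib)
  also have "(det Q)\<^sup>2 = 1"
    using det_orthogonal_matrix[OF Q(1)] by (auto simp: power2_eq_1_iff)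
  finally have "1 \<le> (det M)\<^sup>2"
    using det by (metis mult.right_neutral one_le_power power2_abs)
  also have "\<dots> \<le> (\<Prod>i\<in>UNIV. (norm (M $ i))\<^sup>2)" by (rule hadamard_inequality)
  also have "\<dots> = (norm (A *v u))\<^sup>2 * (\<Prod>i\<in>UNIV-{k}. (norm (M $ i))\<^sup>2)"
    by (subst prod.remove[of _ k]) (auto simp: Mk)
  finally have 1: "1 \<le> (norm (A *v u))\<^sup>2 * (\<Prod>i\<in>UNIV-{k}. (norm (M $ i))\<^sup>2)" .
  have row: "norm (row j (A ** Q)) = norm (A $ j)" for j
  proof -
    have "row j (A ** Q) = transpose Q *v (A $ j)"
      by (simp add: row_def vec_eq_iff matrix_matrix_mult_def matrix_vector_mult_def transpose_def mult.commute)
    moreover have "orthogonal_transformation ((*v) (transpose Q))"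
      using Q(1) by (simp add: orthogonal_transformation_matrix)
    ultimately show ?thesis by (metis orthogonal_transformation_norm)
  qed
  have "(\<Sum>i\<in>UNIV. (norm (M $ i))\<^sup>2) = (\<Sum>i\<in>UNIV. \<Sum>j\<in>UNIV. ((A ** Q) $ j $ i)\<^sup>2)"
    by (simp add: M_def transpose_def power2_norm_eq_inner inner_vec_def power2_eq_square[of "_ $ _"])
  also have "\<dots> = (\<Sum>j\<in>UNIV. \<Sum>i\<in>UNIV. ((A ** Q) $ j $ i)\<^sup>2)" by (rule sum.swap)
  also have "\<dots> = (\<Sum>j\<in>UNIV. (norm (row j (A ** Q)))\<^sup>2)"
    by (simp add: row_def power2_norm_eq_inner inner_vec_def power2_eq_square[of "_ $ _"])
  also have "\<dots> = C" by (simp add: row C_def)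
  finally have sumM: "(\<Sum>i\<in>UNIV. (norm (M $ i))\<^sup>2) = C" .
  have n: "n > 0" "card (UNIV - {k}) = n" using card by (simp_all add: n_def)
  have "(\<Prod>i\<in>UNIV-{k}. (norm (M $ i))\<^sup>2) \<le> ((\<Sum>i\<in>UNIV-{k}. (norm (M $ i))\<^sup>2) / n) ^ n"
    using prod_le_mean_power[of "UNIV - {k}" "\<lambda>i. (norm (M $ i))\<^sup>2"] n by (metis card_gt_0_iff zero_le_power2)
  also have "(\<Sum>i\<in>UNIV-{k}. (norm (M $ i))\<^sup>2) \<le> C"
    unfolding sumM[symmetric] by (rule sum_mono2) auto
  then have "((\<Sum>i\<in>UNIV-{k}. (norm (M $ i))\<^sup>2) / n) ^ n \<le> (C / n) ^ n"
    by (intro power_mono divide_right_mono) (auto intro!: divide_nonneg_nonneg sum_nonneg)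
  finally have 2: "(\<Prod>i\<in>UNIV-{k}. (norm (M $ i))\<^sup>2) \<le> (C / n) ^ n" .
  have 3: "1 \<le> (norm (A *v u))\<^sup>2 * (C / n) ^ n"
    using 1 mult_left_mono[OF 2, of "(norm (A *v u))\<^sup>2"] by simp
  have "C \<ge> 0" by (simp add: C_def sum_nonneg)
  moreover have "C \<noteq> 0" using 3 n by (auto simp: power_0_left)
  ultimately have "C > 0" by simp
  then have "(n / C) ^ n * (C / n) ^ n = 1"
    using n by (simp add: power_mult_distrib[symmetric])
  moreover have "(n / C) ^ n \<ge> 0" using \<open>C \<ge> 0\<close> by simp
  then have "(n / C) ^ n * 1 \<le> (n / C) ^ n * ((norm (A *v u))\<^sup>2 * (C / n) ^ n)"
    by (intro mult_left_mono 3)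
  moreover have "(n / C) ^ n * ((norm (A *v u))\<^sup>2 * (C / n) ^ n)
      = (norm (A *v u))\<^sup>2 * ((n / C) ^ n * (C / n) ^ n)" by (rule mult.left_commute)
  ultimately have "(n / C) ^ n \<le> (norm (A *v u))\<^sup>2" by simp
  moreover have "real n = real CARD('n) - 1" using card by (simp add: n_def of_nat_diff)
  ultimately show ?thesis by (simp add: C_def n_def)
qed


section \<open>Finitely supported functions as an inner product space\<close>

text \<open>
  The vertex and edge sets of the fundamental graph are sets and not types.  The vector spaces over
  them are subspaces of one space of finitely supported functions, which carries the
  \<open>\<ell>\<^sup>2\<close> inner product, so that norms and inner products of the type classes are at hand.
\<close>

instantiation poly_mapping :: (type, real_vector) real_vector
begin

lift_definition scaleR_poly_mapping :: "real \<Rightarrow> ('a \<Rightarrow>\<^sub>0 'b) \<Rightarrow> ('a \<Rightarrow>\<^sub>0 'b)"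
  is "\<lambda>c f i. c *\<^sub>R f i"
  by (erule finite_subset[rotated]) auto

instance
  by standard (transfer, simp add: fun_eq_iff scaleR_add_right scaleR_add_left)+

end

lemma lookup_scaleR [simp]: "Poly_Mapping.lookup (c *\<^sub>R f) i = c *\<^sub>R Poly_Mapping.lookup f i"
  by transfer simp

instantiation poly_mapping :: (type, real_normed_vector) real_normed_vector
begin

definition norm_poly_mapping :: "('a \<Rightarrow>\<^sub>0 'b) \<Rightarrow> real" where
  "norm_poly_mapping f = L2_set (\<lambda>i. norm (Poly_Mapping.lookup f i)) (Poly_Mapping.keys f)"

definition dist_poly_mapping :: "('a \<Rightarrow>\<^sub>0 'b) \<Rightarrow> ('a \<Rightarrow>\<^sub>0 'b) \<Rightarrow> real" where
  "dist_poly_mapping f g = norm (f - g)"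

definition sgn_poly_mapping :: "('a \<Rightarrow>\<^sub>0 'b) \<Rightarrow> ('a \<Rightarrow>\<^sub>0 'b)" where
  "sgn_poly_mapping f = f /\<^sub>R norm f"

definition uniformity_poly_mapping :: "(('a \<Rightarrow>\<^sub>0 'b) \<times> ('a \<Rightarrow>\<^sub>0 'b)) filter" where
  "uniformity_poly_mapping = (INF e\<in>{0 <..}. principal {(f, g). dist f g < e})"

definition open_poly_mapping :: "('a \<Rightarrow>\<^sub>0 'b) set \<Rightarrow> bool" where
  "open_poly_mapping U \<longleftrightarrow> (\<forall>f\<in>U. eventually (\<lambda>(f', g). f' = f \<longrightarrow> g \<in> U) uniformity)"

lemma norm_poly_mapping_superset:
  fixes f :: "'a \<Rightarrow>\<^sub>0 'b"
  assumes "finite S" "Poly_Mapping.keys f \<subseteq> S"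
  shows "norm f = L2_set (\<lambda>i. norm (Poly_Mapping.lookup f i)) S"
  unfolding norm_poly_mapping_def L2_set_def
  by (intro arg_cong[where f = sqrt] sum.mono_neutral_left) (use assms in \<open>auto simp: in_keys_iff\<close>)

instance
proof
  fix f g :: "'a \<Rightarrow>\<^sub>0 'b" and c :: real
  show "norm f = 0 \<longleftrightarrow> f = 0"
    unfolding norm_poly_mapping_def
    by (subst L2_set_eq_0_iff) (auto simp: poly_mapping_eq_iff fun_eq_iff in_keys_iff)
  let ?S = "Poly_Mapping.keys f \<union> Poly_Mapping.keys g"
  have "norm (f + g) = L2_set (\<lambda>i. norm (Poly_Mapping.lookup f i + Poly_Mapping.lookup g i)) ?S"
    by (subst norm_poly_mapping_superset[of ?S]) (auto simp: lookup_add in_keys_iff)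
  also have "\<dots> \<le> L2_set (\<lambda>i. norm (Poly_Mapping.lookup f i) + norm (Poly_Mapping.lookup g i)) ?S"
    by (intro L2_set_mono norm_triangle_ineq) auto
  also have "\<dots> \<le> norm f + norm g"
    by (subst (1 2) norm_poly_mapping_superset[of ?S]) (auto intro: L2_set_triangle_ineq)
  finally show "norm (f + g) \<le> norm f + norm g" .
  have "norm (c *\<^sub>R f) = L2_set (\<lambda>i. \<bar>c\<bar> * norm (Poly_Mapping.lookup f i)) (Poly_Mapping.keys f)"
    by (subst norm_poly_mapping_superset[of "Poly_Mapping.keys f"]) (auto simp: in_keys_iff)
  then show "norm (c *\<^sub>R f) = \<bar>c\<bar> * norm f"
    by (simp add: norm_poly_mapping_def L2_set_right_distrib)
qed (rule dist_poly_mapping_def sgn_poly_mapping_def uniformity_poly_mapping_def open_poly_mapping_def)+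

end

instantiation poly_mapping :: (type, real_inner) real_inner
begin

definition inner_poly_mapping :: "('a \<Rightarrow>\<^sub>0 'b) \<Rightarrow> ('a \<Rightarrow>\<^sub>0 'b) \<Rightarrow> real" where
  "inner_poly_mapping f g = (\<Sum>i\<in>Poly_Mapping.keys f. inner (Poly_Mapping.lookup f i) (Poly_Mapping.lookup g i))"

lemma inner_poly_mapping_superset:
  fixes f g :: "'a \<Rightarrow>\<^sub>0 'b"
  assumes "finite S" "Poly_Mapping.keys f \<subseteq> S"
  shows "inner f g = (\<Sum>i\<in>S. inner (Poly_Mapping.lookup f i) (Poly_Mapping.lookup g i))"
  unfolding inner_poly_mapping_def
  by (intro sum.mono_neutral_left) (use assms in \<open>auto simp: in_keys_iff\<close>)

instance
proof
  fix f g h :: "'a \<Rightarrow>\<^sub>0 'b" and c :: real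
  let ?S = "Poly_Mapping.keys f \<union> Poly_Mapping.keys g"
  have S: "inner f h = (\<Sum>i\<in>?S. inner (Poly_Mapping.lookup f i) (Poly_Mapping.lookup h i))"
    "inner g h = (\<Sum>i\<in>?S. inner (Poly_Mapping.lookup g i) (Poly_Mapping.lookup h i))" for h
    by (rule inner_poly_mapping_superset; simp)+
  show "inner f g = inner g f" by (simp only: S inner_commute)
  have "inner (f + g) h = (\<Sum>i\<in>?S. inner (Poly_Mapping.lookup (f + g) i) (Poly_Mapping.lookup h i))"
    by (rule inner_poly_mapping_superset) (auto simp: in_keys_iff lookup_add)
  then show "inner (f + g) h = inner f h + inner g h"
    by (simp add: S lookup_add inner_add_left sum.distrib)
  have "inner (c *\<^sub>R f) h = (\<Sum>i\<in>?S. inner (Poly_Mapping.lookup (c *\<^sub>R f) i) (Poly_Mapping.lookup h i))"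
    by (rule inner_poly_mapping_superset) (auto simp: in_keys_iff)
  then show "inner (c *\<^sub>R f) h = c * inner f h"
    by (simp add: S sum_distrib_left)
  have sq: "inner f f = (\<Sum>i\<in>Poly_Mapping.keys f. (norm (Poly_Mapping.lookup f i))\<^sup>2)"
    by (simp add: inner_poly_mapping_def power2_norm_eq_inner)
  show "0 \<le> inner f f" by (simp add: sq sum_nonneg)
  show norm: "norm f = sqrt (inner f f)"
    by (simp add: sq norm_poly_mapping_def L2_set_def)
  show "inner f f = 0 \<longleftrightarrow> f = 0"
    using norm by (metis norm_eq_zero real_sqrt_eq_zero_cancel_iff)
qed

end

definition vec_on :: "'i set \<Rightarrow> ('i \<Rightarrow> complex) \<Rightarrow> 'i \<Rightarrow>\<^sub>0 complex" where
  "vec_on I f = Abs_poly_mapping (\<lambda>i. if i \<in> I then f i else 0)"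

context
  fixes I :: "'i set"
  assumes fin: "finite I"
begin

lemma lookup_vec_on: "Poly_Mapping.lookup (vec_on I f) i = (if i \<in> I then f i else 0)"
proof -
  have "finite {i. (if i \<in> I then f i else 0) \<noteq> 0}"
    by (rule finite_subset[OF _ fin]) auto
  then show ?thesis by (simp add: vec_on_def)
qed

lemma keys_vec_on: "Poly_Mapping.keys (vec_on I f) \<subseteq> I"
  by (auto simp: in_keys_iff lookup_vec_on split: if_splits)

lemma vec_on_lookup: "Poly_Mapping.keys x \<subseteq> I \<Longrightarrow> vec_on I (Poly_Mapping.lookup x) = x"
  by (rule poly_mapping_eqI) (auto simp: lookup_vec_on in_keys_iff)

lemma inner_vec_on: "inner (vec_on I f) (vec_on I g) = Re (cvec_inner I f g)"
  by (subst inner_poly_mapping_superset[OF fin keys_vec_on])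
    (simp add: lookup_vec_on cvec_inner_def inner_complex_def Re_sum)

lemma norm_vec_on: "norm (vec_on I f) = cvec_norm I f"
  by (subst norm_poly_mapping_superset[OF fin keys_vec_on])
    (auto simp: lookup_vec_on cvec_norm_def intro!: L2_set_cong)

end

lemma subspace_keys: "subspace {x :: 'i \<Rightarrow>\<^sub>0 complex. Poly_Mapping.keys x \<subseteq> I}"
proof -
  have "Poly_Mapping.keys (x + y) \<subseteq> I" if "Poly_Mapping.keys x \<subseteq> I" "Poly_Mapping.keys y \<subseteq> I"
    for x y :: "'i \<Rightarrow>\<^sub>0 complex"
    using Poly_Mapping.keys_add[of x y] that by blast
  moreover have "Poly_Mapping.keys (c *\<^sub>R x) \<subseteq> Poly_Mapping.keys x" for c and x :: "'i \<Rightarrow>\<^sub>0 complex"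
    by (auto simp: in_keys_iff)
  ultimately show ?thesis unfolding subspace_def by (metis keys_zero empty_subsetI mem_Collect_eq subset_trans)
qed


section \<open>Perturbation of a simple lowest eigenvalue\<close>

text \<open>
  \<open>lam t\<close> is the lowest eigenvalue of \<open>D(t)\<^sup>* D(t)\<close> on the subspace \<open>U\<close>; at \<open>t = 0\<close> it is \<open>0\<close> with
  eigenvector \<open>f0\<close>, and \<open>\<gamma>\<^sup>2\<close> is a lower bound for \<open>D(0)\<^sup>* D(0)\<close> on the complement \<open>G\<close> of the ground
  state.  Everything is phrased with the quadratic form; the eigenvalue equation is
  tested against all \<open>w \<in> U\<close>.  The spaces are real; for a complex problem \<open>G\<close> is the complex
  orthogonal complement, and the phase of the eigenvector can be chosen so that its component along
  \<open>f0\<close> is real, which is what the last assumption asks for.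
\<close>

locale kernel_perturbation =
  fixes D D' :: "real \<Rightarrow> 'x::real_inner \<Rightarrow> 'y::real_inner"
    and U G :: "'x set" and f0 :: 'x and K \<gamma> :: real and lam :: "real \<Rightarrow> real"
  assumes linear_D: "linear (D t)" and linear_D': "linear (D' t)"
    and subspace_U: "subspace U" and subspace_G: "subspace G" and G_sub: "G \<subseteq> U"
    and f0_U: "f0 \<in> U" and f0_orth: "g \<in> G \<Longrightarrow> inner f0 g = 0" and norm_f0: "norm f0 = 1"
    and K_pos: "K > 0"
    and norm_D: "x \<in> U \<Longrightarrow> norm (D t x) \<le> K * norm x"
    and norm_D': "x \<in> U \<Longrightarrow> norm (D' t x) \<le> K * norm x"
    and lipschitz_D: "x \<in> U \<Longrightarrow> norm (D s x - D t x) \<le> K * \<bar>s - t\<bar> * norm x"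
    and taylor_D: "x \<in> U \<Longrightarrow>
      norm (D s x - D t x - (s - t) *\<^sub>R D' t x) \<le> K * (s - t)\<^sup>2 * norm x"
    and kernel: "D 0 f0 = 0"
    and gap_pos: "\<gamma> > 0" and gap: "g \<in> G \<Longrightarrow> \<gamma> * norm g \<le> norm (D 0 g)"
    and lam_le: "x \<in> U \<Longrightarrow> lam t * (norm x)\<^sup>2 \<le> (norm (D t x))\<^sup>2"
    and eigenvector: "\<exists>x c g. x \<noteq> 0 \<and> g \<in> G \<and> x = c *\<^sub>R f0 + g \<and>
      (\<forall>w\<in>U. inner (D t x) (D t w) = lam t * inner x w)"
begin

text \<open>
  Insert the trial vector \<open>f0\<close>; as \<open>D(0) f0 = 0\<close>, its image under \<open>D(t)\<close> has length \<open>O(t)\<close>.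
\<close>

lemma lam_upper: "lam t \<le> K\<^sup>2 * t\<^sup>2"
proof -
  have "norm (D t f0) \<le> K * \<bar>t\<bar>"
    using lipschitz_D[OF f0_U, of t 0] by (simp add: kernel norm_f0)
  then have "(norm (D t f0))\<^sup>2 \<le> (K * \<bar>t\<bar>)\<^sup>2" by (rule power_mono) simp
  with lam_le[OF f0_U, of t] show ?thesis by (simp add: norm_f0 power_mult_distrib)
qed

text \<open>
  For \<open>\<bar>t\<bar> \<le> rad\<close> the perturbation costs at most a quarter of the gap: \<open>K \<bar>t\<bar> \<le> \<gamma> / 4\<close>.
\<close>

definition rad :: real where "rad = \<gamma> / (4 * K)"

lemma rad_pos: "rad > 0" using gap_pos K_pos by (simp add: rad_def)

text \<open>
  An eigenvector \<open>x = c f0 + g\<close> has \<open>\<parallel>D(t) x\<parallel> = O(t)\<close>, so also \<open>\<parallel>D(0) g\<parallel> = \<parallel>D(0) x\<parallel> = O(t)\<close>,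
  and the gap turns this into a bound for \<open>g\<close>.  Hence \<open>c\<close> cannot vanish and may be scaled to \<open>1\<close>.
\<close>

lemma normalized_eigenvector:
  assumes t: "\<bar>t\<bar> \<le> rad"
  shows "\<exists>g. g \<in> G \<and> norm g \<le> 4 * K / \<gamma> * \<bar>t\<bar> \<and>
    (\<forall>w\<in>U. inner (D t (f0 + g)) (D t w) = lam t * inner (f0 + g) w)"
proof -
  obtain x c g where x: "x \<noteq> 0" "g \<in> G" "x = c *\<^sub>R f0 + g"
    "\<forall>w\<in>U. inner (D t x) (D t w) = lam t * inner x w"
    using eigenvector by blast
  have gU: "g \<in> U" using x G_sub by blast
  have xU: "x \<in> U"
    using x(3) gU f0_U subspace_U by (simp add: subspace_add subspace_scale)
  have "(norm (D t x))\<^sup>2 = lam t * (norm x)\<^sup>2"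
    using x(4) xU by (simp add: power2_norm_eq_inner)
  also have "\<dots> \<le> (K * \<bar>t\<bar> * norm x)\<^sup>2"
    using mult_right_mono[OF lam_upper[of t], of "(norm x)\<^sup>2"] by (simp add: power_mult_distrib)
  finally have 1: "norm (D t x) \<le> K * \<bar>t\<bar> * norm x"
    by (rule power2_le_imp_le) (use K_pos in auto)
  have 2: "norm (D 0 x - D t x) \<le> K * \<bar>t\<bar> * norm x"
    using lipschitz_D[OF xU, of 0 t] by simp
  have "D 0 x = D 0 g"
    using x(3) linear_D[of 0] by (simp add: linear_add linear_scale kernel)
  then have "\<gamma> * norm g \<le> norm (D 0 x)" using gap[OF x(2)] by simp
  also have "\<dots> \<le> 2 * K * \<bar>t\<bar> * norm x"
    using norm_triangle_ineq[of "D 0 x - D t x" "D t x"] 1 2 by simp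
  finally have g_le: "\<gamma> * norm g \<le> 2 * K * \<bar>t\<bar> * norm x" .
  \<comment> \<open>By the choice of \<open>rad\<close> the component in \<open>G\<close> has at most half of the length of \<open>x\<close>.\<close>
  have "4 * K * \<bar>t\<bar> \<le> \<gamma>"
    using t K_pos by (simp add: rad_def field_simps)
  then have "2 * (2 * K * \<bar>t\<bar>) * norm x \<le> \<gamma> * norm x"
    by (intro mult_right_mono) auto
  then have "\<gamma> * (2 * norm g) \<le> \<gamma> * norm x" using g_le by simp
  then have half: "2 * norm g \<le> norm x" using gap_pos by simp
  have c: "c \<noteq> 0"
  proof
    assume "c = 0"
    then have "x = g" using x by simp
    then show False using half x(1) by simp
  qed
  have "norm x \<le> \<bar>c\<bar> + norm g"
    using x(3) norm_triangle_ineq[of "c *\<^sub>R f0" g] by (simp add: norm_f0)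
  then have "norm x \<le> 2 * \<bar>c\<bar>" using half by simp
  then have "2 * K * \<bar>t\<bar> * norm x \<le> 2 * K * \<bar>t\<bar> * (2 * \<bar>c\<bar>)"
    using K_pos by (intro mult_left_mono) auto
  then have "\<gamma> * norm g \<le> 4 * K * \<bar>t\<bar> * \<bar>c\<bar>" using g_le by (simp add: mult_ac)
  then have "norm (inverse c *\<^sub>R g) \<le> 4 * K / \<gamma> * \<bar>t\<bar>"
    using c gap_pos by (simp add: field_simps)
  moreover have "f0 + inverse c *\<^sub>R g = inverse c *\<^sub>R x"
    using c by (simp add: x(3) scaleR_add_right)
  ultimately show ?thesis
    using x(2,4) subspace_G linear_D[of t]
    by (intro exI[of _ "inverse c *\<^sub>R g"]) (simp add: subspace_scale linear_scale)
qed

text \<open>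
  The eigenvector at \<open>t\<close> is normalized to \<open>f0 + corr t\<close>, that is, by its component along \<open>f0\<close>
  and not by its length; the difference of two such eigenvectors then lies in \<open>G\<close>.
\<close>

definition corr :: "real \<Rightarrow> 'x" where
  "corr t = (SOME g. g \<in> G \<and> norm g \<le> 4 * K / \<gamma> * \<bar>t\<bar> \<and>
    (\<forall>w\<in>U. inner (D t (f0 + g)) (D t w) = lam t * inner (f0 + g) w))"

definition ev :: "real \<Rightarrow> 'x" where "ev t = f0 + corr t"

context
  fixes t assumes t: "\<bar>t\<bar> \<le> rad"
begin

lemma corr_G: "corr t \<in> G"
  and norm_corr: "norm (corr t) \<le> 4 * K / \<gamma> * \<bar>t\<bar>"
  and weak_eigen: "w \<in> U \<Longrightarrow> inner (D t (ev t)) (D t w) = lam t * inner (ev t) w"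
  using someI_ex[OF normalized_eigenvector[OF t]] unfolding corr_def[symmetric] ev_def by auto

lemma corr_U: "corr t \<in> U" using corr_G G_sub by blast

lemma ev_U: "ev t \<in> U"
  using corr_U f0_U subspace_U by (simp add: ev_def subspace_add)

lemma norm_ev_sq: "(norm (ev t))\<^sup>2 = 1 + (norm (corr t))\<^sup>2"
  using f0_orth[OF corr_G] norm_f0
  by (simp add: ev_def power2_norm_eq_inner inner_add inner_commute norm_eq_1)

lemma norm_ev_ge: "norm (ev t) \<ge> 1"
  by (rule power2_le_imp_le) (auto simp: norm_ev_sq)

lemma norm_corr_le_1: "norm (corr t) \<le> 1"
proof -
  have "4 * K / \<gamma> * \<bar>t\<bar> \<le> 4 * K / \<gamma> * rad"
    using t K_pos gap_pos by (intro mult_left_mono) auto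
  also have "\<dots> = 1" using K_pos gap_pos by (simp add: rad_def)
  finally show ?thesis using norm_corr by simp
qed

lemma norm_ev_le: "norm (ev t) \<le> 2"
  using norm_triangle_ineq[of f0 "corr t"] norm_corr_le_1 by (simp add: ev_def norm_f0)

lemma lam_eq: "lam t * (norm (ev t))\<^sup>2 = (norm (D t (ev t)))\<^sup>2"
  using weak_eigen[OF ev_U] by (simp add: power2_norm_eq_inner)

lemma lam_nonneg: "lam t \<ge> 0"
proof -
  have "(norm (ev t))\<^sup>2 > 0" using norm_ev_ge by auto
  moreover have "0 \<le> lam t * (norm (ev t))\<^sup>2" by (simp add: lam_eq)
  ultimately show ?thesis by (simp add: zero_le_mult_iff)
qed

lemma gap_near: "w \<in> G \<Longrightarrow> 3 / 4 * \<gamma> * norm w \<le> norm (D t w)"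
proof -
  assume w: "w \<in> G"
  then have wU: "w \<in> U" using G_sub by blast
  have "K * \<bar>t\<bar> * norm w \<le> \<gamma> / 4 * norm w"
    using t K_pos by (intro mult_right_mono) (auto simp: rad_def field_simps)
  moreover have "norm (D 0 w) \<le> norm (D t w) + K * \<bar>t\<bar> * norm w"
    using norm_triangle_ineq[of "D 0 w - D t w" "D t w"] lipschitz_D[OF wU, of 0 t] by simp
  ultimately show ?thesis using gap[OF w] by simp
qed

end

text \<open>
  The eigenvector at \<open>t\<close> as a trial vector at \<open>s\<close>.
\<close>

lemma lam_diff_le:
  assumes t: "\<bar>t\<bar> \<le> rad"
  shows "lam s - lam t \<le> ((norm (D s (ev t)))\<^sup>2 - (norm (D t (ev t)))\<^sup>2) / (norm (ev t))\<^sup>2"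
proof -
  have n: "(norm (ev t))\<^sup>2 > 0" using norm_ev_ge[OF t] by auto
  have "lam s * (norm (ev t))\<^sup>2 \<le> (norm (D s (ev t)))\<^sup>2"
    by (rule lam_le[OF ev_U[OF t]])
  then have "(lam s - lam t) * (norm (ev t))\<^sup>2 \<le> (norm (D s (ev t)))\<^sup>2 - (norm (D t (ev t)))\<^sup>2"
    using lam_eq[OF t] by (simp add: algebra_simps)
  then show ?thesis using n by (simp add: pos_le_divide_eq)
qed

lemma norm_sq_diff: "(norm a)\<^sup>2 - (norm b)\<^sup>2 = inner (a - b) (a + b)" for a b :: "'z::real_inner"
  by (simp add: power2_norm_eq_inner inner_simps inner_commute)

lemma lam_lipschitz_aux:
  assumes t: "\<bar>t\<bar> \<le> rad"
  shows "lam s - lam t \<le> 2 * K\<^sup>2 * \<bar>s - t\<bar>"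
proof -
  let ?x = "ev t"
  note xU = ev_U[OF t]
  have n: "(norm ?x)\<^sup>2 > 0" using norm_ev_ge[OF t] by auto
  have "(norm (D s ?x))\<^sup>2 - (norm (D t ?x))\<^sup>2 \<le> norm (D s ?x - D t ?x) * norm (D s ?x + D t ?x)"
    unfolding norm_sq_diff by (rule norm_cauchy_schwarz)
  also have "\<dots> \<le> (K * \<bar>s - t\<bar> * norm ?x) * (2 * K * norm ?x)"
    using norm_triangle_ineq[of "D s ?x" "D t ?x"] norm_D[OF xU, of s] norm_D[OF xU, of t]
    by (intro mult_mono lipschitz_D xU) (use K_pos in auto)
  also have "\<dots> = 2 * K\<^sup>2 * \<bar>s - t\<bar> * (norm ?x)\<^sup>2" by (simp add: power2_eq_square)
  finally show ?thesis
    using lam_diff_le[OF t, of s] n by (auto simp: pos_divide_le_eq intro: order_trans)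
qed

lemma lam_lipschitz:
  assumes "\<bar>t\<bar> \<le> rad" "\<bar>s\<bar> \<le> rad"
  shows "\<bar>lam s - lam t\<bar> \<le> 2 * K\<^sup>2 * \<bar>s - t\<bar>"
  using lam_lipschitz_aux[OF assms(1), of s] lam_lipschitz_aux[OF assms(2), of t]
  by (simp add: abs_le_iff abs_minus_commute)

text \<open>
  Subtract the eigenvalue equations at \<open>t\<close> and \<open>s\<close> and test with the difference \<open>w \<in> G\<close> of the
  eigenvectors.  On \<open>G\<close> the form of \<open>D(t)\<close> exceeds \<open>lam t \<parallel>w\<parallel>\<^sup>2\<close> by a multiple of \<open>\<parallel>w\<parallel>\<^sup>2\<close>, and the remaining
  terms are \<open>O(\<bar>s - t\<bar> \<parallel>w\<parallel>)\<close>.  In particular the normalized eigenvector is unique.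
\<close>

lemma ev_lipschitz:
  assumes t: "\<bar>t\<bar> \<le> rad" and s: "\<bar>s\<bar> \<le> rad"
  shows "norm (ev s - ev t) \<le> 16 * K\<^sup>2 / \<gamma>\<^sup>2 * \<bar>s - t\<bar>"
proof -
  define w where "w = ev t - ev s"
  let ?x = "ev s"
  have w: "w \<in> G"
    unfolding w_def ev_def using subspace_diff[OF subspace_G corr_G[OF t] corr_G[OF s]] by simp
  then have wU: "w \<in> U" using G_sub by blast
  note xU = ev_U[OF s]
  have "inner (D t (ev t)) (D t w) = lam t * inner (ev t) w"
    by (rule weak_eigen[OF t wU])
  moreover have "ev t = w + ?x" by (simp add: w_def)
  ultimately have "inner (D t w) (D t w) + inner (D t ?x) (D t w)
      = lam t * inner w w + lam t * inner ?x w"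
    using linear_D[of t] by (simp add: linear_add inner_add distrib_left)
  moreover have "inner (D s ?x) (D s w) = lam s * inner ?x w"
    by (rule weak_eigen[OF s wU])
  ultimately have eq: "(norm (D t w))\<^sup>2 - lam t * (norm w)\<^sup>2
      = inner (D s ?x) (D s w) - inner (D t ?x) (D t w) - (lam s - lam t) * inner ?x w"
    by (simp add: power2_norm_eq_inner algebra_simps)
  have "inner (D s ?x) (D s w) - inner (D t ?x) (D t w)
      = inner (D s ?x - D t ?x) (D s w) + inner (D t ?x) (D s w - D t w)"
    by (simp add: inner_simps)
  also have "\<dots> \<le> norm (D s ?x - D t ?x) * norm (D s w) + norm (D t ?x) * norm (D s w - D t w)"
    by (intro add_mono norm_cauchy_schwarz)
  also have "\<dots> \<le> (K * \<bar>s - t\<bar> * norm ?x) * (K * norm w) + (K * norm ?x) * (K * \<bar>s - t\<bar> * norm w)"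
    by (intro add_mono mult_mono lipschitz_D norm_D xU wU) (use K_pos in auto)
  also have "\<dots> = 2 * K\<^sup>2 * \<bar>s - t\<bar> * norm w * norm ?x" by (simp add: power2_eq_square)
  finally have A: "inner (D s ?x) (D s w) - inner (D t ?x) (D t w) \<le> 2 * K\<^sup>2 * \<bar>s - t\<bar> * norm w * norm ?x" .
  have "- ((lam s - lam t) * inner ?x w) \<le> \<bar>lam s - lam t\<bar> * \<bar>inner ?x w\<bar>"
    by (metis abs_ge_minus_self abs_mult)
  also have "\<dots> \<le> (2 * K\<^sup>2 * \<bar>s - t\<bar>) * (norm ?x * norm w)"
    by (intro mult_mono lam_lipschitz t s Cauchy_Schwarz_ineq2) auto
  finally have B: "- ((lam s - lam t) * inner ?x w) \<le> 2 * K\<^sup>2 * \<bar>s - t\<bar> * norm w * norm ?x"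
    by (simp add: mult_ac)
  have "2 * K\<^sup>2 * \<bar>s - t\<bar> * norm w * norm ?x \<le> 2 * K\<^sup>2 * \<bar>s - t\<bar> * norm w * 2"
    by (intro mult_left_mono norm_ev_le s) auto
  then have upper: "(norm (D t w))\<^sup>2 - lam t * (norm w)\<^sup>2 \<le> 8 * K\<^sup>2 * \<bar>s - t\<bar> * norm w"
    using eq A B by linarith
  have "(K * \<bar>t\<bar>)\<^sup>2 \<le> (\<gamma> / 4)\<^sup>2"
    using t K_pos by (intro power_mono) (auto simp: rad_def field_simps)
  then have "lam t \<le> \<gamma>\<^sup>2 / 16"
    using lam_upper[of t] by (simp add: power_mult_distrib power_divide)
  then have L: "lam t * (norm w)\<^sup>2 \<le> \<gamma>\<^sup>2 / 16 * (norm w)\<^sup>2"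
    by (rule mult_right_mono) simp
  have "(3 / 4 * \<gamma> * norm w)\<^sup>2 \<le> (norm (D t w))\<^sup>2"
    using gap_pos by (intro power_mono gap_near[OF t w]) auto
  then have "9 / 16 * \<gamma>\<^sup>2 * (norm w)\<^sup>2 \<le> (norm (D t w))\<^sup>2"
    by (simp add: power_mult_distrib power_divide)
  then have "\<gamma>\<^sup>2 / 2 * (norm w)\<^sup>2 \<le> 8 * K\<^sup>2 * \<bar>s - t\<bar> * norm w"
    using upper L by simp
  then have *: "norm w * (\<gamma>\<^sup>2 * norm w) \<le> norm w * (16 * K\<^sup>2 * \<bar>s - t\<bar>)"
    by (simp add: power2_eq_square mult_ac)
  have "\<gamma>\<^sup>2 * norm w \<le> 16 * K\<^sup>2 * \<bar>s - t\<bar>"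
  proof (cases "w = 0")
    case False
    then show ?thesis by (intro mult_left_le_imp_le[OF *]) simp
  qed simp
  then have "norm w \<le> 16 * K\<^sup>2 / \<gamma>\<^sup>2 * \<bar>s - t\<bar>"
    using gap_pos by (simp add: field_simps)
  then show ?thesis by (simp add: w_def norm_minus_commute)
qed

text \<open>
  The Hellmann-Feynman expression for the derivative of the eigenvalue.
\<close>

definition slope :: "real \<Rightarrow> real" where
  "slope t = 2 * inner (D' t (ev t)) (D t (ev t)) / (norm (ev t))\<^sup>2"

lemma lam_diff_slope:
  assumes t: "\<bar>t\<bar> \<le> rad"
  shows "lam s - lam t \<le> (s - t) * slope t + 4 * K\<^sup>2 * (s - t)\<^sup>2"
proof -
  let ?x = "ev t" and ?t = "s - t"
  note xU = ev_U[OF t]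
  have n: "(norm ?x)\<^sup>2 > 0" using norm_ev_ge[OF t] by auto
  define r where "r = D s ?x - D t ?x - ?t *\<^sub>R D' t ?x"
  have dec: "D s ?x = D t ?x + (?t *\<^sub>R D' t ?x + r)" by (simp add: r_def)
  have r: "norm r \<le> K * ?t\<^sup>2 * norm ?x" unfolding r_def by (rule taylor_D[OF xU])
  have "?t *\<^sub>R D' t ?x + r = D s ?x - D t ?x" by (simp add: r_def)
  then have d: "norm (?t *\<^sub>R D' t ?x + r) \<le> K * \<bar>?t\<bar> * norm ?x"
    using lipschitz_D[OF xU, of s t] by simp
  have "(norm (D s ?x))\<^sup>2 - (norm (D t ?x))\<^sup>2
     = ?t * (2 * inner (D' t ?x) (D t ?x)) + 2 * inner (D t ?x) r + (norm (?t *\<^sub>R D' t ?x + r))\<^sup>2"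
    unfolding dec by (simp add: power2_norm_eq_inner inner_simps inner_commute algebra_simps)
  also have "\<dots> \<le> ?t * (2 * inner (D' t ?x) (D t ?x))
      + 2 * (K * norm ?x * (K * ?t\<^sup>2 * norm ?x)) + (K * \<bar>?t\<bar> * norm ?x)\<^sup>2"
    using norm_cauchy_schwarz[of "D t ?x" r] mult_mono[OF norm_D[OF xU, of t] r] K_pos
    by (intro add_mono power_mono d order_refl) auto
  also have "\<dots> = ?t * (2 * inner (D' t ?x) (D t ?x)) + 3 * K\<^sup>2 * ?t\<^sup>2 * (norm ?x)\<^sup>2"
    by (simp add: power2_eq_square)
  finally have "((norm (D s ?x))\<^sup>2 - (norm (D t ?x))\<^sup>2) / (norm ?x)\<^sup>2
      \<le> (?t * (2 * inner (D' t ?x) (D t ?x)) + 3 * K\<^sup>2 * ?t\<^sup>2 * (norm ?x)\<^sup>2) / (norm ?x)\<^sup>2"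
    by (rule divide_right_mono) simp
  also have "\<dots> = ?t * slope t + 3 * K\<^sup>2 * ?t\<^sup>2"
    using n by (simp add: slope_def add_divide_distrib)
  finally show ?thesis using lam_diff_le[OF t, of s] 
    by (smt (verit) mult_right_mono zero_le_power2)
qed

text \<open>
  Add the Taylor estimate and the one with \<open>s\<close> and \<open>t\<close> exchanged.
\<close>

lemma lipschitz_D':
  assumes "x \<in> U" "s \<noteq> t"
  shows "norm (D' s x - D' t x) \<le> 2 * K * \<bar>s - t\<bar> * norm x"
proof -
  have "(s - t) *\<^sub>R (D' s x - D' t x) =
      (D s x - D t x - (s - t) *\<^sub>R D' t x) + (D t x - D s x - (t - s) *\<^sub>R D' s x)"
    by (simp add: algebra_simps)
  also have "norm \<dots> \<le> K * (s - t)\<^sup>2 * norm x + K * (t - s)\<^sup>2 * norm x"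
    by (intro norm_triangle_le add_mono taylor_D assms)
  also have "\<dots> = (\<bar>s - t\<bar> * \<bar>s - t\<bar>) * (2 * K * norm x)"
    by (simp only: power2_commute[of t s] power2_eq_square abs_mult_self_eq) (simp add: algebra_simps)
  also have "\<dots> = \<bar>s - t\<bar> * (2 * K * \<bar>s - t\<bar> * norm x)"
    by (simp only: mult_ac)
  finally have "\<bar>s - t\<bar> * norm (D' s x - D' t x) \<le> \<bar>s - t\<bar> * (2 * K * \<bar>s - t\<bar> * norm x)"
    by simp
  then show ?thesis by (rule mult_left_le_imp_le) (use assms(2) in simp)
qed

lemma eventually_near:
  assumes "\<bar>t\<bar> < rad"
  shows "\<forall>\<^sub>F s in at t. \<bar>s\<bar> \<le> rad \<and> s \<noteq> t"
proof -
  have "\<forall>\<^sub>F s in at t. s \<in> {- rad<..<rad}"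
    using assms by (intro eventually_at_in_open') auto
  then show ?thesis
    using eventually_neq_at_within[of t t UNIV] by eventually_elim auto
qed

lemma tendsto_ev:
  assumes t: "\<bar>t\<bar> < rad"
  shows "(ev \<longlongrightarrow> ev t) (at t)"
    and "((\<lambda>s. D s (ev s)) \<longlongrightarrow> D t (ev t)) (at t)"
    and "((\<lambda>s. D' s (ev s)) \<longlongrightarrow> D' t (ev t)) (at t)"
proof -
  note near = eventually_near[OF t]
  have t': "\<bar>t\<bar> \<le> rad" using t by simp
  define M where "M = 16 * K\<^sup>2 / \<gamma>\<^sup>2"
  have lim: "((\<lambda>s. c * \<bar>s - t\<bar>) \<longlongrightarrow> 0) (at t)" for c
    by (rule tendsto_eq_intros refl | simp)+
  have lip: "norm (ev s - ev t) \<le> M * \<bar>s - t\<bar>" if "\<bar>s\<bar> \<le> rad" for s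
    unfolding M_def by (rule ev_lipschitz[OF t' that])
  show "(ev \<longlongrightarrow> ev t) (at t)"
    by (rule LIM_zero_cancel, rule Lim_null_comparison[OF _ lim[of M]])
      (use near lip in \<open>auto elim!: eventually_mono\<close>)
  have *: "norm (F s (ev s) - F t (ev t)) \<le> (4 * K + K * M) * \<bar>s - t\<bar>"
    if s: "\<bar>s\<bar> \<le> rad" "s \<noteq> t" and lin: "linear (F t)"
      and bound: "\<And>x. x \<in> U \<Longrightarrow> norm (F t x) \<le> K * norm x"
      and lipF: "\<And>x. x \<in> U \<Longrightarrow> norm (F s x - F t x) \<le> 2 * K * \<bar>s - t\<bar> * norm x"
    for s and F :: "real \<Rightarrow> 'x \<Rightarrow> 'y"
  proof -
    have U: "ev s - ev t \<in> U"
      by (intro subspace_diff subspace_U ev_U s t')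
    have "F s (ev s) - F t (ev t) = (F s (ev s) - F t (ev s)) + F t (ev s - ev t)"
      using lin by (simp add: linear_diff)
    also have "norm \<dots> \<le> 2 * K * \<bar>s - t\<bar> * norm (ev s) + K * norm (ev s - ev t)"
      by (intro norm_triangle_le add_mono lipF bound U ev_U s)
    also have "\<dots> \<le> 2 * K * \<bar>s - t\<bar> * 2 + K * (M * \<bar>s - t\<bar>)"
      using K_pos by (intro add_mono mult_left_mono lip norm_ev_le s) auto
    finally show ?thesis by (simp add: algebra_simps)
  qed
  have lipD2: "norm (D s x - D t x) \<le> 2 * K * \<bar>s - t\<bar> * norm x" if "x \<in> U" for s x
  proof -
    have "0 \<le> K * \<bar>s - t\<bar> * norm x" using K_pos by simp
    then show ?thesis using lipschitz_D[OF that, of s t] by linarith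
  qed
  show "((\<lambda>s. D s (ev s)) \<longlongrightarrow> D t (ev t)) (at t)"
    by (rule LIM_zero_cancel, rule Lim_null_comparison[OF _ lim[of "4 * K + K * M"]])
      (use near in eventually_elim, intro * linear_D norm_D lipD2, auto)
  show "((\<lambda>s. D' s (ev s)) \<longlongrightarrow> D' t (ev t)) (at t)"
    by (rule LIM_zero_cancel, rule Lim_null_comparison[OF _ lim[of "4 * K + K * M"]])
      (use near in eventually_elim, intro * linear_D' norm_D' lipschitz_D', auto)
qed

lemma tendsto_slope:
  assumes t: "\<bar>t\<bar> < rad"
  shows "(slope \<longlongrightarrow> slope t) (at t)"
  unfolding slope_def using norm_ev_ge[of t] t
  by (intro tendsto_intros tendsto_ev) auto

text \<open>
  The upper bound \<open>lam_diff_slope\<close> for \<open>lam s - lam t\<close> and the same bound with \<open>s\<close> and \<open>t\<close> exchanged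
  enclose the difference quotient between the slopes at both points, up to \<open>O(\<bar>s - t\<bar>)\<close>, and the
  slope is continuous.
\<close>

lemma lam_has_derivative:
  assumes t: "\<bar>t\<bar> < rad"
  shows "(lam has_real_derivative slope t) (at t)"
proof -
  have t': "\<bar>t\<bar> \<le> rad" using t by simp
  note near = eventually_near[OF t]
  have bound: "norm ((lam s - lam t) / (s - t) - slope t)
      \<le> 4 * K\<^sup>2 * \<bar>s - t\<bar> + \<bar>slope s - slope t\<bar>" if s: "\<bar>s\<bar> \<le> rad \<and> s \<noteq> t" for s
  proof -
    let ?t = "s - t"
    have 1: "lam s - lam t - ?t * slope t \<le> 4 * K\<^sup>2 * ?t\<^sup>2"
      using lam_diff_slope[OF t', of s] by simp
    have 2: "?t * (slope s - slope t) - 4 * K\<^sup>2 * ?t\<^sup>2 \<le> lam s - lam t - ?t * slope t"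
      using lam_diff_slope[of s t] s by (simp add: power2_commute[of t s] algebra_simps)
    have 3: "\<bar>?t * (slope s - slope t)\<bar> = \<bar>?t\<bar> * \<bar>slope s - slope t\<bar>"
      by (rule abs_mult)
    have "\<bar>lam s - lam t - ?t * slope t\<bar> \<le> 4 * K\<^sup>2 * ?t\<^sup>2 + \<bar>?t\<bar> * \<bar>slope s - slope t\<bar>"
      using 1 2 3 by linarith
    also have "\<dots> = \<bar>?t\<bar> * (4 * K\<^sup>2 * \<bar>?t\<bar> + \<bar>slope s - slope t\<bar>)"
      by (simp add: distrib_left mult.left_commute power2_eq_square[of ?t] flip: abs_mult)
    finally have "\<bar>lam s - lam t - ?t * slope t\<bar> / \<bar>?t\<bar> \<le> 4 * K\<^sup>2 * \<bar>?t\<bar> + \<bar>slope s - slope t\<bar>"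
      using s by (simp add: pos_divide_le_eq mult.commute)
    moreover have "(lam s - lam t) / ?t - slope t = (lam s - lam t - ?t * slope t) / ?t"
      using s by (simp add: field_simps)
    ultimately show ?thesis by simp
  qed
  have "((\<lambda>s. 4 * K\<^sup>2 * \<bar>s - t\<bar> + \<bar>slope s - slope t\<bar>) \<longlongrightarrow> 0) (at t)"
    by (rule tendsto_eq_intros tendsto_slope[OF t] refl | simp)+
  then have "((\<lambda>s. (lam s - lam t) / (s - t) - slope t) \<longlongrightarrow> 0) (at t)"
    by (rule Lim_null_comparison[rotated]) (use near bound in \<open>auto elim!: eventually_mono\<close>)
  then show ?thesis
    unfolding has_field_derivative_iff by (rule LIM_zero_cancel)
qed

context
  fixes g1 y0
  assumes g1: "g1 \<in> G" and y0: "y0 = D' 0 f0 + D 0 g1"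
    and y0_orth: "\<And>w. w \<in> U \<Longrightarrow> inner y0 (D 0 w) = 0"
begin

text \<open>
  Write \<open>D(t) (ev t) / t = y0 + D(0) w + r\<close> with \<open>w = corr t / t - g1 \<in> G\<close> and a remainder
  \<open>r = O(t)\<close>.  Since \<open>lam t = O(t\<^sup>2)\<close>, the eigenvalue equation tested with \<open>w\<close> says that the left-hand side
  is orthogonal to \<open>D(0) w\<close> up to \<open>O(t \<parallel>w\<parallel>)\<close>; as \<open>y0\<close> is orthogonal to it exactly, \<open>\<parallel>D(0) w\<parallel>\<^sup>2\<close> is at most
  \<open>O(t) (\<parallel>w\<parallel> + \<parallel>D(0) w\<parallel>)\<close>, and the gap bounds \<open>\<parallel>w\<parallel>\<close> by \<open>\<parallel>D(0) w\<parallel>\<close>.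
\<close>

lemma scaled_image_near:
  "\<exists>C. \<forall>t. t \<noteq> 0 \<longrightarrow> \<bar>t\<bar> \<le> rad \<longrightarrow> norm ((1 / t) *\<^sub>R D t (ev t) - y0) \<le> C * \<bar>t\<bar>"
proof -
  define M where "M = K + K * (4 * K / \<gamma>)"
  have "norm ((1 / t) *\<^sub>R D t (ev t) - y0) \<le> (4 * K\<^sup>2 / \<gamma> + 2 * M) * \<bar>t\<bar>"
    if nz: "t \<noteq> 0" and t: "\<bar>t\<bar> \<le> rad" for t
  proof -
    define y where "y = (1 / t) *\<^sub>R D t (ev t)"
    define w where "w = (1 / t) *\<^sub>R corr t - g1"
    define z where "z = D 0 w"
    define r where "r = y - (y0 + z)"
    have wG: "w \<in> G"
      unfolding w_def using corr_G[OF t] g1 subspace_G by (simp add: subspace_diff subspace_scale)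
    then have wU: "w \<in> U" using G_sub by blast
    have lin: "linear (D t)" "linear (D 0)" by (rule linear_D)+
    have "D 0 (corr t) = t *\<^sub>R D 0 ((1 / t) *\<^sub>R corr t)"
      using nz lin(2) by (simp add: linear_scale)
    then have "t *\<^sub>R r = (D t f0 - D 0 f0 - (t - 0) *\<^sub>R D' 0 f0) + (D t (corr t) - D 0 (corr t))"
      using nz lin unfolding r_def y_def y0 z_def w_def ev_def
      by (simp add: linear_add linear_diff kernel scaleR_diff_right scaleR_add_right)
    also have "norm \<dots> \<le> K * (t - 0)\<^sup>2 * norm f0 + K * \<bar>t - 0\<bar> * norm (corr t)"
      by (intro norm_triangle_le add_mono taylor_D lipschitz_D f0_U corr_U t)
    also have "\<dots> \<le> K * (t - 0)\<^sup>2 * norm f0 + K * \<bar>t - 0\<bar> * (4 * K / \<gamma> * \<bar>t\<bar>)"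
      using K_pos by (intro add_left_mono mult_left_mono norm_corr t) auto
    also have "\<dots> = \<bar>t\<bar> * (M * \<bar>t\<bar>)"
      by (simp add: norm_f0 M_def algebra_simps power2_eq_square)
    finally have r: "norm r \<le> M * \<bar>t\<bar>" using nz by simp
    have "norm (D t (ev t)) \<le> K * \<bar>t\<bar> * norm (ev t)"
    proof (rule power2_le_imp_le)
      show "(norm (D t (ev t)))\<^sup>2 \<le> (K * \<bar>t\<bar> * norm (ev t))\<^sup>2"
        using mult_right_mono[OF lam_upper[of t], of "(norm (ev t))\<^sup>2"]
        by (simp add: lam_eq[OF t] power_mult_distrib)
    qed (use K_pos in auto)
    also have "\<dots> \<le> K * \<bar>t\<bar> * 2"
      using K_pos by (intro mult_left_mono norm_ev_le t) auto
    finally have y_le: "norm y \<le> 2 * K" using nz by (simp add: y_def field_simps)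
    have "inner y (D t w) = lam t / t * inner (ev t) w"
      using weak_eigen[OF t wU] by (simp add: y_def)
    then have "\<bar>inner y (D t w)\<bar> = lam t / \<bar>t\<bar> * \<bar>inner (ev t) w\<bar>"
      using lam_nonneg[OF t] by (simp add: abs_mult)
    also have "\<dots> \<le> (K\<^sup>2 * t\<^sup>2) / \<bar>t\<bar> * (norm (ev t) * norm w)"
      by (intro mult_mono divide_right_mono lam_upper Cauchy_Schwarz_ineq2) auto
    also have "\<dots> = K\<^sup>2 * \<bar>t\<bar> * norm w * norm (ev t)"
      using nz by (simp add: power2_eq_square field_simps)
    also have "\<dots> \<le> K\<^sup>2 * \<bar>t\<bar> * norm w * 2"
      by (intro mult_left_mono norm_ev_le t) auto
    finally have 1: "\<bar>inner y (D t w)\<bar> \<le> 2 * K\<^sup>2 * \<bar>t\<bar> * norm w" by simp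
    have "inner y (z - D t w) \<le> norm y * norm (D 0 w - D t w)"
      unfolding z_def by (rule norm_cauchy_schwarz)
    also have "\<dots> \<le> (2 * K) * (K * \<bar>0 - t\<bar> * norm w)"
      by (intro mult_mono y_le lipschitz_D wU) (use K_pos in auto)
    finally have 2: "inner y (z - D t w) \<le> 2 * K\<^sup>2 * \<bar>t\<bar> * norm w"
      by (simp add: power2_eq_square mult_ac)
    have "inner y z = inner y (D t w) + inner y (z - D t w)" by (simp add: inner_diff_right)
    then have 3: "inner y z \<le> 4 * K\<^sup>2 * \<bar>t\<bar> * norm w" using 1 2 by linarith
    have "(norm z)\<^sup>2 = inner y z - inner r z"
      using y0_orth[OF wU] by (simp add: r_def z_def power2_norm_eq_inner inner_simps)
    also have "\<dots> \<le> 4 * K\<^sup>2 * \<bar>t\<bar> * norm w + norm r * norm z"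
      using 3 Cauchy_Schwarz_ineq2[of r z] by linarith
    also have "\<dots> \<le> 4 * K\<^sup>2 * \<bar>t\<bar> * (norm z / \<gamma>) + (M * \<bar>t\<bar>) * norm z"
      using gap[OF wG] gap_pos
      by (intro add_mono mult_left_mono mult_right_mono r) (auto simp: z_def field_simps)
    also have "\<dots> = norm z * ((4 * K\<^sup>2 / \<gamma> + M) * \<bar>t\<bar>)" by (simp add: algebra_simps)
    finally have *: "norm z * norm z \<le> norm z * ((4 * K\<^sup>2 / \<gamma> + M) * \<bar>t\<bar>)"
      by (simp add: power2_eq_square)
    have z: "norm z \<le> (4 * K\<^sup>2 / \<gamma> + M) * \<bar>t\<bar>"
    proof (cases "z = 0")
      case True
      then show ?thesis using K_pos gap_pos by (simp add: M_def)
    next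
      case False
      then show ?thesis by (intro mult_left_le_imp_le[OF *]) simp
    qed
    have "y - y0 = z + r" by (simp add: r_def)
    then have "norm (y - y0) \<le> norm z + norm r" by (simp add: norm_triangle_ineq)
    then show ?thesis using z r by (simp add: y_def algebra_simps)
  qed
  then show ?thesis by blast
qed

text \<open>
  Put \<open>y = D(t) (ev t) / t\<close>.  The claim follows from \<open>lam t (1 + \<parallel>corr t\<parallel>\<^sup>2) = t\<^sup>2 \<parallel>y\<parallel>\<^sup>2\<close>
  together with \<open>y = y0 + O(t)\<close> and \<open>corr t = O(t)\<close>.
\<close>

lemma lam_expansion: "(\<lambda>t. lam t - t\<^sup>2 * (norm y0)\<^sup>2) \<in> O[at_right 0](\<lambda>t. t ^ 3)"
proof -
  obtain C where C: "\<And>t. t \<noteq> 0 \<Longrightarrow> \<bar>t\<bar> \<le> rad \<Longrightarrow> norm ((1 / t) *\<^sub>R D t (ev t) - y0) \<le> C * \<bar>t\<bar>"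
    using scaled_image_near by blast
  have C0: "C \<ge> 0"
    using C[of rad] rad_pos by (smt (verit) mult_neg_pos norm_ge_zero)
  define N where "N = C * (C * rad + 2 * norm y0) + K\<^sup>2 * (4 * K / \<gamma>)"
  have bound: "norm (lam t - t\<^sup>2 * (norm y0)\<^sup>2) \<le> N * norm (t ^ 3)"
    if pos: "t > 0" and le: "t < rad" for t
  proof -
    have t: "\<bar>t\<bar> \<le> rad" "t \<noteq> 0" using pos le by auto
    define y where "y = (1 / t) *\<^sub>R D t (ev t)"
    have d: "norm (y - y0) \<le> C * t" using C[OF t(2,1)] pos by (simp add: y_def)
    have "norm (y + y0) \<le> norm (y - y0) + 2 * norm y0"
      using norm_triangle_ineq[of "y - y0" "y0 + y0"] norm_triangle_ineq[of y0 y0] by simp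
    also have "\<dots> \<le> C * rad + 2 * norm y0"
      using d mult_left_mono[OF less_imp_le[OF le] C0] by simp
    finally have s: "norm (y + y0) \<le> C * rad + 2 * norm y0" .
    have "\<bar>(norm y)\<^sup>2 - (norm y0)\<^sup>2\<bar> \<le> norm (y - y0) * norm (y + y0)"
      unfolding norm_sq_diff by (rule Cauchy_Schwarz_ineq2)
    also have "\<dots> \<le> (C * t) * (C * rad + 2 * norm y0)"
      by (intro mult_mono d s) (use C0 pos in auto)
    finally have 1: "\<bar>(norm y)\<^sup>2 - (norm y0)\<^sup>2\<bar> \<le> C * (C * rad + 2 * norm y0) * t"
      by (simp add: mult_ac)
    have "D t (ev t) = t *\<^sub>R y" using pos by (simp add: y_def)
    then have "lam t * (1 + (norm (corr t))\<^sup>2) = t\<^sup>2 * (norm y)\<^sup>2"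
      using lam_eq[OF t(1)] norm_ev_sq[OF t(1)] by (simp add: power_mult_distrib)
    then have eq: "lam t - t\<^sup>2 * (norm y0)\<^sup>2 =
        t\<^sup>2 * ((norm y)\<^sup>2 - (norm y0)\<^sup>2) - lam t * (norm (corr t))\<^sup>2"
      by (simp add: algebra_simps)
    have "(norm (corr t))\<^sup>2 \<le> norm (corr t) * 1"
      unfolding power2_eq_square by (intro mult_left_mono norm_corr_le_1 t) auto
    then have "(norm (corr t))\<^sup>2 \<le> 4 * K / \<gamma> * t" using norm_corr[OF t(1)] pos by simp
    then have 2: "lam t * (norm (corr t))\<^sup>2 \<le> (K\<^sup>2 * t\<^sup>2) * (4 * K / \<gamma> * t)"
      by (intro mult_mono lam_upper) auto
    have 3: "0 \<le> lam t * (norm (corr t))\<^sup>2" using lam_nonneg[OF t(1)] by simp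
    have "\<bar>t\<^sup>2 * ((norm y)\<^sup>2 - (norm y0)\<^sup>2)\<bar> \<le> t\<^sup>2 * (C * (C * rad + 2 * norm y0) * t)"
      unfolding abs_mult using 1 by (intro mult_mono) auto
    then have "\<bar>lam t - t\<^sup>2 * (norm y0)\<^sup>2\<bar> \<le>
        t\<^sup>2 * (C * (C * rad + 2 * norm y0) * t) + (K\<^sup>2 * t\<^sup>2) * (4 * K / \<gamma> * t)"
      using eq 2 3 by linarith
    also have "\<dots> = N * t ^ 3" by (simp add: N_def power2_eq_square power3_eq_cube algebra_simps)
    finally show ?thesis using pos by simp
  qed
  have "\<forall>\<^sub>F t in at_right 0. t \<in> {0<..<rad}"
    by (rule eventually_at_right_real[OF rad_pos])
  then have "\<forall>\<^sub>F t in at_right 0. norm (lam t - t\<^sup>2 * (norm y0)\<^sup>2) \<le> N * norm (t ^ 3)"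
    by eventually_elim (rule bound, auto)
  then show ?thesis by (rule bigoI)
qed

text \<open>
  The slope divided by \<open>t\<close> tends to twice the inner product of \<open>D'(0) f0\<close> and \<open>y0\<close>, and
  \<open>D'(0) f0 = y0 - D(0) g1\<close> with \<open>D(0) g1\<close> orthogonal to \<open>y0\<close>.
\<close>

lemma lam_second_derivative:
  "(slope has_real_derivative 2 * (norm y0)\<^sup>2) (at 0)"
proof -
  obtain C where C: "\<And>t. t \<noteq> 0 \<Longrightarrow> \<bar>t\<bar> \<le> rad \<Longrightarrow> norm ((1 / t) *\<^sub>R D t (ev t) - y0) \<le> C * \<bar>t\<bar>"
    using scaled_image_near by blast
  have 0: "\<bar>0::real\<bar> < rad" using rad_pos by simp
  have "norm (corr 0) \<le> 0" using norm_corr[of 0] rad_pos by simp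
  then have ev0: "ev 0 = f0" by (simp add: ev_def)
  have slope0: "slope 0 = 0" by (simp add: slope_def ev0 kernel)
  note near = eventually_near[OF 0]
  have "((\<lambda>t. C * \<bar>t\<bar>) \<longlongrightarrow> 0) (at 0)"
    by (rule tendsto_eq_intros refl | simp)+
  then have "((\<lambda>t. (1 / t) *\<^sub>R D t (ev t) - y0) \<longlongrightarrow> 0) (at 0)"
    by (rule Lim_null_comparison[rotated]) (use near C in \<open>auto elim!: eventually_mono\<close>)
  then have y: "((\<lambda>t. (1 / t) *\<^sub>R D t (ev t)) \<longlongrightarrow> y0) (at 0)"
    by (rule LIM_zero_cancel)
  have "((\<lambda>t. 2 * inner (D' t (ev t)) ((1 / t) *\<^sub>R D t (ev t)) / (norm (ev t))\<^sup>2)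
      \<longlongrightarrow> 2 * inner (D' 0 (ev 0)) y0 / (norm (ev 0))\<^sup>2) (at 0)"
    by (intro tendsto_intros tendsto_ev 0 y) (simp add: ev0 norm_f0)
  moreover have "inner (D' 0 f0) y0 = (norm y0)\<^sup>2"
  proof -
    have "inner y0 y0 = inner (D' 0 f0) y0 + inner y0 (D 0 g1)"
      using y0 by (metis inner_add_left inner_commute)
    then show ?thesis using y0_orth[of g1] g1 G_sub by (auto simp: power2_norm_eq_inner)
  qed
  ultimately have "((\<lambda>t. (slope t - slope 0) / (t - 0)) \<longlongrightarrow> 2 * (norm y0)\<^sup>2) (at 0)"
    by (simp add: ev0 norm_f0 slope0) (simp add: slope_def mult.commute)
  then show ?thesis unfolding has_field_derivative_iff .
qed

lemma lam_twice_differentiable: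
  "\<forall>\<^sub>F t in nhds 0. lam differentiable (at t)"
  "deriv lam differentiable (at 0)"
  "deriv (deriv lam) 0 = 2 * (norm y0)\<^sup>2"
proof -
  have "\<forall>\<^sub>F t in nhds 0. t \<in> {- rad<..<rad}"
    using rad_pos by (intro eventually_nhds_in_open) auto
  then have ev: "\<forall>\<^sub>F t in nhds 0. (lam has_real_derivative slope t) (at t)"
    by eventually_elim (rule lam_has_derivative, auto)
  then show "\<forall>\<^sub>F t in nhds 0. lam differentiable (at t)"
    by eventually_elim (auto simp: real_differentiable_def)
  have "\<forall>\<^sub>F t in nhds 0. slope t = deriv lam t"
    using ev by eventually_elim (simp add: DERIV_imp_deriv)
  then have "(deriv lam has_real_derivative 2 * (norm y0)\<^sup>2) (at 0)"
    using lam_second_derivative by (subst DERIV_cong_ev[OF refl _ refl, of _ slope]) (auto elim: eventually_mono)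
  then show "deriv lam differentiable (at 0)" "deriv (deriv lam) 0 = 2 * (norm y0)\<^sup>2"
    by (auto simp: real_differentiable_def DERIV_imp_deriv)
qed

end

end


section \<open>The twisted incidence operator of a finite graph\<close>

lemma norm_exp_i_minus_1: "cmod (exp (\<i> * of_real y) - 1) \<le> \<bar>y\<bar>"
  using Taylor_exp[of "\<i> * of_real y" 0] by (simp add: norm_mult)

lemma norm_exp_i_taylor: "cmod (exp (\<i> * of_real y) - 1 - \<i> * of_real y) \<le> y\<^sup>2"
  using Taylor_exp[of "\<i> * of_real y" 1] by (simp add: norm_mult numeral_2_eq_2 diff_diff_eq)

lemma cvec_norm_le_card:
  assumes "\<And>i. i \<in> I \<Longrightarrow> cmod (f i) \<le> B"
  shows "cvec_norm I f \<le> real (card I) * B"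
proof -
  have "cvec_norm I f \<le> (\<Sum>i\<in>I. cmod (f i))"
    unfolding cvec_norm_def by (rule L2_set_le_sum) auto
  also have "\<dots> \<le> (\<Sum>i\<in>I. B)" by (intro sum_mono assms)
  finally show ?thesis by simp
qed

lemma cmod_le_cvec_norm: "finite I \<Longrightarrow> i \<in> I \<Longrightarrow> cmod (x i) \<le> cvec_norm I x"
  unfolding cvec_norm_def by (rule member_le_L2_set)

text \<open>
  A finite graph with oriented edges running from \<open>s e\<close> to \<open>t e\<close>, its degrees \<open>k\<close> (loops count
  twice) and a slope \<open>\<alpha> e\<close> for each edge, such as \<open>\<langle>\<tau>(e), \<omega>\<rangle>\<close>.  Connectedness is
  stated through the functions that do not change along any edge.
\<close>

locale weighted_graph =
  fixes V :: "'v set" and E :: "'e set" and s t :: "'e \<Rightarrow> 'v" and k :: "'v \<Rightarrow> real"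
    and \<alpha> :: "'e \<Rightarrow> real"
  assumes finite_V: "finite V" and V_ne: "V \<noteq> {}" and finite_E: "finite E"
    and s_V: "e \<in> E \<Longrightarrow> s e \<in> V" and t_V: "e \<in> E \<Longrightarrow> t e \<in> V"
    and k_pos: "v \<in> V \<Longrightarrow> k v > 0"
    and k_eq: "v \<in> V \<Longrightarrow> k v = real (card {e \<in> E. s e = v} + card {e \<in> E. t e = v})"
    and connected: "(\<forall>e\<in>E. G (s e) = (G (t e) :: complex)) \<Longrightarrow> u \<in> V \<Longrightarrow> v \<in> V \<Longrightarrow> G u = G v"
begin

definition phase :: "real \<Rightarrow> 'e \<Rightarrow> complex" where
  "phase \<epsilon> e = exp (\<i> * of_real (\<epsilon> * \<alpha> e))"

text \<open>
  At \<open>\<epsilon> = 0\<close> this is the normalized incidence matrix applied to \<open>x\<close>.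
\<close>

definition twist :: "real \<Rightarrow> ('v \<Rightarrow> complex) \<Rightarrow> 'e \<Rightarrow> complex" where
  "twist \<epsilon> x e = phase \<epsilon> e * x (t e) / of_real (sqrt (k (t e))) - x (s e) / of_real (sqrt (k (s e)))"

text \<open>
  The Floquet matrix at \<open>\<epsilon> \<omega>\<close>, with each edge of \<open>E\<close> contributing in both of its
  orientations; it factors as \<open>twist\<^sup>* twist\<close>.
\<close>

definition fiber :: "real \<Rightarrow> 'v \<Rightarrow> 'v \<Rightarrow> complex" where
  "fiber \<epsilon> u v = (if u = v then 1 else 0) - 1 / of_real (sqrt (k u * k v)) *
    ((\<Sum>e | e \<in> E \<and> s e = u \<and> t e = v. phase \<epsilon> e) + (\<Sum>e | e \<in> E \<and> t e = u \<and> s e = v. cnj (phase \<epsilon> e)))"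

text \<open>
  The unit vector spanning the kernel of the fiber at \<open>\<epsilon> = 0\<close>.
\<close>

definition ground :: "'v \<Rightarrow> complex" where
  "ground v = of_real (sqrt (k v / sum k V))"

lemma norm_phase [simp]: "cmod (phase \<epsilon> e) = 1"
  unfolding phase_def by (rule norm_exp_i_times)

lemma phase_mult_cnj [simp]: "phase \<epsilon> e * cnj (phase \<epsilon> e) = 1"
  using complex_norm_square[of "phase \<epsilon> e"] by simp

lemma phase_0 [simp]: "phase 0 e = 1"
  by (simp add: phase_def)

lemma herm_fiber: "herm_on V (fiber \<epsilon>)"
  unfolding herm_on_def
proof (intro ballI)
  fix u v
  have sets: "{e. e \<in> E \<and> s e = v \<and> t e = u} = {e. e \<in> E \<and> t e = u \<and> s e = v}"
    "{e. e \<in> E \<and> t e = v \<and> s e = u} = {e. e \<in> E \<and> s e = u \<and> t e = v}" by auto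
  show "fiber \<epsilon> v u = cnj (fiber \<epsilon> u v)"
    unfolding fiber_def sets by (simp add: mult.commute[of "k v"] add.commute)
qed

text \<open>
  Every edge belongs to exactly one pair of end points.
\<close>

lemma sum_pairs:
  assumes "\<And>e. e \<in> E \<Longrightarrow> p e \<in> V" "\<And>e. e \<in> E \<Longrightarrow> q e \<in> V"
  shows "(\<Sum>u\<in>V. \<Sum>v\<in>V. \<Sum>e | e \<in> E \<and> p e = u \<and> q e = v. f e u v) = (\<Sum>e\<in>E. f e (p e) (q e) :: complex)"
proof -
  have "(\<Sum>v\<in>V. \<Sum>e | e \<in> E \<and> p e = u \<and> q e = v. f e u v)
      = (\<Sum>e\<in>{e\<in>E. p e = u}. f e (p e) (q e))" for u
  proof -
    have "(\<Sum>v\<in>V. \<Sum>e | e \<in> E \<and> p e = u \<and> q e = v. f e u v)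
        = (\<Sum>v\<in>V. \<Sum>e\<in>{e\<in>{e\<in>E. p e = u}. q e = v}. f e (p e) (q e))"
      by (intro sum.cong refl) auto
    also have "\<dots> = (\<Sum>e\<in>{e\<in>E. p e = u}. f e (p e) (q e))"
      by (rule sum.group) (use finite_V finite_E assms in auto)
    finally show ?thesis .
  qed
  then have "(\<Sum>u\<in>V. \<Sum>v\<in>V. \<Sum>e | e \<in> E \<and> p e = u \<and> q e = v. f e u v)
      = (\<Sum>u\<in>V. \<Sum>e\<in>{e\<in>E. p e = u}. f e (p e) (q e))" by simp
  also have "\<dots> = (\<Sum>e\<in>E. f e (p e) (q e))"
    by (rule sum.group) (use finite_V finite_E assms in auto)
  finally show ?thesis .
qed

lemma sum_degrees: "(\<Sum>v\<in>V. of_real (k v) * z v) = (\<Sum>e\<in>E. z (s e) + z (t e) :: complex)"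
proof -
  have "(\<Sum>v\<in>V. of_real (k v) * z v) = (\<Sum>v\<in>V. \<Sum>e\<in>{e\<in>E. s e = v}. z (s e)) + (\<Sum>v\<in>V. \<Sum>e\<in>{e\<in>E. t e = v}. z (t e))"
    by (simp add: sum.distrib[symmetric] k_eq distrib_right)
  also have "\<dots> = (\<Sum>e\<in>E. z (s e)) + (\<Sum>e\<in>E. z (t e))"
    by (intro arg_cong2[where f = "(+)"] sum.group) (use finite_V finite_E s_V t_V in auto)
  finally show ?thesis by (simp add: sum.distrib)
qed

text \<open>
  Expand the product of \<open>z X(t) - X(s)\<close> and the conjugate of \<open>z Y(t) - Y(s)\<close> with \<open>\<bar>z\<bar> = 1\<close>: the
  unmixed terms, collected at each vertex, give the degree and hence the identity matrix, and the
  mixed terms are the two orientations of the edge.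
\<close>

lemma fiber_form:
  "cvec_inner V (mat_vec V (fiber \<epsilon>) x) y = cvec_inner E (twist \<epsilon> x) (twist \<epsilon> y)"
proof -
  define X where "X v = x v / of_real (sqrt (k v))" for v
  define Y where "Y v = cnj (y v / of_real (sqrt (k v)))" for v
  have "cvec_inner V (mat_vec V (fiber \<epsilon>) x) y = (\<Sum>u\<in>V. \<Sum>v\<in>V. fiber \<epsilon> u v * x v * cnj (y u))"
    by (simp add: cvec_inner_def mat_vec_def sum_distrib_right)
  also have "\<dots> = (\<Sum>u\<in>V. \<Sum>v\<in>V. (if u = v then x v * cnj (y u) else 0)
      - ((\<Sum>e | e \<in> E \<and> s e = u \<and> t e = v. phase \<epsilon> e * X v * Y u)
        + (\<Sum>e | e \<in> E \<and> t e = u \<and> s e = v. cnj (phase \<epsilon> e) * X v * Y u)))"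
  proof (intro sum.cong refl)
    fix u v
    define A where "A = (\<Sum>e | e \<in> E \<and> s e = u \<and> t e = v. phase \<epsilon> e)"
    define B where "B = (\<Sum>e | e \<in> E \<and> t e = u \<and> s e = v. cnj (phase \<epsilon> e))"
    have "(\<Sum>e | e \<in> E \<and> s e = u \<and> t e = v. phase \<epsilon> e * X v * Y u) = A * (X v * Y u)"
      "(\<Sum>e | e \<in> E \<and> t e = u \<and> s e = v. cnj (phase \<epsilon> e) * X v * Y u) = B * (X v * Y u)"
      by (simp_all add: A_def B_def sum_distrib_right mult.assoc)
    moreover have "fiber \<epsilon> u v = (if u = v then 1 else 0) - 1 / of_real (sqrt (k u * k v)) * (A + B)"
      by (simp add: fiber_def A_def B_def)
    moreover have "X v * Y u = x v * cnj (y u) * (1 / of_real (sqrt (k u * k v)))"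
      by (simp add: X_def Y_def real_sqrt_mult)
    ultimately show "fiber \<epsilon> u v * x v * cnj (y u) = (if u = v then x v * cnj (y u) else 0)
      - ((\<Sum>e | e \<in> E \<and> s e = u \<and> t e = v. phase \<epsilon> e * X v * Y u)
        + (\<Sum>e | e \<in> E \<and> t e = u \<and> s e = v. cnj (phase \<epsilon> e) * X v * Y u))"
      by (simp only:) (simp add: algebra_simps add_divide_distrib)
  qed
  also have "\<dots> = (\<Sum>u\<in>V. x u * cnj (y u))
      - ((\<Sum>e\<in>E. phase \<epsilon> e * X (t e) * Y (s e)) + (\<Sum>e\<in>E. cnj (phase \<epsilon> e) * X (s e) * Y (t e)))"
    using finite_V
    by (simp add: sum_subtractf sum.distrib sum_pairs s_V t_V)
  also have "(\<Sum>u\<in>V. x u * cnj (y u)) = (\<Sum>u\<in>V. of_real (k u) * (X u * Y u))"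
  proof (intro sum.cong refl)
    fix u assume "u \<in> V"
    then have "k u > 0" by (rule k_pos)
    then have "complex_of_real (k u) = of_real (sqrt (k u)) * of_real (sqrt (k u))" "sqrt (k u) \<noteq> 0"
      by (simp_all flip: of_real_mult)
    then show "x u * cnj (y u) = of_real (k u) * (X u * Y u)"
      by (simp add: X_def Y_def)
  qed
  also have "\<dots> = (\<Sum>e\<in>E. X (s e) * Y (s e) + X (t e) * Y (t e))" by (rule sum_degrees)
  also have "\<dots> - ((\<Sum>e\<in>E. phase \<epsilon> e * X (t e) * Y (s e)) + (\<Sum>e\<in>E. cnj (phase \<epsilon> e) * X (s e) * Y (t e)))
      = (\<Sum>e\<in>E. X (s e) * Y (s e) + X (t e) * Y (t e) - phase \<epsilon> e * X (t e) * Y (s e)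
          - cnj (phase \<epsilon> e) * X (s e) * Y (t e))"
    by (simp add: sum_subtractf sum.distrib)
  also have "\<dots> = cvec_inner E (twist \<epsilon> x) (twist \<epsilon> y)"
    unfolding cvec_inner_def
  proof (intro sum.cong refl)
    fix e
    have "twist \<epsilon> x e = phase \<epsilon> e * X (t e) - X (s e)" by (simp add: twist_def X_def)
    moreover have "cnj (twist \<epsilon> y e) = cnj (phase \<epsilon> e) * Y (t e) - Y (s e)" by (simp add: twist_def Y_def)
    moreover have "(phase \<epsilon> e * X (t e) - X (s e)) * (cnj (phase \<epsilon> e) * Y (t e) - Y (s e))
      = (phase \<epsilon> e * cnj (phase \<epsilon> e)) * (X (t e) * Y (t e)) + X (s e) * Y (s e)
        - phase \<epsilon> e * X (t e) * Y (s e) - cnj (phase \<epsilon> e) * X (s e) * Y (t e)"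
      by (simp add: algebra_simps del: phase_mult_cnj)
    ultimately show "X (s e) * Y (s e) + X (t e) * Y (t e) - phase \<epsilon> e * X (t e) * Y (s e)
          - cnj (phase \<epsilon> e) * X (s e) * Y (t e) = twist \<epsilon> x e * cnj (twist \<epsilon> y e)"
      by simp
  qed
  finally show ?thesis .
qed

lemma twist_add: "twist \<epsilon> (\<lambda>v. x v + y v) e = twist \<epsilon> x e + twist \<epsilon> y e"
  by (simp add: twist_def add_divide_distrib ring_distribs)

lemma twist_scale: "twist \<epsilon> (\<lambda>v. c * x v) e = c * twist \<epsilon> x e"
  by (simp add: twist_def field_simps)

lemma twist_cong: "e \<in> E \<Longrightarrow> (\<And>v. v \<in> V \<Longrightarrow> x v = y v) \<Longrightarrow> twist \<epsilon> x e = twist \<epsilon> y e"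
  using s_V t_V by (simp add: twist_def)

lemma sum_k_pos: "sum k V > 0"
  by (intro sum_pos finite_V V_ne k_pos)

lemma norm_ground: "cvec_norm V ground = 1"
proof -
  have "(cvec_norm V ground)\<^sup>2 = (\<Sum>v\<in>V. k v / sum k V)"
    unfolding cvec_norm_sq using k_pos sum_k_pos
    by (intro sum.cong refl) (auto simp: ground_def less_imp_le)
  also have "\<dots> = 1" using sum_k_pos by (simp add: sum_divide_distrib[symmetric])
  finally show ?thesis by (simp add: power2_eq_1_iff) (metis cvec_norm_def L2_set_nonneg neg_0_le_iff_le not_one_le_zero)
qed

lemma ground_over_sqrt: "v \<in> V \<Longrightarrow> ground v / of_real (sqrt (k v)) = of_real (1 / sqrt (sum k V))"
  using k_pos[of v] by (simp add: ground_def real_sqrt_divide)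

lemma twist_ground: "e \<in> E \<Longrightarrow> twist 0 ground e = 0"
  by (simp add: twist_def ground_over_sqrt s_V t_V)

text \<open>
  On the kernel \<open>x / \<surd>k\<close> is constant by connectedness, so \<open>x\<close> is a multiple of the ground state.
\<close>

lemma kernel_twist:
  assumes "\<forall>e\<in>E. twist 0 x e = 0" "cvec_inner V x ground = 0" "v \<in> V"
  shows "x v = 0"
proof -
  define G where "G u = x u / of_real (sqrt (k u))" for u
  have const: "G u = G v" if "u \<in> V" for u
    by (rule connected) (use assms that in \<open>auto simp: G_def twist_def\<close>)
  have x: "x u = G v * of_real (sqrt (k u))" if "u \<in> V" for u
    using const[OF that] k_pos[OF that] by (simp add: G_def field_simps)
  have "x u * cnj (ground u) = G v * of_real (k u / sqrt (sum k V))" if "u \<in> V" for u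
  proof -
    have "sqrt (k u) * sqrt (k u / sum k V) = k u / sqrt (sum k V)"
      using k_pos[OF that] by (simp add: real_sqrt_divide)
    then show ?thesis
      by (simp add: x[OF that] ground_def mult.assoc flip: of_real_mult)
  qed
  then have "cvec_inner V x ground = G v * of_real (\<Sum>u\<in>V. k u / sqrt (sum k V))"
    unfolding cvec_inner_def of_real_sum sum_distrib_left by simp
  also have "(\<Sum>u\<in>V. k u / sqrt (sum k V)) = sum k V / sqrt (sum k V)"
    by (simp add: sum_divide_distrib)
  finally have "G v = 0"
    using assms(2) sum_k_pos by (simp del: of_real_divide of_real_sum)
  then show ?thesis using x[OF assms(3)] by simp
qed

text \<open>
  The minimum over the compact unit sphere of the complement is attained, and it is positive
  because the kernel is spanned by the ground state.  For a single vertex the complement is zero and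
  any constant will do.
\<close>

lemma spectral_gap:
  obtains \<gamma> where "\<gamma> > 0"
    "\<And>x. x \<in> cvecs V \<Longrightarrow> cvec_inner V x ground = 0 \<Longrightarrow> \<gamma> * cvec_norm V x \<le> cvec_norm E (twist 0 x)"
proof (cases "\<exists>x0 \<in> cvecs V. x0 \<noteq> (\<lambda>_. 0) \<and> cvec_inner V x0 ground = 0")
  case False
  then have "1 * cvec_norm V x \<le> cvec_norm E (twist 0 x)"
    if "x \<in> cvecs V" "cvec_inner V x ground = 0" for x
  proof -
    have "x = (\<lambda>_. 0)" using False that by blast
    then have "cvec_norm V x = 0" by (simp add: cvec_norm_def L2_set_def)
    moreover have "cvec_norm E (twist 0 x) \<ge> 0" by (simp add: cvec_norm_def)
    ultimately show ?thesis by simp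
  qed
  then show ?thesis using that[of 1] by auto
next
  case True
  then obtain x0 where x0: "x0 \<in> cvecs V" "x0 \<noteq> (\<lambda>_. 0)" "cvec_inner V x0 ground = 0" by blast
  define q where "q x = (\<Sum>e\<in>E. (cmod (twist 0 x e))\<^sup>2)" for x
  have orth: "cvec_inner V x ground = (\<Sum>v\<in>V. cnj (ground v) * x v)" for x
    by (simp add: cvec_inner_def mult.commute)
  have cont: "continuous_on UNIV q"
    unfolding q_def twist_def divide_inverse
    by (intro continuous_intros continuous_on_product_coordinates)
  obtain z where z: "z \<in> cvecs V" "cvec_norm V z = 1" "cvec_inner V z ground = 0"
    and min: "\<And>x. x \<in> cvecs V \<Longrightarrow> cvec_norm V x = 1 \<Longrightarrow> cvec_inner V x ground = 0 \<Longrightarrow> q z \<le> q x"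
    using minimizer_on_sphere_section[of V "{()}" x0 "\<lambda>_ v. cnj (ground v)" q] finite_V x0 cont
    unfolding orth by auto
  have "q z \<noteq> 0"
  proof
    assume "q z = 0"
    then have "\<forall>e\<in>E. twist 0 z e = 0"
      unfolding q_def using finite_E by (subst (asm) sum_nonneg_eq_0_iff) auto
    then have "\<forall>v\<in>V. z v = 0" using kernel_twist z(3) by blast
    then show False using z(2) by (simp add: cvec_norm_def L2_set_def)
  qed
  moreover have "q z \<ge> 0" by (simp add: q_def sum_nonneg)
  ultimately have pos: "sqrt (q z) > 0" by simp
  show ?thesis
  proof (rule that[OF pos])
    fix x assume x: "x \<in> cvecs V" "cvec_inner V x ground = 0"
    show "sqrt (q z) * cvec_norm V x \<le> cvec_norm E (twist 0 x)"
    proof (cases "cvec_norm V x = 0")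
      case True
      then show ?thesis by (simp add: cvec_norm_def)
    next
      case False
      define c where "c = 1 / cvec_norm V x"
      have n: "cvec_norm V x > 0" using False by (metis L2_set_nonneg cvec_norm_def less_eq_real_def)
      have "q z \<le> q (\<lambda>v. of_real c * x v)"
      proof (rule min)
        show "cvec_inner V (\<lambda>v. of_real c * x v) ground = 0"
          using x(2) by (simp add: cvec_inner_def mult.assoc sum_distrib_left[symmetric])
        show "cvec_norm V (\<lambda>v. of_real c * x v) = 1"
          using n by (simp only: cvec_norm_scale, simp add: c_def norm_divide)
      qed (rule cvecs_scale[OF x(1)])
      also have "q (\<lambda>v. of_real c * x v) = c\<^sup>2 * (cvec_norm E (twist 0 x))\<^sup>2"
        by (simp only: q_def twist_scale cvec_norm_sq norm_mult power_mult_distrib sum_distrib_left norm_of_real power2_abs)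
      also have "\<dots> = (cvec_norm E (twist 0 x) / cvec_norm V x)\<^sup>2"
        by (simp add: c_def power_divide)
      finally have "sqrt (q z) \<le> cvec_norm E (twist 0 x) / cvec_norm V x"
        using n by (simp add: real_le_lsqrt cvec_norm_def)
      then show ?thesis using n by (simp add: pos_le_divide_eq)
    qed
  qed
qed

definition lam :: "real \<Rightarrow> real" where
  "lam \<epsilon> = smallest_eigenvalue V (fiber \<epsilon>)"

lemma lam_le_form: "x \<in> cvecs V \<Longrightarrow> lam \<epsilon> * (cvec_norm V x)\<^sup>2 \<le> (cvec_norm E (twist \<epsilon> x))\<^sup>2"
  using smallest_eigenvalue_variational(2)[OF finite_V V_ne herm_fiber, of x \<epsilon>]
  by (simp add: lam_def fiber_form cvec_inner_self)

text \<open>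
  Multiplying an eigenvector by the conjugate of its component along the ground state makes
  this component real.
\<close>

lemma lam_eigenvector:
  "\<exists>x\<in>cvecs V. x \<noteq> (\<lambda>_. 0) \<and> (\<exists>c::real. cvec_inner V x ground = of_real c) \<and>
    (\<forall>w. cvec_inner E (twist \<epsilon> x) (twist \<epsilon> w) = of_real (lam \<epsilon>) * cvec_inner V x w)"
proof -
  obtain x where x: "x \<in> cvecs V" "x \<noteq> (\<lambda>_. 0)"
    "\<forall>i\<in>V. mat_vec V (fiber \<epsilon>) x i = of_real (lam \<epsilon>) * x i"
    using smallest_eigenvalue_variational(1)[OF finite_V V_ne herm_fiber]
    unfolding is_eigenvalue_def lam_def by blast
  define a where "a = cvec_inner V x ground"
  define c where "c = (if a = 0 then 1 else cnj a)"
  define x' where "x' = (\<lambda>v. c * x v)"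
  have c: "c \<noteq> 0" by (simp add: c_def)
  have "x' \<noteq> (\<lambda>_. 0)" using x(2) c by (auto simp: x'_def fun_eq_iff)
  moreover have "cvec_inner V x' ground = c * a"
    by (simp add: x'_def a_def cvec_inner_def sum_distrib_left mult.assoc)
  then have "cvec_inner V x' ground = of_real (if a = 0 then 0 else (cmod a)\<^sup>2)"
    by (simp add: c_def complex_norm_square mult.commute del: of_real_power)
  moreover have "cvec_inner E (twist \<epsilon> x') (twist \<epsilon> w) = of_real (lam \<epsilon>) * cvec_inner V x' w" for w
  proof -
    have "cvec_inner E (twist \<epsilon> x') (twist \<epsilon> w) = c * cvec_inner E (twist \<epsilon> x) (twist \<epsilon> w)"
      by (simp add: x'_def twist_scale cvec_inner_def sum_distrib_left mult.assoc)
    also have "\<dots> = c * cvec_inner V (mat_vec V (fiber \<epsilon>) x) w" by (simp add: fiber_form)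
    also have "cvec_inner V (mat_vec V (fiber \<epsilon>) x) w = of_real (lam \<epsilon>) * cvec_inner V x w"
      using x(3) by (simp add: cvec_inner_def sum_distrib_left mult.assoc)
    also have "c * (of_real (lam \<epsilon>) * cvec_inner V x w) = of_real (lam \<epsilon>) * cvec_inner V x' w"
    proof -
      have "cvec_inner V x' w = c * cvec_inner V x w"
        by (simp add: x'_def cvec_inner_def sum_distrib_left mult.assoc)
      then show ?thesis by simp
    qed
    finally show ?thesis .
  qed
  ultimately show ?thesis using cvecs_scale[OF x(1), of c] unfolding x'_def by blast
qed

text \<open>
  The derivative of \<^const>\<open>twist\<close> in \<open>\<epsilon>\<close>; only the phase depends on \<open>\<epsilon>\<close>.
\<close>

definition twist' :: "real \<Rightarrow> ('v \<Rightarrow> complex) \<Rightarrow> 'e \<Rightarrow> complex" where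
  "twist' \<epsilon> x e = \<i> * of_real (\<alpha> e) * phase \<epsilon> e * x (t e) / of_real (sqrt (k (t e)))"

lemma twist_bounds:
  obtains K where "K > 0"
    "\<And>x \<epsilon>. cvec_norm E (twist \<epsilon> x) \<le> K * cvec_norm V x"
    "\<And>x \<epsilon>. cvec_norm E (twist' \<epsilon> x) \<le> K * cvec_norm V x"
    "\<And>x \<epsilon> \<delta>. cvec_norm E (\<lambda>e. twist \<delta> x e - twist \<epsilon> x e) \<le> K * \<bar>\<delta> - \<epsilon>\<bar> * cvec_norm V x"
    "\<And>x \<epsilon> \<delta>. cvec_norm E (\<lambda>e. twist \<delta> x e - twist \<epsilon> x e - of_real (\<delta> - \<epsilon>) * twist' \<epsilon> x e)
      \<le> K * (\<delta> - \<epsilon>)\<^sup>2 * cvec_norm V x"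
proof -
  define A where "A = (\<Sum>e\<in>E. \<bar>\<alpha> e\<bar>)"
  define c where "c = (\<Sum>v\<in>V. 1 / sqrt (k v))"
  define K0 where "K0 = c * (2 + A + A\<^sup>2)"
  have A: "\<bar>\<alpha> e\<bar> \<le> A" if "e \<in> E" for e
    unfolding A_def using that finite_E by (intro member_le_sum) auto
  have A0: "A \<ge> 0" by (simp add: A_def sum_nonneg)
  have c0: "c \<ge> 0" unfolding c_def using k_pos by (intro sum_nonneg) (simp add: less_imp_le)
  have c: "cmod (x v / of_real (sqrt (k v))) \<le> c * cvec_norm V x" if "v \<in> V" for x v
  proof -
    have "1 / sqrt (k v) \<le> c"
      unfolding c_def using that finite_V k_pos by (intro member_le_sum) (auto simp: less_imp_le)
    then have "1 / sqrt (k v) * cmod (x v) \<le> c * cvec_norm V x"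
      using c0 by (intro mult_mono cmod_le_cvec_norm finite_V that) auto
    then show ?thesis using k_pos[OF that] by (simp add: norm_divide)
  qed
  have n0: "cvec_norm V x \<ge> 0" for x by (simp add: cvec_norm_def)
  have K0: "c * 2 \<le> K0" "c * A \<le> K0" "c * A\<^sup>2 \<le> K0"
    unfolding K0_def using A0 c0 by (auto intro!: mult_left_mono)
  \<comment> \<open>\<open>K0\<close> bounds single entries; the factor \<open>card E\<close> passes to the norm, and \<open>1\<close> makes \<open>K\<close> positive.\<close>
  define K where "K = real (card E) * K0 + 1"
  have K0_nonneg: "K0 \<ge> 0" using K0(1) c0 by simp
  have conv: "cvec_norm E f \<le> K * r * cvec_norm V x"
    if "r \<ge> 0" "\<And>e. e \<in> E \<Longrightarrow> cmod (f e) \<le> K0 * r * cvec_norm V x" for f r x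
  proof -
    have "cvec_norm E f \<le> real (card E) * (K0 * r * cvec_norm V x)"
      by (rule cvec_norm_le_card) (rule that)
    also have "\<dots> \<le> K * (r * cvec_norm V x)"
      using n0[of x] that(1) by (simp add: K_def distrib_right mult.assoc)
    finally show ?thesis by (simp add: mult.assoc)
  qed
  have step: "phase \<delta> e = phase \<epsilon> e * exp (\<i> * of_real ((\<delta> - \<epsilon>) * \<alpha> e))" for \<delta> \<epsilon> e
    by (simp add: phase_def exp_add[symmetric] algebra_simps)
  have le: "a * (c * cvec_norm V x) \<le> K0 * r * cvec_norm V x" if "c * b \<le> K0" "a \<le> b * r" "r \<ge> 0" for a b r x
  proof -
    have "a * (c * cvec_norm V x) \<le> (b * r) * (c * cvec_norm V x)"
      using that c0 n0 by (intro mult_right_mono) auto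
    also have "\<dots> = (c * b) * (r * cvec_norm V x)" by simp
    also have "\<dots> \<le> K0 * (r * cvec_norm V x)" using that n0 by (intro mult_right_mono) auto
    finally show ?thesis by (simp add: mult.assoc)
  qed
  show ?thesis
  proof (rule that)
    show "K > 0" unfolding K_def using K0_nonneg by (simp add: add_nonneg_pos)
    show "cvec_norm E (twist \<epsilon> x) \<le> K * cvec_norm V x" for x \<epsilon>
    proof -
      have "cmod (twist \<epsilon> x e) \<le> K0 * 1 * cvec_norm V x" if "e \<in> E" for e
      proof -
        have "cmod (twist \<epsilon> x e) \<le> cmod (phase \<epsilon> e * (x (t e) / of_real (sqrt (k (t e)))))
            + cmod (x (s e) / of_real (sqrt (k (s e))))"
          unfolding twist_def times_divide_eq_right[symmetric] by (rule norm_triangle_ineq4)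
        also have "\<dots> \<le> c * cvec_norm V x + c * cvec_norm V x"
          unfolding norm_mult norm_phase mult_1_left by (intro add_mono c s_V t_V that)
        finally show ?thesis using le[of 2 2 1 x] K0(1) by simp
      qed
      then show ?thesis using conv[of 1] by simp
    qed
    show "cvec_norm E (twist' \<epsilon> x) \<le> K * cvec_norm V x" for x \<epsilon>
    proof -
      have "cmod (twist' \<epsilon> x e) \<le> K0 * 1 * cvec_norm V x" if "e \<in> E" for e
      proof -
        have "cmod (twist' \<epsilon> x e) = \<bar>\<alpha> e\<bar> * cmod (x (t e) / of_real (sqrt (k (t e))))"
          by (simp add: twist'_def norm_mult norm_divide)
        also have "\<dots> \<le> \<bar>\<alpha> e\<bar> * (c * cvec_norm V x)" by (intro mult_left_mono c t_V that) auto
        finally show ?thesis using le[OF K0(2), of "\<bar>\<alpha> e\<bar>" 1 x] A[OF that] by simp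
      qed
      then show ?thesis using conv[of 1] by simp
    qed
    show "cvec_norm E (\<lambda>e. twist \<delta> x e - twist \<epsilon> x e) \<le> K * \<bar>\<delta> - \<epsilon>\<bar> * cvec_norm V x" for x \<epsilon> \<delta>
    proof (rule conv)
      fix e assume e: "e \<in> E"
      let ?y = "(\<delta> - \<epsilon>) * \<alpha> e"
      have "twist \<delta> x e - twist \<epsilon> x e = phase \<epsilon> e * (exp (\<i> * of_real ?y) - 1) * (x (t e) / of_real (sqrt (k (t e))))"
        unfolding twist_def step[of \<delta> e \<epsilon>] by (simp add: algebra_simps diff_divide_distrib)
      then have "cmod (twist \<delta> x e - twist \<epsilon> x e) = cmod (exp (\<i> * of_real ?y) - 1) * cmod (x (t e) / of_real (sqrt (k (t e))))"
        by (simp only: norm_mult norm_phase mult_1_left)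
      also have "\<dots> \<le> \<bar>?y\<bar> * (c * cvec_norm V x)"
        by (intro mult_mono norm_exp_i_minus_1 c t_V e) auto
      also have "\<dots> \<le> K0 * \<bar>\<delta> - \<epsilon>\<bar> * cvec_norm V x"
        using A[OF e] by (intro le[OF K0(2)]) (auto simp: abs_mult mult.commute[of "\<bar>\<delta> - \<epsilon>\<bar>"] intro: mult_right_mono)
      finally show "cmod (twist \<delta> x e - twist \<epsilon> x e) \<le> K0 * \<bar>\<delta> - \<epsilon>\<bar> * cvec_norm V x" .
    qed simp
    show "cvec_norm E (\<lambda>e. twist \<delta> x e - twist \<epsilon> x e - of_real (\<delta> - \<epsilon>) * twist' \<epsilon> x e)
      \<le> K * (\<delta> - \<epsilon>)\<^sup>2 * cvec_norm V x" for x \<epsilon> \<delta>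
    proof (rule conv)
      fix e assume e: "e \<in> E"
      let ?y = "(\<delta> - \<epsilon>) * \<alpha> e"
      have "twist \<delta> x e - twist \<epsilon> x e - of_real (\<delta> - \<epsilon>) * twist' \<epsilon> x e
         = phase \<epsilon> e * (exp (\<i> * of_real ?y) - 1 - \<i> * of_real ?y) * (x (t e) / of_real (sqrt (k (t e))))"
        unfolding twist_def twist'_def step[of \<delta> e \<epsilon>] by (simp add: algebra_simps diff_divide_distrib)
      then have "cmod (twist \<delta> x e - twist \<epsilon> x e - of_real (\<delta> - \<epsilon>) * twist' \<epsilon> x e)
          = cmod (exp (\<i> * of_real ?y) - 1 - \<i> * of_real ?y) * cmod (x (t e) / of_real (sqrt (k (t e))))"
        by (simp only: norm_mult norm_phase mult_1_left)
      also have "\<dots> \<le> ?y\<^sup>2 * (c * cvec_norm V x)"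
        by (intro mult_mono norm_exp_i_taylor c t_V e) auto
      also have "\<dots> \<le> K0 * (\<delta> - \<epsilon>)\<^sup>2 * cvec_norm V x"
        using power_mono[OF A[OF e], of 2]
        by (intro le[OF K0(3)]) (auto simp: power_mult_distrib mult.commute[of "(\<delta> - \<epsilon>)\<^sup>2"] intro: mult_right_mono)
      finally show "cmod (twist \<delta> x e - twist \<epsilon> x e - of_real (\<delta> - \<epsilon>) * twist' \<epsilon> x e)
         \<le> K0 * (\<delta> - \<epsilon>)\<^sup>2 * cvec_norm V x" .
    qed simp
  qed
qed

text \<open>
  The class of \<open>h\<close> modulo gradients \<open>twist 0 g\<close> contains a cycle, namely the component of
  \<open>h\<close> orthogonal to the finite-dimensional space of gradients.  The projection is taken over the reals,
  but multiplication by \<open>\<i>\<close> maps gradients to gradients, so orthogonality holds over the complex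
  numbers.  Removing the ground state component of \<open>g\<close> leaves its gradient unchanged.
\<close>

lemma exists_harmonic_representative:
  "\<exists>g y. cvec_inner V g ground = 0 \<and> (\<forall>e\<in>E. y e = h e + twist 0 g e) \<and>
    (\<forall>w. cvec_inner E y (twist 0 w) = 0)"
proof -
  define unit where "unit = (\<lambda>(v, c). vec_on E (twist 0 (\<lambda>u. if u = v then c else 0)))"
  \<comment> \<open>The gradients of the real basis \<open>\<delta>\<^sub>v\<close>, \<open>\<i> \<delta>\<^sub>v\<close>; their real span consists of all gradients.\<close>
  define B where "B = unit ` (V \<times> {1, \<i>})"
  have finB: "finite B" unfolding B_def using finite_V by simp
  have range: "vec_on E (twist 0 w) \<in> span B" for w
  proof -
    have "vec_on E (twist 0 w) = (\<Sum>v\<in>V. Re (w v) *\<^sub>R unit (v, 1) + Im (w v) *\<^sub>R unit (v, \<i>))" (is "?l = ?r")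
    proof (rule poly_mapping_eqI)
      fix e
      show "Poly_Mapping.lookup ?l e = Poly_Mapping.lookup ?r e"
      proof (cases "e \<in> E")
        case False
        then show ?thesis by (simp add: lookup_sum lookup_add unit_def lookup_vec_on[OF finite_E])
      next
        case True
        have "Poly_Mapping.lookup ?r e
          = (\<Sum>v\<in>V. of_real (Re (w v)) * twist 0 (\<lambda>u. if u = v then 1 else 0) e
              + of_real (Im (w v)) * twist 0 (\<lambda>u. if u = v then \<i> else 0) e)"
          using True by (simp add: lookup_sum lookup_add unit_def lookup_vec_on[OF finite_E] scaleR_conv_of_real)
        also have "\<dots> = (\<Sum>v\<in>V. (if t e = v then w v else 0) / of_real (sqrt (k (t e)))
              - (if s e = v then w v else 0) / of_real (sqrt (k (s e))))"
        proof (intro sum.cong refl)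
          fix v
          have "(if P then w v else 0) = of_real (Re (w v)) * (if P then 1 else 0)
              + of_real (Im (w v)) * (if P then \<i> else 0)" for P
            by (simp add: complex_eq_iff)
          then show "of_real (Re (w v)) * twist 0 (\<lambda>u. if u = v then 1 else 0) e
              + of_real (Im (w v)) * twist 0 (\<lambda>u. if u = v then \<i> else 0) e
              = (if t e = v then w v else 0) / of_real (sqrt (k (t e)))
              - (if s e = v then w v else 0) / of_real (sqrt (k (s e)))"
            by (simp only: twist_def phase_0 mult_1_left)
              (simp only: add_divide_distrib right_diff_distrib times_divide_eq_right, simp)
        qed
        also have "\<dots> = twist 0 w e"
          using s_V[OF True] t_V[OF True] finite_V
          by (simp add: sum_subtractf sum_divide_distrib[symmetric] twist_def)
        finally show ?thesis using True by (simp add: lookup_vec_on[OF finite_E])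
      qed
    qed
    also have "\<dots> \<in> span B"
      by (intro span_sum span_add span_scale span_base) (auto simp: B_def)
    finally show ?thesis .
  qed
  have in_range: "\<exists>p. b = vec_on E (twist 0 p)" if "b \<in> span B" for b
    using that
  proof (induction rule: span_induct_alt)
    case base
    show ?case by (intro exI[of _ "\<lambda>_. 0"] poly_mapping_eqI) (simp add: lookup_vec_on[OF finite_E] twist_def)
  next
    case (step c x y)
    then obtain v d p where *: "x = unit (v, d)" "y = vec_on E (twist 0 p)" by (auto simp: B_def)
    show ?case
      by (rule exI[of _ "\<lambda>u. of_real c * (if u = v then d else 0) + p u"], rule poly_mapping_eqI)
        (simp only: * unit_def case_prod_conv lookup_add lookup_scaleR lookup_vec_on[OF finite_E] twist_add twist_scale,
          simp add: scaleR_conv_of_real)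
  qed
  obtain z where z: "z \<in> span B" "\<forall>b\<in>span B. inner (vec_on E h - z) b = 0"
    using exists_orthogonal_projection[OF finB] by blast
  obtain p where p: "z = vec_on E (twist 0 p)" using in_range[OF z(1)] by blast
  define a where "a = cvec_inner V p ground"
  define g where "g v = a * ground v - p v" for v
  define y where "y e = h e + twist 0 g e" for e
  have tg: "twist 0 g e = - twist 0 p e" if "e \<in> E" for e
  proof -
    have "twist 0 g e = twist 0 (\<lambda>v. a * ground v + (- 1) * p v) e" by (simp add: g_def[abs_def])
    also have "\<dots> = - twist 0 p e" unfolding twist_add twist_scale using twist_ground[OF that] by simp
    finally show ?thesis .
  qed
  have "cvec_inner V g ground = a * cvec_inner V ground ground - cvec_inner V p ground"
    by (simp add: g_def cvec_inner_def left_diff_distrib sum_subtractf sum_distrib_left mult.assoc)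
  then have g: "cvec_inner V g ground = 0" by (simp add: cvec_inner_self norm_ground a_def)
  have y_eq: "vec_on E h - z = vec_on E y"
    by (rule poly_mapping_eqI) (simp add: p lookup_minus lookup_vec_on[OF finite_E] y_def tg)
  have re: "Re (cvec_inner E y (twist 0 w)) = 0" for w
    using z(2) range[of w] unfolding y_eq inner_vec_on[OF finite_E, symmetric] by blast
  have "cvec_inner E y (twist 0 w) = 0" for w
  proof -
    have "cvec_inner E y (twist 0 (\<lambda>v. \<i> * w v)) = - \<i> * cvec_inner E y (twist 0 w)"
      by (simp add: twist_scale cvec_inner_def sum_distrib_left mult_ac sum_negf)
    then have "Im (cvec_inner E y (twist 0 w)) = 0" using re[of "\<lambda>v. \<i> * w v"] by simp
    then show ?thesis using re[of w] by (simp add: complex_eq_iff)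
  qed
  then show ?thesis using g y_def by blast
qed

text \<open>
  The vector spaces over \<open>V\<close> and \<open>E\<close> are realized inside the finitely supported functions, and
  the abstract perturbation result applies: \<open>twist' 0 ground\<close> is \<open>\<i>\<close> times the vector of slopes
  divided by the square root of the total degree.
\<close>

theorem lam_near_0:
  assumes g: "cvec_inner V g ground = 0"
    and y: "\<And>e. e \<in> E \<Longrightarrow> y e = \<i> * of_real (\<alpha> e) / of_real (sqrt (sum k V)) + twist 0 g e"
    and y_orth: "\<And>w. cvec_inner E y (twist 0 w) = 0"
  shows "(\<lambda>\<epsilon>. lam \<epsilon> - \<epsilon>\<^sup>2 * (cvec_norm E y)\<^sup>2) \<in> O[at_right 0](\<lambda>\<epsilon>. \<epsilon> ^ 3)"
    and "\<forall>\<^sub>F \<epsilon> in nhds 0. lam differentiable (at \<epsilon>)"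
    and "deriv lam differentiable (at 0)"
    and "deriv (deriv lam) 0 = 2 * (cvec_norm E y)\<^sup>2"
proof -
  let ?l = "Poly_Mapping.lookup :: ('v \<Rightarrow>\<^sub>0 complex) \<Rightarrow> 'v \<Rightarrow> complex"
  define D where "D \<epsilon> x = vec_on E (twist \<epsilon> (?l x))" for \<epsilon> x
  define D' where "D' \<epsilon> x = vec_on E (twist' \<epsilon> (?l x))" for \<epsilon> x
  define U where "U = {x :: 'v \<Rightarrow>\<^sub>0 complex. Poly_Mapping.keys x \<subseteq> V}"
  define G where "G = {x\<in>U. cvec_inner V (?l x) ground = 0}"
  define f0 where "f0 = vec_on V ground"
  obtain K where K: "K > 0"
    "\<And>x \<epsilon>. cvec_norm E (twist \<epsilon> x) \<le> K * cvec_norm V x"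
    "\<And>x \<epsilon>. cvec_norm E (twist' \<epsilon> x) \<le> K * cvec_norm V x"
    "\<And>x \<epsilon> \<delta>. cvec_norm E (\<lambda>e. twist \<delta> x e - twist \<epsilon> x e) \<le> K * \<bar>\<delta> - \<epsilon>\<bar> * cvec_norm V x"
    "\<And>x \<epsilon> \<delta>. cvec_norm E (\<lambda>e. twist \<delta> x e - twist \<epsilon> x e - of_real (\<delta> - \<epsilon>) * twist' \<epsilon> x e)
      \<le> K * (\<delta> - \<epsilon>)\<^sup>2 * cvec_norm V x"
    using twist_bounds by blast
  obtain \<gamma> where \<gamma>: "\<gamma> > 0"
    "\<And>x. x \<in> cvecs V \<Longrightarrow> cvec_inner V x ground = 0 \<Longrightarrow> \<gamma> * cvec_norm V x \<le> cvec_norm E (twist 0 x)"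
    using spectral_gap by blast
  note lv = lookup_vec_on[OF finite_V] and le = lookup_vec_on[OF finite_E]
  have cv: "?l x \<in> cvecs V" if "x \<in> U" for x
    using that by (auto simp: U_def cvecs_def in_keys_iff subset_iff)
  have nU: "norm x = cvec_norm V (?l x)" if "x \<in> U" for x
    using that norm_vec_on[OF finite_V, of "?l x"] vec_on_lookup[OF finite_V, of x] by (simp add: U_def)
  have iU: "inner x w = Re (cvec_inner V (?l x) (?l w))" if "x \<in> U" "w \<in> U" for x w
    using that inner_vec_on[OF finite_V, of "?l x" "?l w"] vec_on_lookup[OF finite_V] by (simp add: U_def)
  have vU: "vec_on V x \<in> U" for x by (simp add: U_def keys_vec_on[OF finite_V])
  have inner_cong: "cvec_inner V (?l (vec_on V x)) w = cvec_inner V x w" for x w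
    by (rule cvec_inner_cong) (simp_all add: lv)
  have twc: "twist \<epsilon> (?l (vec_on V x)) e = twist \<epsilon> x e" if "e \<in> E" for \<epsilon> x e
    by (rule twist_cong[OF that]) (simp add: lv)
  have subU: "subspace U" unfolding U_def by (rule subspace_keys)
  have "kernel_perturbation D D' U G f0 K \<gamma> lam"
  proof (rule kernel_perturbation.intro)
    have add: "?l (x + y) = (\<lambda>v. ?l x v + ?l y v)" and scale: "?l (c *\<^sub>R x) = (\<lambda>v. of_real c * ?l x v)"
      for x y and c :: real
      by (simp_all add: fun_eq_iff lookup_add scaleR_conv_of_real)
    show "linear (D \<epsilon>)" for \<epsilon>
      by (intro linearI poly_mapping_eqI)
        (simp_all only: D_def add scale twist_add twist_scale, simp_all add: le lookup_add scaleR_conv_of_real twist_add twist_scale)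
    show "linear (D' \<epsilon>)" for \<epsilon>
      by (intro linearI poly_mapping_eqI)
        (simp_all only: D'_def add scale twist'_def[abs_def],
          simp_all add: le lookup_add scaleR_conv_of_real add_divide_distrib ring_distribs)
    show "subspace U" by (rule subU)
    show "subspace G"
      using subU unfolding G_def subspace_def
      by (auto simp: cvec_inner_def lookup_add distrib_right sum.distrib scaleR_conv_of_real mult.assoc
          sum_distrib_left[symmetric])
    show "G \<subseteq> U" by (auto simp: G_def)
    show "f0 \<in> U" by (simp add: f0_def vU)
    show "norm f0 = 1" by (simp add: f0_def norm_vec_on[OF finite_V] norm_ground)
    show "inner f0 g = 0" if "g \<in> G" for g
    proof -
      have "inner f0 g = inner g f0" by (rule inner_commute)
      also have "\<dots> = Re (cvec_inner V (?l g) (?l f0))"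
        using that by (intro iU) (auto simp: G_def f0_def vU)
      also have "cvec_inner V (?l g) (?l f0) = cvec_inner V (?l g) ground"
        by (rule cvec_inner_cong) (simp_all add: f0_def lv)
      finally show ?thesis using that by (simp add: G_def)
    qed
    show "K > 0" by (rule K)
    show "norm (D \<epsilon> x) \<le> K * norm x" if "x \<in> U" for \<epsilon> x
      by (simp add: D_def norm_vec_on[OF finite_E] nU[OF that] K)
    show "norm (D' \<epsilon> x) \<le> K * norm x" if "x \<in> U" for \<epsilon> x
      by (simp add: D'_def norm_vec_on[OF finite_E] nU[OF that] K)
    show "norm (D \<delta> x - D \<epsilon> x) \<le> K * \<bar>\<delta> - \<epsilon>\<bar> * norm x" if "x \<in> U" for \<delta> \<epsilon> x
    proof -
      have "D \<delta> x - D \<epsilon> x = vec_on E (\<lambda>e. twist \<delta> (?l x) e - twist \<epsilon> (?l x) e)"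
        by (rule poly_mapping_eqI) (simp add: D_def le lookup_minus)
      then show ?thesis by (simp add: norm_vec_on[OF finite_E] nU[OF that] K)
    qed
    show "norm (D \<delta> x - D \<epsilon> x - (\<delta> - \<epsilon>) *\<^sub>R D' \<epsilon> x) \<le> K * (\<delta> - \<epsilon>)\<^sup>2 * norm x" if "x \<in> U" for \<delta> \<epsilon> x
    proof -
      have "D \<delta> x - D \<epsilon> x - (\<delta> - \<epsilon>) *\<^sub>R D' \<epsilon> x
        = vec_on E (\<lambda>e. twist \<delta> (?l x) e - twist \<epsilon> (?l x) e - of_real (\<delta> - \<epsilon>) * twist' \<epsilon> (?l x) e)"
        by (rule poly_mapping_eqI) (simp add: D_def D'_def le lookup_minus scaleR_conv_of_real)
      then show ?thesis using K(5)[of \<delta> "?l x" \<epsilon>] by (simp add: norm_vec_on[OF finite_E] nU[OF that])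
    qed
    show "D 0 f0 = 0"
      by (rule poly_mapping_eqI) (simp add: D_def f0_def le twc twist_ground)
    show "\<gamma> > 0" by (rule \<gamma>)
    show "\<gamma> * norm x \<le> norm (D 0 x)" if "x \<in> G" for x
      using that \<gamma>(2)[OF cv, of x] by (simp add: G_def D_def norm_vec_on[OF finite_E] nU)
    show "lam \<epsilon> * (norm x)\<^sup>2 \<le> (norm (D \<epsilon> x))\<^sup>2" if "x \<in> U" for \<epsilon> x
      using lam_le_form[OF cv[OF that]] by (simp add: D_def norm_vec_on[OF finite_E] nU[OF that])
    show "\<exists>x c g. x \<noteq> 0 \<and> g \<in> G \<and> x = c *\<^sub>R f0 + g \<and>
      (\<forall>w\<in>U. inner (D \<epsilon> x) (D \<epsilon> w) = lam \<epsilon> * inner x w)" for \<epsilon>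
    proof -
      obtain x c where x: "x \<in> cvecs V" "x \<noteq> (\<lambda>_. 0)" "cvec_inner V x ground = of_real c"
        "\<And>w. cvec_inner E (twist \<epsilon> x) (twist \<epsilon> w) = of_real (lam \<epsilon>) * cvec_inner V x w"
        using lam_eigenvector[of \<epsilon>] by blast
      define x' where "x' = vec_on V x"
      have lx: "?l x' = x" using x(1) by (auto simp: x'_def lv cvecs_def fun_eq_iff)
      have "x' \<noteq> 0" using x(2) lx by (auto simp: fun_eq_iff)
      moreover have "x' - c *\<^sub>R f0 \<in> G"
      proof -
        have "cvec_inner V (?l (x' - c *\<^sub>R f0)) ground
            = cvec_inner V x ground - of_real c * cvec_inner V ground ground"
          unfolding cvec_inner_def sum_distrib_left sum_subtractf[symmetric]
          by (intro sum.cong refl)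
            (simp add: lookup_minus lx f0_def lv scaleR_conv_of_real left_diff_distrib mult.assoc)
        then show ?thesis
          using subU by (simp add: G_def x(3) cvec_inner_self norm_ground x'_def f0_def vU subspace_diff subspace_scale)
      qed
      moreover have "inner (D \<epsilon> x') (D \<epsilon> w) = lam \<epsilon> * inner x' w" if "w \<in> U" for w
        using that x(4)[of "?l w"]
        by (simp add: D_def inner_vec_on[OF finite_E] iU x'_def vU) (simp add: x'_def[symmetric] lx)
      ultimately show ?thesis
        by (intro exI[of _ x'] exI[of _ c] exI[of _ "x' - c *\<^sub>R f0"]) simp
    qed
  qed
  then interpret kernel_perturbation D D' U G f0 K \<gamma> lam .
  define g1 where "g1 = vec_on V g"
  have g1: "g1 \<in> G" using g by (simp add: G_def g1_def vU inner_cong)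
  have y0: "vec_on E y = D' 0 f0 + D 0 g1"
  proof (rule poly_mapping_eqI)
    fix e
    show "Poly_Mapping.lookup (vec_on E y) e = Poly_Mapping.lookup (D' 0 f0 + D 0 g1) e"
    proof (cases "e \<in> E")
      case True
      have "twist' 0 (?l f0) e = \<i> * of_real (\<alpha> e) * (ground (t e) / of_real (sqrt (k (t e))))"
        using t_V[OF True] by (simp add: twist'_def f0_def lv)
      also have "\<dots> = \<i> * of_real (\<alpha> e) / of_real (sqrt (sum k V))"
        by (simp only: ground_over_sqrt[OF t_V[OF True]]) simp
      finally show ?thesis using True by (simp add: lookup_add le D_def D'_def y twc g1_def)
    qed (simp add: lookup_add le D_def D'_def)
  qed
  have orth: "inner (vec_on E y) (D 0 w) = 0" for w
    by (simp add: D_def inner_vec_on[OF finite_E] y_orth)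
  show "(\<lambda>\<epsilon>. lam \<epsilon> - \<epsilon>\<^sup>2 * (cvec_norm E y)\<^sup>2) \<in> O[at_right 0](\<lambda>\<epsilon>. \<epsilon> ^ 3)"
    and "\<forall>\<^sub>F \<epsilon> in nhds 0. lam differentiable (at \<epsilon>)"
    and "deriv lam differentiable (at 0)"
    and "deriv (deriv lam) 0 = 2 * (cvec_norm E y)\<^sup>2"
    using lam_expansion[OF g1 y0 orth] lam_twice_differentiable[OF g1 y0 orth]
    by (simp_all add: norm_vec_on[OF finite_E])
qed

text \<open>
  Adding up \<open>y\<close> around the cycle formed by \<open>e0\<close> and a path \<open>S\<close> joining its end points cancels the
  gradient and leaves only the contribution of the slope of \<open>e0\<close>, as the slopes vanish on \<open>S\<close>.  The cycle has at most
  \<open>card V\<close> edges, whence the factor in the Cauchy-Schwarz inequality.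
\<close>

lemma harmonic_lower_bound:
  assumes y: "\<And>e. e \<in> E \<Longrightarrow> y e = \<i> * of_real (\<alpha> e) / of_real (sqrt (sum k V)) + twist 0 g e"
    and e0: "e0 \<in> E" "e0 \<notin> S" and S: "S \<subseteq> E" "card S + 1 \<le> card V" "\<forall>e\<in>S. \<alpha> e = 0"
    and path: "\<And>G :: 'v \<Rightarrow> complex. cmod (G (t e0) - G (s e0)) \<le> (\<Sum>e\<in>S. cmod (G (t e) - G (s e)))"
  shows "(\<alpha> e0)\<^sup>2 / (sum k V * real (card V)) \<le> (cvec_norm E y)\<^sup>2"
proof -
  define G where "G v = g v / of_real (sqrt (k v))" for v
  have tw: "twist 0 g e = G (t e) - G (s e)" for e by (simp add: twist_def G_def)
  have finS: "finite S" using S(1) finite_E finite_subset by blast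
  have "\<bar>\<alpha> e0\<bar> / sqrt (sum k V) = cmod (\<i> * of_real (\<alpha> e0) / of_real (sqrt (sum k V)))"
    using sum_k_pos by (simp add: norm_mult norm_divide)
  also have "\<dots> = cmod (y e0 - (G (t e0) - G (s e0)))" by (simp add: y[OF e0(1)] tw)
  also have "\<dots> \<le> cmod (y e0) + cmod (G (t e0) - G (s e0))" by (rule norm_triangle_ineq4)
  also have "\<dots> \<le> cmod (y e0) + (\<Sum>e\<in>S. cmod (G (t e) - G (s e)))" by (intro add_left_mono path)
  also have "(\<Sum>e\<in>S. cmod (G (t e) - G (s e))) = (\<Sum>e\<in>S. cmod (y e))"
    using S by (intro sum.cong refl) (auto simp: y tw)
  also have "cmod (y e0) + \<dots> = (\<Sum>e\<in>insert e0 S. cmod (y e))" using e0(2) finS by simp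
  finally have "(\<bar>\<alpha> e0\<bar> / sqrt (sum k V))\<^sup>2 \<le> (\<Sum>e\<in>insert e0 S. cmod (y e))\<^sup>2"
    using sum_k_pos by (intro power_mono) auto
  then have "(\<alpha> e0)\<^sup>2 / sum k V \<le> (\<Sum>e\<in>insert e0 S. cmod (y e))\<^sup>2"
    using sum_k_pos by (simp add: power_divide)
  also have "\<dots> \<le> (\<Sum>e\<in>insert e0 S. (cmod (y e))\<^sup>2) * real (card (insert e0 S))"
    using sum_squared_le_sum_of_squares[of "\<lambda>e. cmod (y e)" "insert e0 S"] finS by simp
  also have "\<dots> \<le> (cvec_norm E y)\<^sup>2 * real (card V)"
    unfolding cvec_norm_sq using S e0 finS finite_E by (intro mult_mono sum_mono2) (auto intro: sum_nonneg)
  finally show ?thesis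
    using sum_k_pos V_ne finite_V by (simp add: field_simps card_gt_0_iff)
qed

end


section \<open>The fundamental graph of a periodic graph\<close>

context periodic_graph
begin

abbreviation "verts_F \<equiv> verts (fund_graph \<Gamma>)"
abbreviation "arcs_F \<equiv> arcs (fund_graph \<Gamma>)"
abbreviation "tail_F \<equiv> tail (fund_graph \<Gamma>)"
abbreviation "head_F \<equiv> head (fund_graph \<Gamma>)"

lemma vorbit_vshift:
  assumes "v \<in> verts (base \<Gamma>)"
  shows "vorbit \<Gamma> (vshift \<Gamma> m v) = vorbit \<Gamma> v"
  unfolding vorbit_def
proof (intro equalityI image_subsetI)
  fix n
  have "vshift \<Gamma> n (vshift \<Gamma> m v) = vshift \<Gamma> (n + m) v"
    by (rule vshift_add[OF assms, symmetric])
  then show "vshift \<Gamma> n (vshift \<Gamma> m v) \<in> range (\<lambda>n. vshift \<Gamma> n v)" by (rule range_eqI)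
  have "vshift \<Gamma> n v = vshift \<Gamma> (n - m) (vshift \<Gamma> m v)"
    using vshift_add[OF assms, of "n - m" m] by (simp only: diff_add_cancel)
  then show "vshift \<Gamma> n v \<in> range (\<lambda>n. vshift \<Gamma> n (vshift \<Gamma> m v))" by (rule range_eqI)
qed

lemma self_in_vorbit: "v \<in> verts (base \<Gamma>) \<Longrightarrow> v \<in> vorbit \<Gamma> v"
  unfolding vorbit_def by (metis rangeI vshift_zero)

lemma vorbit_eq_iff:
  assumes "u \<in> verts (base \<Gamma>)" "v \<in> verts (base \<Gamma>)"
  shows "vorbit \<Gamma> u = vorbit \<Gamma> v \<longleftrightarrow> (\<exists>m. v = vshift \<Gamma> m u)"
  using assms self_in_vorbit[of v] vorbit_vshift[of u] by (auto simp: vorbit_def)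

lemma self_in_aorbit: "a \<in> arcs (base \<Gamma>) \<Longrightarrow> a \<in> aorbit \<Gamma> a"
  unfolding aorbit_def by (metis rangeI ashift_zero)

lemma tail_F_aorbit: "a \<in> arcs (base \<Gamma>) \<Longrightarrow> tail_F (aorbit \<Gamma> a) = vorbit \<Gamma> (tail (base \<Gamma>) a)"
  by (auto simp: fund_graph_def aorbit_def vorbit_def image_image tail_ashift)

lemma head_F_aorbit: "a \<in> arcs (base \<Gamma>) \<Longrightarrow> head_F (aorbit \<Gamma> a) = vorbit \<Gamma> (head (base \<Gamma>) a)"
  by (auto simp: fund_graph_def aorbit_def vorbit_def image_image head_ashift)

lemma flip_F_aorbit: "a \<in> arcs (base \<Gamma>) \<Longrightarrow> fund_flip \<Gamma> (aorbit \<Gamma> a) = aorbit \<Gamma> (flip \<Gamma> a)"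
  by (auto simp: fund_flip_def aorbit_def image_image flip_ashift)

lemma verts_F_eq: "verts_F = vorbit \<Gamma> ` verts (base \<Gamma>)"
  and arcs_F_eq: "arcs_F = aorbit \<Gamma> ` arcs (base \<Gamma>)"
  by (simp_all add: fund_graph_def)

lemma arc_F_cases:
  assumes "X \<in> arcs_F"
  obtains a where "a \<in> arcs (base \<Gamma>)" "X = aorbit \<Gamma> a"
  using assms by (auto simp: arcs_F_eq)

lemma flip_F_arcs: "X \<in> arcs_F \<Longrightarrow> fund_flip \<Gamma> X \<in> arcs_F"
  and flip_flip_F: "X \<in> arcs_F \<Longrightarrow> fund_flip \<Gamma> (fund_flip \<Gamma> X) = X"
  and tail_flip_F: "X \<in> arcs_F \<Longrightarrow> tail_F (fund_flip \<Gamma> X) = head_F X"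
  and head_flip_F: "X \<in> arcs_F \<Longrightarrow> head_F (fund_flip \<Gamma> X) = tail_F X"
  and tail_F_verts: "X \<in> arcs_F \<Longrightarrow> tail_F X \<in> verts_F"
  and head_F_verts: "X \<in> arcs_F \<Longrightarrow> head_F X \<in> verts_F"
  by (auto elim!: arc_F_cases simp: flip_F_aorbit tail_F_aorbit head_F_aorbit arcs_F_eq verts_F_eq)

end

locale periodic_tree = periodic_graph \<Gamma>
  for \<Gamma> :: "('v,'a,'d::finite) periodic_data" +
  fixes T :: "('v,'a) pre_digraph" and E :: "'a set set"
  assumes tree: "fundamental_tree \<Gamma> T"
    and orientation: "is_orientation (fund_graph \<Gamma>) (fund_flip \<Gamma>) E"
begin

abbreviation "V0 \<equiv> verts T"
abbreviation "\<tau> \<equiv> index \<Gamma> V0"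

lemma T_sub: "subgraph T (base \<Gamma>)" and T_flip: "flip \<Gamma> ` arcs T \<subseteq> arcs T"
  and T_connected: "Digraph_Component.connected T" and V0: "fundamental_vertex_set \<Gamma> V0"
  using tree by (auto simp: fundamental_tree_def is_tree_def)

lemma V0_verts: "v \<in> V0 \<Longrightarrow> v \<in> verts (base \<Gamma>)"
  using V0 by (auto simp: fundamental_vertex_set_def)

lemma verts_F_ne: "verts_F \<noteq> {}"
  using infinite_verts by (auto simp: verts_F_eq)

lemma inj_vorbit: "inj_on (vorbit \<Gamma>) V0"
  by (rule inj_onI) (metis V0 V0_verts vorbit_eq_iff fundamental_vertex_set_def)

text \<open>
  Inequivalent vertices have different orbits; as their number is the number of all orbits,
  every orbit meets the vertex set of the tree.
\<close>

lemma vorbit_V0: "vorbit \<Gamma> ` V0 = verts_F"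
proof (rule card_subset_eq[OF finite_fund_verts])
  show "vorbit \<Gamma> ` V0 \<subseteq> verts_F" using V0_verts by (auto simp: verts_F_eq)
  show "card (vorbit \<Gamma> ` V0) = card verts_F"
    using V0 card_image[OF inj_vorbit] by (simp add: fundamental_vertex_set_def)
qed

lemma finite_V0: "finite V0"
  using finite_fund_verts inj_vorbit vorbit_V0 by (metis finite_image_iff)

lemma card_V0: "card V0 = card verts_F"
  using V0 by (simp add: fundamental_vertex_set_def)

text \<open>
  If \<open>v\<^sub>0 + m = v\<^sub>1 + n\<close> with \<open>v\<^sub>1\<close> in the tree, then \<open>v\<^sub>0\<close> and \<open>v\<^sub>1\<close> are equivalent, hence equal, and freeness of the action
  gives \<open>n = m\<close>.
\<close>

lemma cell_vshift_V0:
  assumes v0: "v0 \<in> V0"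
  shows "cell \<Gamma> V0 (vshift \<Gamma> m v0) = m"
  unfolding cell_def
proof (rule the_equality)
  show "\<exists>v1\<in>V0. vshift \<Gamma> m v0 = vshift \<Gamma> m v1" using v0 by blast
  fix n assume "\<exists>v1\<in>V0. vshift \<Gamma> m v0 = vshift \<Gamma> n v1"
  then obtain v1 where v1: "v1 \<in> V0" "vshift \<Gamma> m v0 = vshift \<Gamma> n v1" by blast
  have "vorbit \<Gamma> v0 = vorbit \<Gamma> v1"
    using v1 v0 V0_verts vorbit_vshift by metis
  then have eq: "v1 = v0" using inj_vorbit v0 v1 by (auto dest: inj_onD)
  have "vshift \<Gamma> (- n + m) v0 = vshift \<Gamma> (- n + n) v0"
    using v1(2) V0_verts[OF v0] by (simp only: vshift_add eq)
  then have "vshift \<Gamma> (- n + m) v0 = v0" using V0_verts[OF v0] by (simp add: vshift_zero)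
  then have "- n + m = 0" by (rule vshift_free[OF V0_verts[OF v0]])
  then show "n = m" by (metis add.inverse_inverse add_eq_0_iff neg_eq_iff_add_eq_0)
qed

lemma vert_cases:
  assumes "v \<in> verts (base \<Gamma>)"
  obtains v0 m where "v0 \<in> V0" "v = vshift \<Gamma> m v0"
proof -
  have "vorbit \<Gamma> v \<in> vorbit \<Gamma> ` V0" using assms vorbit_V0 verts_F_eq by auto
  then obtain v0 where "v0 \<in> V0" "vorbit \<Gamma> v0 = vorbit \<Gamma> v" by (metis imageE)
  then show ?thesis using that assms V0_verts by (auto simp: vorbit_eq_iff)
qed

lemma cell_vshift:
  assumes "v \<in> verts (base \<Gamma>)"
  shows "cell \<Gamma> V0 (vshift \<Gamma> m v) = m + cell \<Gamma> V0 v"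
proof -
  obtain v0 n where v: "v0 \<in> V0" "v = vshift \<Gamma> n v0" by (rule vert_cases[OF assms])
  have "vshift \<Gamma> m v = vshift \<Gamma> (m + n) v0" using v V0_verts by (simp add: vshift_add)
  then show ?thesis using v cell_vshift_V0 by simp
qed

lemma cell_V0: "v \<in> V0 \<Longrightarrow> cell \<Gamma> V0 v = 0"
  using cell_vshift_V0[of v 0] V0_verts vshift_zero by simp

text \<open>
  A translation adds the same vector to the cells of both end points.
\<close>

lemma index_aorbit:
  assumes a: "a \<in> arcs (base \<Gamma>)"
  shows "\<tau> (aorbit \<Gamma> a) = arc_index \<Gamma> V0 a"
proof -
  have "arc_index \<Gamma> V0 (ashift \<Gamma> m a) = arc_index \<Gamma> V0 a" for m
    using a by (simp add: arc_index_def tail_ashift head_ashift cell_vshift)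
  then have "\<forall>b\<in>aorbit \<Gamma> a. arc_index \<Gamma> V0 b = arc_index \<Gamma> V0 a"
    by (auto simp: aorbit_def)
  then have "arc_index \<Gamma> V0 ` aorbit \<Gamma> a = (\<lambda>_. arc_index \<Gamma> V0 a) ` aorbit \<Gamma> a"
    by (intro image_cong refl) (rule bspec)
  also have "\<dots> = {arc_index \<Gamma> V0 a}" by (rule image_constant[OF self_in_aorbit[OF a]])
  finally have "arc_index \<Gamma> V0 ` aorbit \<Gamma> a = {arc_index \<Gamma> V0 a}" .
  then show ?thesis by (simp add: index_def)
qed

lemma index_flip: "X \<in> arcs_F \<Longrightarrow> \<tau> (fund_flip \<Gamma> X) = - \<tau> X"
  by (auto elim!: arc_F_cases simp: flip_F_aorbit index_aorbit arc_index_def)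

lemma E_arcs: "e \<in> E \<Longrightarrow> e \<in> arcs_F"
  using orientation by (auto simp: is_orientation_def)

lemma E_flip: "e \<in> E \<Longrightarrow> fund_flip \<Gamma> e \<notin> E"
  and E_or_flip: "X \<in> arcs_F \<Longrightarrow> X \<notin> E \<Longrightarrow> fund_flip \<Gamma> X \<in> E"
  using orientation by (auto simp: is_orientation_def)

lemma finite_E: "finite E"
  using finite_subset[OF _ finite_fund_arcs] E_arcs by blast

lemma inj_flip_F: "inj_on (fund_flip \<Gamma>) arcs_F"
  by (rule inj_on_inverseI) (rule flip_flip_F)

text \<open>
  The oriented edges are the representatives in \<open>E\<close> and their reversals.
\<close>

lemma sum_arcs_F:
  fixes f :: "'a set \<Rightarrow> 'c::comm_monoid_add"
  shows "(\<Sum>X | X \<in> arcs_F \<and> P X. f X)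
    = (\<Sum>e | e \<in> E \<and> P e. f e) + (\<Sum>e | e \<in> E \<and> P (fund_flip \<Gamma> e). f (fund_flip \<Gamma> e))"
proof -
  let ?A = "{e \<in> E. P e}" and ?B = "{e \<in> E. P (fund_flip \<Gamma> e)}"
  have split: "{X. X \<in> arcs_F \<and> P X} = ?A \<union> fund_flip \<Gamma> ` ?B"
  proof (intro equalityI subsetI)
    fix X assume X: "X \<in> {X. X \<in> arcs_F \<and> P X}"
    show "X \<in> ?A \<union> fund_flip \<Gamma> ` ?B"
    proof (cases "X \<in> E")
      case False
      then have "fund_flip \<Gamma> X \<in> ?B" using X E_or_flip[of X] by (simp add: flip_flip_F)
      then show ?thesis using X flip_flip_F[of X] by (metis (no_types, lifting) UnI2 image_eqI mem_Collect_eq)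
    qed (use X in auto)
  qed (use E_arcs flip_F_arcs in auto)
  have "(\<Sum>X | X \<in> arcs_F \<and> P X. f X) = sum f ?A + sum f (fund_flip \<Gamma> ` ?B)"
    unfolding split by (rule sum.union_disjoint) (use finite_E E_flip in auto)
  also have "sum f (fund_flip \<Gamma> ` ?B) = (\<Sum>e\<in>?B. f (fund_flip \<Gamma> e))"
    by (subst sum.reindex) (auto intro: inj_on_subset[OF inj_flip_F] E_arcs)
  finally show ?thesis by simp
qed

text \<open>
  Inclusion-exclusion: the unoriented edges at \<open>v\<close> are those starting or ending at \<open>v\<close>, and
  the loops, which the degree counts once more, are those doing both.
\<close>

lemma fund_degree_eq:
  "fund_degree \<Gamma> v = real (card {e \<in> E. tail_F e = v} + card {e \<in> E. head_F e = v})"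
proof -
  define pair where "pair e = {e, fund_flip \<Gamma> e}" for e
  have edges: "uedges (fund_graph \<Gamma>) (fund_flip \<Gamma>) = pair ` E"
  proof (intro equalityI subsetI)
    fix x assume "x \<in> uedges (fund_graph \<Gamma>) (fund_flip \<Gamma>)"
    then obtain X where X: "X \<in> arcs_F" "x = {X, fund_flip \<Gamma> X}" by (auto simp: uedges_def)
    show "x \<in> pair ` E"
    proof (cases "X \<in> E")
      case False
      then have "fund_flip \<Gamma> X \<in> E" "x = pair (fund_flip \<Gamma> X)"
        using X E_or_flip by (auto simp: pair_def flip_flip_F)
      then show ?thesis by blast
    qed (use X in \<open>auto simp: pair_def\<close>)
  qed (use E_arcs in \<open>auto simp: uedges_def pair_def\<close>)
  have inj: "inj_on pair E"
    by (rule inj_onI) (use E_flip in \<open>auto simp: pair_def doubleton_eq_iff\<close>)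
  have ends: "tail_F ` pair e = {tail_F e, head_F e}" if "e \<in> E" for e
    using E_arcs[OF that] by (auto simp: pair_def tail_flip_F)
  have 1: "{x \<in> pair ` E. v \<in> tail_F ` x} = pair ` ({e \<in> E. tail_F e = v} \<union> {e \<in> E. head_F e = v})"
    using ends by (auto simp del: image_insert)
  have 2: "{x \<in> pair ` E. tail_F ` x = {v}} = pair ` ({e \<in> E. tail_F e = v} \<inter> {e \<in> E. head_F e = v})"
  proof -
    have "tail_F ` pair e = {v} \<longleftrightarrow> tail_F e = v \<and> head_F e = v" if "e \<in> E" for e
      unfolding ends[OF that] by auto
    then show ?thesis by blast
  qed
  have "degree (fund_graph \<Gamma>) (fund_flip \<Gamma>) v
      = card ({e \<in> E. tail_F e = v} \<union> {e \<in> E. head_F e = v})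
        + card ({e \<in> E. tail_F e = v} \<inter> {e \<in> E. head_F e = v})"
    unfolding Defs.degree_def edges 1 2
    by (intro arg_cong2[where f = "(+)"] card_image inj_on_subset[OF inj]) auto
  also have "\<dots> = card {e \<in> E. tail_F e = v} + card {e \<in> E. head_F e = v}"
    by (rule card_Un_Int[symmetric]) (use finite_E in auto)
  finally show ?thesis by (simp add: fund_degree_def)
qed

lemma wf_T: "wf_digraph T" and T_tail: "tail T = tail (base \<Gamma>)" and T_head: "head T = head (base \<Gamma>)"
  and T_arcs: "a \<in> arcs T \<Longrightarrow> a \<in> arcs (base \<Gamma>)"
  using T_sub by (auto simp: subgraph_def compatible_def)

lemma tree_apath:
  assumes "u \<in> V0" "v \<in> V0"
  shows "\<exists>p. pre_digraph.apath T u p v"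
proof -
  interpret T: wf_digraph T by (rule wf_T)
  have "symmetric T"
    unfolding symmetric_def sym_def arcs_ends_def arc_to_ends_def
  proof (intro allI impI)
    fix x y assume "(x, y) \<in> (\<lambda>a. (tail T a, head T a)) ` arcs T"
    then obtain a where a: "a \<in> arcs T" "x = tail T a" "y = head T a" by auto
    then have "(y, x) = (tail T (flip \<Gamma> a), head T (flip \<Gamma> a))"
      using T_arcs by (simp add: T_tail T_head)
    then show "(y, x) \<in> (\<lambda>a. (tail T a, head T a)) ` arcs T" using T_flip a by blast
  qed
  then have "strongly_connected T"
    by (rule T.symmetric_connected_imp_strongly_connected[OF _ T_connected])
  then have "u \<rightarrow>\<^sup>*\<^bsub>T\<^esub> v" using assms by (simp add: strongly_connected_def)
  then show ?thesis by (simp add: T.reachable_apath)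
qed

text \<open>
  A set of edges of index zero along which one can go from \<open>x\<close> to \<open>y\<close>: every potential \<open>G\<close>
  changes along the set by at least the difference of its values at the two ends.
\<close>

definition zero_path :: "'a set set \<Rightarrow> 'v set \<Rightarrow> 'v set \<Rightarrow> bool" where
  "zero_path S x y \<longleftrightarrow> S \<subseteq> E \<and> (\<forall>e\<in>S. \<tau> e = 0) \<and>
    (\<forall>G :: 'v set \<Rightarrow> complex. cmod (G y - G x) \<le> (\<Sum>e\<in>S. cmod (G (head_F e) - G (tail_F e))))"

lemma zero_pathD:
  "zero_path S x y \<Longrightarrow> cmod (G y - G x) \<le> (\<Sum>e\<in>S. cmod (G (head_F e) - G (tail_F e)))"
  by (simp add: zero_path_def)

text \<open>
  The edges of a path in the tree project to different edges of the fundamental graph: the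
  end points of the later edges all come from later vertices of the path, which lie in orbits
  different from that of the first vertex.  They have index zero because all vertices of the tree
  have cell zero.
\<close>

lemma edges_of_tree_path:
  fixes u v :: 'v
  assumes "pre_digraph.apath T u p v"
  shows "\<exists>S. zero_path S (vorbit \<Gamma> u) (vorbit \<Gamma> v) \<and> card S \<le> length p \<and>
    (\<forall>e\<in>S. {tail_F e, head_F e} \<subseteq> vorbit \<Gamma> ` set (pre_digraph.awalk_verts T u p))"
proof -
  interpret T: wf_digraph T by (rule wf_T)
  show ?thesis
    using assms
  proof (induction p arbitrary: u)
    case Nil
    then show ?case by (auto simp: T.apath_Nil_iff zero_path_def intro!: exI[of _ "{}"])
  next
    case (Cons a p)
    define w where "w = head T a"
    have a: "a \<in> arcs T" "tail T a = u" and w: "T.apath w p v" "u \<notin> set (T.awalk_verts w p)"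
      using Cons.prems by (auto simp: T.apath_Cons_iff w_def)
    have aG: "a \<in> arcs (base \<Gamma>)" by (rule T_arcs[OF a(1)])
    have uV: "u \<in> V0" and wV: "w \<in> V0" using a T.wellformed w_def by auto
    have verts: "set (T.awalk_verts w p) \<subseteq> V0"
      using T.awalkI_apath[OF w(1)] by blast
    have w_in: "w \<in> set (T.awalk_verts w p)" using w(1) by (rule T.hd_in_awalk_verts)
    obtain S where path: "zero_path S (vorbit \<Gamma> w) (vorbit \<Gamma> v)" and card: "card S \<le> length p"
      and ends: "\<forall>e\<in>S. {tail_F e, head_F e} \<subseteq> vorbit \<Gamma> ` set (T.awalk_verts w p)"
      using Cons.IH[OF w(1)] by blast
    have S: "S \<subseteq> E" "\<forall>e\<in>S. \<tau> e = 0" using path by (simp_all add: zero_path_def)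
    have SG: "cmod (G (vorbit \<Gamma> v) - G (vorbit \<Gamma> w)) \<le> (\<Sum>e\<in>S. cmod (G (head_F e) - G (tail_F e)))"
      for G :: "'v set \<Rightarrow> complex"
      by (rule zero_pathD[OF path])
    define X where "X = aorbit \<Gamma> a"
    define e where "e = (if X \<in> E then X else fund_flip \<Gamma> X)"
    have X: "X \<in> arcs_F" "tail_F X = vorbit \<Gamma> u" "head_F X = vorbit \<Gamma> w" "\<tau> X = 0"
      using aG a(2) uV wV
      by (auto simp: X_def arcs_F_eq tail_F_aorbit head_F_aorbit index_aorbit arc_index_def w_def
          T_tail[symmetric] T_head[symmetric] cell_V0)
    have e: "e \<in> E" "\<tau> e = 0" "{tail_F e, head_F e} = {vorbit \<Gamma> u, vorbit \<Gamma> w}"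
      using X E_or_flip[OF X(1)] by (auto simp: e_def index_flip tail_flip_F head_flip_F)
    have edge: "cmod (G (vorbit \<Gamma> w) - G (vorbit \<Gamma> u)) = cmod (G (head_F e) - G (tail_F e))" for G :: "'v set \<Rightarrow> complex"
      using e(3) by (auto simp: doubleton_eq_iff norm_minus_commute)
    have u_notin: "vorbit \<Gamma> u \<notin> vorbit \<Gamma> ` set (T.awalk_verts w p)"
      using w(2) verts uV inj_vorbit unfolding inj_on_def by blast
    have new: "e \<notin> S"
    proof
      assume "e \<in> S"
      with ends have "{tail_F e, head_F e} \<subseteq> vorbit \<Gamma> ` set (T.awalk_verts w p)" by (rule bspec)
      then show False using u_notin unfolding e(3) by simp
    qed
    have finS: "finite S" by (rule finite_subset[OF S(1) finite_E])
    show ?case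
    proof (intro exI[of _ "insert e S"] conjI)
      show "zero_path (insert e S) (vorbit \<Gamma> u) (vorbit \<Gamma> v)"
        unfolding zero_path_def
      proof (intro conjI allI)
        show "insert e S \<subseteq> E" "\<forall>e\<in>insert e S. \<tau> e = 0" using S e(1,2) by auto
        fix G :: "'v set \<Rightarrow> complex"
        have "cmod (G (vorbit \<Gamma> v) - G (vorbit \<Gamma> u))
            \<le> cmod (G (vorbit \<Gamma> v) - G (vorbit \<Gamma> w)) + cmod (G (vorbit \<Gamma> w) - G (vorbit \<Gamma> u))"
          by (rule norm_diff_triangle_ineq[of _ "G (vorbit \<Gamma> w)" "G (vorbit \<Gamma> w)", simplified])
        also have "\<dots> \<le> (\<Sum>e\<in>S. cmod (G (head_F e) - G (tail_F e))) + cmod (G (head_F e) - G (tail_F e))"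
          unfolding edge by (intro add_right_mono SG)
        finally show "cmod (G (vorbit \<Gamma> v) - G (vorbit \<Gamma> u))
            \<le> (\<Sum>e\<in>insert e S. cmod (G (head_F e) - G (tail_F e)))"
          using new finS by simp
      qed
      show "card (insert e S) \<le> length (a # p)" using card new finS by simp
      show "\<forall>e\<in>insert e S. {tail_F e, head_F e} \<subseteq> vorbit \<Gamma> ` set (T.awalk_verts u (a # p))"
      proof
        fix e' assume e': "e' \<in> insert e S"
        have verts_Cons: "T.awalk_verts u (a # p) = u # T.awalk_verts w p" by (simp add: a(2) w_def)
        show "{tail_F e', head_F e'} \<subseteq> vorbit \<Gamma> ` set (T.awalk_verts u (a # p))"
        proof (cases "e' = e")
          case True
          show ?thesis unfolding True e(3) verts_Cons using w_in by simp
        next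
          case False
          then have "{tail_F e', head_F e'} \<subseteq> vorbit \<Gamma> ` set (T.awalk_verts w p)"
            using e' by (intro bspec[OF ends]) simp
          also have "\<dots> \<subseteq> vorbit \<Gamma> ` set (T.awalk_verts u (a # p))"
            unfolding verts_Cons by (intro image_mono) (simp add: subset_insertI)
          finally show ?thesis .
        qed
      qed
    qed
  qed
qed

lemma zero_path_exists:
  assumes "x \<in> verts_F" "y \<in> verts_F"
  shows "\<exists>S. zero_path S x y \<and> card S + 1 \<le> card verts_F"
proof -
  interpret T: wf_digraph T by (rule wf_T)
  obtain u v where uv: "u \<in> V0" "v \<in> V0" "x = vorbit \<Gamma> u" "y = vorbit \<Gamma> v"
    using assms vorbit_V0 by (metis imageE)
  obtain p where p: "T.apath u p v" using tree_apath uv by blast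
  have "distinct (T.awalk_verts u p)" "set (T.awalk_verts u p) \<subseteq> V0"
    using p by (auto simp: T.apath_def)
  then have "length (T.awalk_verts u p) \<le> card V0"
    by (metis card_mono distinct_card finite_V0)
  then have len: "length p + 1 \<le> card verts_F" by (simp add: T.length_awalk_verts card_V0)
  obtain S where "zero_path S x y" "card S \<le> length p"
    using edges_of_tree_path[OF p] uv by blast
  then show ?thesis using len by (intro exI[of _ S]) simp
qed

text \<open>
  Functions that agree along all edges are constant by following paths in the tree.  A vertex
  without edges would have an indicator function of this kind, so all degrees are positive as soon as
  there is an edge somewhere.
\<close>

lemma weighted_graph_F:
  assumes "E \<noteq> {}"
  shows "weighted_graph verts_F E tail_F head_F (fund_degree \<Gamma>)"
proof
  show conn: "G u = G v" if const: "\<forall>e\<in>E. G (tail_F e) = G (head_F e)" and uv: "u \<in> verts_F" "v \<in> verts_F"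
    for G :: "'v set \<Rightarrow> complex" and u v
  proof -
    obtain S where S: "zero_path S u v" using zero_path_exists[OF uv] by blast
    then have "S \<subseteq> E" by (simp add: zero_path_def)
    from S have "cmod (G v - G u) \<le> (\<Sum>e\<in>S. cmod (G (head_F e) - G (tail_F e)))"
      by (rule zero_pathD)
    also have "(\<Sum>e\<in>S. cmod (G (head_F e) - G (tail_F e))) = 0"
      using \<open>S \<subseteq> E\<close> const by (intro sum.neutral) (auto simp: subset_iff)
    finally show ?thesis by simp
  qed
  show "fund_degree \<Gamma> v > 0" if v: "v \<in> verts_F" for v
  proof (rule ccontr)
    assume "\<not> fund_degree \<Gamma> v > 0"
    then have "card {e \<in> E. tail_F e = v} = 0" "card {e \<in> E. head_F e = v} = 0"
      unfolding fund_degree_eq by simp_all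
    then have "{e \<in> E. tail_F e = v} = {}" "{e \<in> E. head_F e = v} = {}"
      using finite_E by simp_all
    then have no: "tail_F e \<noteq> v" "head_F e \<noteq> v" if "e \<in> E" for e
      using that by blast+
    obtain e where e: "e \<in> E" using assms by blast
    have "(if v = v then 1 else 0) = (if tail_F e = v then 1 else (0::complex))"
      by (rule conn[of "\<lambda>u. if u = v then 1 else 0"]) (use no v e E_arcs tail_F_verts in auto)
    then show False using no e by simp
  qed
qed (use finite_fund_verts verts_F_ne finite_E E_arcs tail_F_verts head_F_verts fund_degree_eq in auto)

end


section \<open>Gram matrices of integer vectors\<close>

text \<open>
  The matrix \<open>\<T>\<^sup>*\<T>\<close> for the matrix \<open>\<T>\<close> with rows \<open>r i\<close>, \<open>i \<in> I\<close>.
\<close>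

abbreviation gram :: "'i set \<Rightarrow> ('i \<Rightarrow> int^'d) \<Rightarrow> 'd \<Rightarrow> 'd \<Rightarrow> complex" where
  "gram I r \<equiv> mat_mul I (mat_adj (rows_mat r)) (rows_mat r)"

lemma mat_vec_gram:
  "mat_vec J (mat_mul I (mat_adj M) M) x j = (\<Sum>i\<in>I. cnj (M i j) * mat_vec J M x i)"
proof -
  have "mat_vec J (mat_mul I (mat_adj M) M) x j = (\<Sum>k\<in>J. \<Sum>i\<in>I. cnj (M i j) * (M i k * x k))"
    by (simp add: mat_vec_def mat_mul_def mat_adj_def sum_distrib_right mult.assoc)
  also have "\<dots> = (\<Sum>i\<in>I. \<Sum>k\<in>J. cnj (M i j) * (M i k * x k))" by (rule sum.swap)
  finally show ?thesis by (simp add: mat_vec_def sum_distrib_left)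
qed

lemma gram_form:
  "cvec_inner J (mat_vec J (mat_mul I (mat_adj M) M) x) y = cvec_inner I (mat_vec J M x) (mat_vec J M y)"
proof -
  have "cvec_inner J (mat_vec J (mat_mul I (mat_adj M) M) x) y
      = (\<Sum>j\<in>J. \<Sum>i\<in>I. mat_vec J M x i * cnj (M i j * y j))"
    by (simp add: cvec_inner_def mat_vec_gram sum_distrib_left mult_ac)
  also have "\<dots> = (\<Sum>i\<in>I. \<Sum>j\<in>J. mat_vec J M x i * cnj (M i j * y j))" by (rule sum.swap)
  also have "\<dots> = cvec_inner I (mat_vec J M x) (mat_vec J M y)"
    by (simp add: cvec_inner_def mat_vec_def[of J M y] cnj_sum sum_distrib_left)
  finally show ?thesis .
qed

lemma herm_gram: "herm_on J (mat_mul I (mat_adj M) M)"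
  unfolding herm_on_def mat_mul_def mat_adj_def by (simp add: mult.commute)

lemma in_cvecs_UNIV: "x \<in> cvecs UNIV"
  by (simp add: cvecs_def)

lemma rows_mat_real_imag:
  "Re (mat_vec UNIV (rows_mat r) x e) = int_vec (r e) \<bullet> (\<chi> j. Re (x j))"
  "Im (mat_vec UNIV (rows_mat r) x e) = int_vec (r e) \<bullet> (\<chi> j. Im (x j))"
  by (simp_all add: mat_vec_def rows_mat_def inner_vec_def int_vec_def Re_sum Im_sum)

lemma cvec_norm_rows_mat:
  "(cvec_norm I (mat_vec UNIV (rows_mat r) x))\<^sup>2
    = (\<Sum>e\<in>I. (int_vec (r e) \<bullet> (\<chi> j. Re (x j)))\<^sup>2) + (\<Sum>e\<in>I. (int_vec (r e) \<bullet> (\<chi> j. Im (x j)))\<^sup>2)"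
  by (simp add: cvec_norm_sq cmod_power2 rows_mat_real_imag sum.distrib)

lemma cvec_norm_real_imag:
  "(cvec_norm UNIV x)\<^sup>2 = (norm (\<chi> j. Re (x j)))\<^sup>2 + (norm (\<chi> j. Im (x j)))\<^sup>2"
  by (simp add: cvec_norm_sq cmod_power2 norm_vec_def L2_set_def sum_nonneg sum.distrib)

lemma quadratic_form_le_largest_gram:
  fixes \<omega> :: "real^'d"
  shows "(\<Sum>e\<in>I. (int_vec (r e) \<bullet> \<omega>)\<^sup>2) \<le> largest_eigenvalue UNIV (gram I r) * (norm \<omega>)\<^sup>2"
  using largest_eigenvalue_variational(2)[OF finite UNIV_not_empty herm_gram[of UNIV I "rows_mat r"] in_cvecs_UNIV,
      of "\<lambda>j. of_real (\<omega> $ j)"]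
  by (simp add: gram_form cvec_inner_self cvec_norm_rows_mat cvec_norm_real_imag power2_eq_square[of 0] inner_vec_def
      zero_vec_def[symmetric] del: of_real_power)

lemma smallest_gram_le_quadratic_form:
  fixes \<omega> :: "real^'d"
  shows "smallest_eigenvalue UNIV (gram I r) * (norm \<omega>)\<^sup>2 \<le> (\<Sum>e\<in>I. (int_vec (r e) \<bullet> \<omega>)\<^sup>2)"
  using smallest_eigenvalue_variational(2)[OF finite UNIV_not_empty herm_gram[of UNIV I "rows_mat r"] in_cvecs_UNIV,
      of "\<lambda>j. of_real (\<omega> $ j)"]
  by (simp add: gram_form cvec_inner_self cvec_norm_rows_mat cvec_norm_real_imag power2_eq_square[of 0] inner_vec_def
      zero_vec_def[symmetric] del: of_real_power)

text \<open>
  The matrix is real, so the form splits over the real and the imaginary part of a complex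
  eigenvector, and at least one of the two parts has a Rayleigh quotient not above the eigenvalue.
\<close>

lemma smallest_gram_attained:
  fixes r :: "'i \<Rightarrow> int^'d"
  obtains u :: "real^'d" where "norm u = 1"
    "(\<Sum>e\<in>I. (int_vec (r e) \<bullet> u)\<^sup>2) \<le> smallest_eigenvalue UNIV (gram I r)"
proof -
  let ?l = "smallest_eigenvalue UNIV (gram I r)"
  define q where "q u = (\<Sum>e\<in>I. (int_vec (r e) \<bullet> u)\<^sup>2)" for u :: "real^'d"
  obtain x where x: "x \<noteq> (\<lambda>_. 0)" "\<forall>j. mat_vec UNIV (gram I r) x j = of_real ?l * x j"
    using smallest_eigenvalue_variational(1)[OF finite UNIV_not_empty herm_gram[of UNIV I "rows_mat r"]]
    unfolding is_eigenvalue_def by auto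
  define p where "p = (\<chi> j. Re (x j))"
  define p' where "p' = (\<chi> j. Im (x j))"
  have "cvec_inner UNIV (mat_vec UNIV (gram I r) x) x = of_real ?l * cvec_inner UNIV x x"
    using x(2) by (simp add: cvec_inner_def sum_distrib_left mult.assoc)
  then have "(cvec_norm I (mat_vec UNIV (rows_mat r) x))\<^sup>2 = ?l * (cvec_norm UNIV x)\<^sup>2"
    unfolding gram_form cvec_inner_self by (metis of_real_eq_iff of_real_mult)
  then have eq: "q p + q p' = ?l * (norm p)\<^sup>2 + ?l * (norm p')\<^sup>2"
    unfolding cvec_norm_rows_mat cvec_norm_real_imag by (simp add: q_def p_def p'_def distrib_left)
  have "p \<noteq> 0 \<or> p' \<noteq> 0"
    using x(1) by (auto simp: p_def p'_def vec_eq_iff fun_eq_iff complex_eq_iff)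
  moreover have "q 0 = 0" by (simp add: q_def)
  ultimately have "\<exists>w. w \<noteq> 0 \<and> q w \<le> ?l * (norm w)\<^sup>2"
    using eq by (cases "p = 0"; cases "p' = 0"; cases "q p \<le> ?l * (norm p)\<^sup>2") auto
  then obtain w where w: "w \<noteq> 0" "q w \<le> ?l * (norm w)\<^sup>2" by blast
  have "q ((1 / norm w) *\<^sub>R w) = q w / (norm w)\<^sup>2"
    by (simp add: q_def power_divide sum_divide_distrib)
  also have "\<dots> \<le> ?l" using w by (simp add: pos_divide_le_eq)
  finally show ?thesis using that[of "(1 / norm w) *\<^sub>R w"] w(1) by (simp add: q_def)
qed

text \<open>
  Schur's test: the matrix \<open>\<T> \<T>\<^sup>*\<close> of the scalar products of the rows has the same nonzero
  eigenvalues, with eigenvector \<open>y = \<T> x\<close>; its row where \<open>y\<close> is largest bounds the eigenvalue by the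
  sum of the absolute values in that row.
\<close>

lemma largest_gram_le:
  fixes r :: "'i \<Rightarrow> int^'d"
  assumes fin: "finite I" and ne: "I \<noteq> {}"
  shows "largest_eigenvalue UNIV (gram I r) \<le> (MAX e0\<in>I. abs_vec (r e0) \<bullet> (\<Sum>e\<in>I. abs_vec (r e)))"
    (is "?l \<le> ?M")
proof -
  define row_sum where "row_sum e0 = abs_vec (r e0) \<bullet> (\<Sum>e\<in>I. abs_vec (r e))" for e0
  have M: "row_sum e \<le> ?M" if "e \<in> I" for e
    unfolding row_sum_def[symmetric] using that fin by (intro Max_ge) auto
  have nonneg: "row_sum e \<ge> 0" for e
    by (simp add: row_sum_def inner_vec_def abs_vec_def sum_nonneg)
  obtain x where x: "x \<noteq> (\<lambda>_. 0)" "\<And>j. mat_vec UNIV (gram I r) x j = of_real ?l * x j"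
    using largest_eigenvalue_variational(1)[OF finite UNIV_not_empty herm_gram[of UNIV I "rows_mat r"]]
    unfolding is_eigenvalue_def by auto
  define y where "y = mat_vec UNIV (rows_mat r) x"
  have xy: "of_real ?l * x j = (\<Sum>e\<in>I. of_int (r e $ j) * y e)" for j
    using x(2)[of j] unfolding mat_vec_gram y_def by (simp add: rows_mat_def)
  show ?thesis
  proof (cases "?l > 0")
    case False
    obtain e where "e \<in> I" using ne by blast
    then show ?thesis using False M[of e] nonneg[of e] by simp
  next
    case True
    obtain e0 where e0: "e0 \<in> I" "\<And>e. e \<in> I \<Longrightarrow> cmod (y e) \<le> cmod (y e0)"
    proof -
      have "Max ((\<lambda>e. cmod (y e)) ` I) \<in> (\<lambda>e. cmod (y e)) ` I"
        using fin ne by (intro Max_in) auto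
      then obtain e0 where "e0 \<in> I" "cmod (y e0) = Max ((\<lambda>e. cmod (y e)) ` I)" by auto
      then show ?thesis using that[of e0] fin by simp
    qed
    have "y e0 \<noteq> 0"
    proof
      assume "y e0 = 0"
      then have "y e = 0" if "e \<in> I" for e using e0(2)[OF that] by simp
      then have "of_real ?l * x j = 0" for j unfolding xy by simp
      then show False using True x(1) by (auto simp: fun_eq_iff)
    qed
    have "of_real ?l * y e0 = (\<Sum>j\<in>UNIV. of_int (r e0 $ j) * (of_real ?l * x j))"
      by (simp add: y_def mat_vec_def rows_mat_def sum_distrib_left sum_distrib_right mult_ac)
    also have "\<dots> = (\<Sum>j\<in>UNIV. \<Sum>e\<in>I. of_int (r e0 $ j) * (of_int (r e $ j) * y e))"
      unfolding xy by (simp add: sum_distrib_left)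
    also have "cmod \<dots> \<le> (\<Sum>j\<in>UNIV. \<Sum>e\<in>I. \<bar>real_of_int (r e0 $ j)\<bar> * (\<bar>real_of_int (r e $ j)\<bar> * cmod (y e0)))"
      by (intro sum_norm_le) (auto simp: norm_mult intro!: sum_norm_le mult_left_mono e0)
    also have "\<dots> = row_sum e0 * cmod (y e0)"
      by (simp add: row_sum_def inner_vec_def abs_vec_def sum_distrib_left sum_distrib_right mult.assoc)
    finally have "?l * cmod (y e0) \<le> row_sum e0 * cmod (y e0)" using True by (simp add: norm_mult)
    then have "?l \<le> row_sum e0" using \<open>y e0 \<noteq> 0\<close> by simp
    then show ?thesis using M[OF e0(1)] by simp
  qed
qed

text \<open>
  The determinant of independent integer vectors is a nonzero integer, so it is at least \<open>1\<close>
  in absolute value.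
\<close>

theorem smallest_gram_lower_bound:
  fixes t :: "'d::finite \<Rightarrow> int^'d"
  assumes card: "CARD('d) \<ge> 2" and inj: "inj (\<lambda>j. int_vec (t j))"
    and indep: "independent (range (\<lambda>j. int_vec (t j)))"
  shows "((real CARD('d) - 1) / (\<Sum>j\<in>UNIV. (norm (int_vec (t j)))\<^sup>2)) ^ (CARD('d) - 1)
      \<le> smallest_eigenvalue UNIV (gram UNIV t)" (is "?L \<le> ?l")
    and "0 < smallest_eigenvalue UNIV (gram UNIV t)"
proof -
  define A :: "real^'d^'d" where "A = (\<chi> j. int_vec (t j))"
  have row: "A $ j = int_vec (t j)" for j by (simp add: A_def)
  have Au: "(norm (A *v u))\<^sup>2 = (\<Sum>j\<in>UNIV. (int_vec (t j) \<bullet> u)\<^sup>2)" for u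
    by (simp add: norm_vec_def L2_set_def sum_nonneg matrix_vector_mul_component row)
  have "det A = of_int (det (\<chi> j. t j))"
    by (simp add: det_def A_def int_vec_def)
  moreover have span: "span (range (\<lambda>j. int_vec (t j))) = UNIV"
    using card_eq_dim[of "range (\<lambda>j. int_vec (t j))" UNIV] indep card_image[OF inj] 
    by (auto simp: dim_UNIV)
  have ker: "u = 0" if "A *v u = 0" for u
  proof -
    have "int_vec (t j) \<bullet> u = 0" for j
      using that by (metis matrix_vector_mul_component row zero_index)
    then have "orthogonal u v" if "v \<in> range (\<lambda>j. int_vec (t j))" for v
      using that by (auto simp: orthogonal_def inner_commute)
    then have "orthogonal u u"
      using orthogonal_to_span[of u "range (\<lambda>j. int_vec (t j))" u] span by auto
    then show ?thesis by (simp add: orthogonal_self)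
  qed
  then have "det A \<noteq> 0"
    using matrix_left_invertible_ker[of A] by (simp add: invertible_left_inverse flip: invertible_det_nz)
  ultimately have det: "\<bar>det A\<bar> \<ge> 1"
    by (metis of_int_0_eq_iff of_int_abs of_int_1_le_iff zero_less_abs_iff int_one_le_iff_zero_less)
  obtain u :: "real^'d" where u: "norm u = 1" "(\<Sum>j\<in>UNIV. (int_vec (t j) \<bullet> u)\<^sup>2) \<le> ?l"
    using smallest_gram_attained[where r = t and I = UNIV] by blast
  have "?L \<le> (norm (A *v u))\<^sup>2"
    using short_vector_lower_bound[OF det u(1) card] by (simp add: row)
  then show "?L \<le> ?l" using u(2) Au by simp
  have "A *v u \<noteq> 0" using ker u(1) by (metis norm_zero zero_neq_one)
  then have "0 < (norm (A *v u))\<^sup>2" by simp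
  then show "0 < ?l" using u(2) unfolding Au by linarith
qed


section \<open>The effective form of a periodic graph\<close>

lemma orth_proj_kernel_eqI:
  assumes fin: "finite J" and w: "w \<in> mat_kernel I J M"
    and orth: "\<And>y. y \<in> mat_kernel I J M \<Longrightarrow> cvec_inner J (\<lambda>i. x i - w i) y = 0"
  shows "orth_proj J (mat_kernel I J M) x = w"
  unfolding orth_proj_def
proof (rule the_equality)
  show "w \<in> mat_kernel I J M \<and> (\<forall>y\<in>mat_kernel I J M. cvec_inner J (\<lambda>i. x i - w i) y = 0)"
    using w orth by blast
  fix w' assume w': "w' \<in> mat_kernel I J M \<and> (\<forall>y\<in>mat_kernel I J M. cvec_inner J (\<lambda>i. x i - w' i) y = 0)"
  define d where "d = (\<lambda>i. w i - w' i)"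
  have d: "d \<in> mat_kernel I J M"
    using w w' by (auto simp: d_def mat_kernel_def cvecs_def mat_vec_def right_diff_distrib sum_subtractf)
  have "cvec_inner J d d = cvec_inner J (\<lambda>i. x i - w' i) d - cvec_inner J (\<lambda>i. x i - w i) d"
    by (simp add: d_def cvec_inner_def sum_subtractf[symmetric] algebra_simps)
  also have "\<dots> = 0" using w' orth d by simp
  finally have "cvec_norm J d = 0" by (simp add: cvec_inner_self)
  then have "d = (\<lambda>_. 0)" using cvec_norm_eq_0[OF fin] d by (simp add: mat_kernel_def)
  then show "w' = w" by (auto simp: d_def fun_eq_iff)
qed

text \<open>
  This makes the coefficient in the definition of \<^const>\<open>effective_form\<close> unique.
\<close>

lemma quadratic_not_cubic:
  assumes "(\<lambda>\<epsilon>. \<epsilon>\<^sup>2 * a) \<in> O[at_right 0](\<lambda>\<epsilon>::real. \<epsilon> ^ 3)"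
  shows "a = 0"
proof -
  obtain C where C: "\<forall>\<^sub>F \<epsilon> in at_right 0. norm (\<epsilon>\<^sup>2 * a) \<le> C * norm (\<epsilon> ^ 3)"
    using assms by (elim landau_o.bigE)
  have pos: "\<forall>\<^sub>F \<epsilon> in at_right 0. \<epsilon> > (0::real)" by (rule eventually_at_right_less)
  have ev: "\<forall>\<^sub>F \<epsilon> in at_right 0. \<bar>a\<bar> \<le> C * \<epsilon>"
    using C pos
  proof eventually_elim
    case (elim \<epsilon>)
    then have "\<epsilon>\<^sup>2 * \<bar>a\<bar> \<le> \<epsilon>\<^sup>2 * (C * \<epsilon>)"
      by (simp add: abs_mult power2_eq_square power3_eq_cube mult_ac)
    then show ?case by (rule mult_left_le_imp_le) (use elim in simp)
  qed
  have "((\<lambda>\<epsilon>. C * \<epsilon>) \<longlongrightarrow> C * 0) (at_right 0)"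
    by (intro tendsto_intros)
  then have "\<bar>a\<bar> \<le> C * 0" by (rule tendsto_lowerbound[OF _ ev]) simp
  then show ?thesis by simp
qed

lemma effective_form_eqI:
  assumes "(\<lambda>\<epsilon>. band1 \<Gamma> V0 (\<epsilon> *\<^sub>R \<omega>) - \<epsilon>\<^sup>2 * c) \<in> O[at_right 0](\<lambda>\<epsilon>. \<epsilon> ^ 3)"
  shows "effective_form \<Gamma> V0 \<omega> = c"
  unfolding effective_form_def
proof (rule the_equality)
  fix c' assume "(\<lambda>\<epsilon>. band1 \<Gamma> V0 (\<epsilon> *\<^sub>R \<omega>) - \<epsilon>\<^sup>2 * c') \<in> O[at_right 0](\<lambda>\<epsilon>. \<epsilon> ^ 3)"
  from sum_in_bigo(2)[OF assms this]
  have "(\<lambda>\<epsilon>. \<epsilon>\<^sup>2 * (c' - c)) \<in> O[at_right 0](\<lambda>\<epsilon>. \<epsilon> ^ 3)"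
    by (simp add: algebra_simps)
  then show "c' = c" using quadratic_not_cubic by fastforce
qed (fact assms)

context periodic_tree
begin

context
  fixes \<omega> :: "real^'d"
  assumes E_ne: "E \<noteq> {}"
begin

interpretation W: weighted_graph verts_F E tail_F head_F "fund_degree \<Gamma>" "\<lambda>e. int_vec (\<tau> e) \<bullet> \<omega>"
  by (rule weighted_graph_F[OF E_ne])

text \<open>
  Reversing an edge changes the sign of its index and so conjugates its phase.
\<close>

lemma floquet_eq_fiber: "floquet \<Gamma> V0 (\<epsilon> *\<^sub>R \<omega>) = W.fiber \<epsilon>"
proof (intro ext)
  fix u v
  have phase: "exp (\<i> * of_real (int_vec (\<tau> e) \<bullet> (\<epsilon> *\<^sub>R \<omega>))) = W.phase \<epsilon> e" for e
    by (simp add: W.phase_def)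
  have neg: "W.phase \<epsilon> (fund_flip \<Gamma> e) = cnj (W.phase \<epsilon> e)" if "e \<in> E" for e
  proof -
    have "int_vec (- \<tau> e) \<bullet> \<omega> = - (int_vec (\<tau> e) \<bullet> \<omega>)"
      by (simp add: int_vec_def inner_vec_def sum_negf)
    then show ?thesis
      using E_arcs[OF that] by (simp add: W.phase_def index_flip exp_cnj)
  qed
  have "(\<Sum>e | e \<in> arcs_F \<and> tail_F e = u \<and> head_F e = v. W.phase \<epsilon> e)
    = (\<Sum>e | e \<in> E \<and> tail_F e = u \<and> head_F e = v. W.phase \<epsilon> e)
      + (\<Sum>e | e \<in> E \<and> tail_F (fund_flip \<Gamma> e) = u \<and> head_F (fund_flip \<Gamma> e) = v. W.phase \<epsilon> (fund_flip \<Gamma> e))"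
    by (rule sum_arcs_F)
  also have "(\<Sum>e | e \<in> E \<and> tail_F (fund_flip \<Gamma> e) = u \<and> head_F (fund_flip \<Gamma> e) = v. W.phase \<epsilon> (fund_flip \<Gamma> e))
      = (\<Sum>e | e \<in> E \<and> head_F e = u \<and> tail_F e = v. cnj (W.phase \<epsilon> e))"
    by (intro sum.cong) (use E_arcs in \<open>auto simp: tail_flip_F head_flip_F neg\<close>)
  finally show "floquet \<Gamma> V0 (\<epsilon> *\<^sub>R \<omega>) u v = W.fiber \<epsilon> u v"
    unfolding floquet_def W.fiber_def phase by simp
qed

lemma twist_0_eq_incidence:
  assumes "e \<in> E"
  shows "W.twist 0 x e = (\<Sum>v\<in>verts_F. incidence \<Gamma> e v * x v)"
proof -
  have "incidence \<Gamma> e v * x v = (if head_F e = v then x v / of_real (sqrt (fund_degree \<Gamma> v)) else 0)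
      - (if tail_F e = v then x v / of_real (sqrt (fund_degree \<Gamma> v)) else 0)" for v
    by (auto simp: incidence_def)
  then have "(\<Sum>v\<in>verts_F. incidence \<Gamma> e v * x v)
    = (\<Sum>v\<in>verts_F. if head_F e = v then x v / of_real (sqrt (fund_degree \<Gamma> v)) else 0)
      - (\<Sum>v\<in>verts_F. if tail_F e = v then x v / of_real (sqrt (fund_degree \<Gamma> v)) else 0)"
    by (simp add: sum_subtractf)
  also have "\<dots> = W.twist 0 x e"
    using W.s_V[OF assms] W.t_V[OF assms] finite_fund_verts by (simp add: W.twist_def)
  finally show ?thesis by simp
qed

text \<open>
  Being orthogonal to all gradients means lying in the kernel of \<open>\<partial>\<^sup>*\<close>.
\<close>

lemma inner_twist_0:
  "cvec_inner E y (W.twist 0 x) = (\<Sum>v\<in>verts_F. cnj (x v) * mat_vec E (mat_adj (incidence \<Gamma>)) y v)"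
proof -
  have "cvec_inner E y (W.twist 0 x) = (\<Sum>e\<in>E. \<Sum>v\<in>verts_F. cnj (x v) * (cnj (incidence \<Gamma> e v) * y e))"
    unfolding cvec_inner_def
    by (intro sum.cong refl) (simp add: twist_0_eq_incidence cnj_sum sum_distrib_left mult_ac)
  also have "\<dots> = (\<Sum>v\<in>verts_F. \<Sum>e\<in>E. cnj (x v) * (cnj (incidence \<Gamma> e v) * y e))" by (rule sum.swap)
  finally show ?thesis by (simp add: mat_vec_def mat_adj_def sum_distrib_left)
qed

text \<open>
  The cycle in the class of \<open>h\<close> modulo gradients is the orthogonal projection of \<open>h\<close> onto the
  kernel of \<open>\<partial>\<^sup>*\<close>, since gradients are orthogonal to this kernel.
\<close>

lemma Pstar_decomposition:
  obtains g where "cvec_inner verts_F g W.ground = 0"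
    "\<And>e. e \<in> E \<Longrightarrow> Pstar \<Gamma> E (hvec \<Gamma> V0 E \<omega>) e = hvec \<Gamma> V0 E \<omega> e + W.twist 0 g e"
    "\<And>w. cvec_inner E (Pstar \<Gamma> E (hvec \<Gamma> V0 E \<omega>)) (W.twist 0 w) = 0"
proof -
  let ?h = "hvec \<Gamma> V0 E \<omega>"
  obtain g y' where g: "cvec_inner verts_F g W.ground = 0" "\<forall>e\<in>E. y' e = ?h e + W.twist 0 g e"
    "\<forall>w. cvec_inner E y' (W.twist 0 w) = 0"
    using W.exists_harmonic_representative[of ?h] by blast
  define y where "y = (\<lambda>e. if e \<in> E then y' e else 0)"
  have orth: "cvec_inner E y (W.twist 0 w) = 0" for w
    using g(3) cvec_inner_cong[of E y y' "W.twist 0 w" "W.twist 0 w"] by (simp add: y_def)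
  have y: "y e = ?h e + W.twist 0 g e" if "e \<in> E" for e using g(2) that by (simp add: y_def)
  have "mat_vec E (mat_adj (incidence \<Gamma>)) y v = 0" if "v \<in> verts_F" for v
  proof -
    have "0 = (\<Sum>u\<in>verts_F. cnj (if u = v then 1 else 0) * mat_vec E (mat_adj (incidence \<Gamma>)) y u)"
      using orth[of "\<lambda>u. if u = v then 1 else 0"] unfolding inner_twist_0 by simp
    also have "\<dots> = (\<Sum>u\<in>verts_F. if u = v then mat_vec E (mat_adj (incidence \<Gamma>)) y u else 0)"
      by (intro sum.cong) auto
    also have "\<dots> = mat_vec E (mat_adj (incidence \<Gamma>)) y v"
      using that finite_fund_verts by simp
    finally show ?thesis by simp
  qed
  then have ker: "y \<in> mat_kernel verts_F E (mat_adj (incidence \<Gamma>))"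
    by (simp add: mat_kernel_def cvecs_def y_def)
  have "Pstar \<Gamma> E ?h = y"
    unfolding Pstar_def
  proof (rule orth_proj_kernel_eqI[OF finite_E ker])
    fix z assume z: "z \<in> mat_kernel verts_F E (mat_adj (incidence \<Gamma>))"
    have "cvec_inner E z (W.twist 0 g) = 0"
      unfolding inner_twist_0 using z by (simp add: mat_kernel_def)
    then have "cvec_inner E (W.twist 0 g) z = 0" by (metis cvec_inner_commute complex_cnj_zero)
    moreover have "cvec_inner E (\<lambda>e. ?h e - y e) z = - cvec_inner E (W.twist 0 g) z"
      unfolding cvec_inner_def sum_negf[symmetric] by (intro sum.cong refl) (simp add: y)
    ultimately show "cvec_inner E (\<lambda>e. ?h e - y e) z = 0" by simp
  qed
  then show ?thesis using that g(1) y orth by simp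
qed

lemma hvec_norm:
  "(cvec_norm E (hvec \<Gamma> V0 E \<omega>))\<^sup>2
    = 1 / total_degree \<Gamma> * (\<Sum>e\<in>bridges \<Gamma> V0 E. (int_vec (\<tau> e) \<bullet> \<omega>)\<^sup>2)"
proof -
  have pos: "total_degree \<Gamma> > 0" using W.sum_k_pos by (simp add: total_degree_def)
  have "(cvec_norm E (hvec \<Gamma> V0 E \<omega>))\<^sup>2 = (\<Sum>e\<in>E. (int_vec (\<tau> e) \<bullet> \<omega>)\<^sup>2 / total_degree \<Gamma>)"
    unfolding cvec_norm_sq using pos
    by (intro sum.cong refl) (simp add: hvec_def norm_mult norm_divide power_mult_distrib power_divide)
  also have "\<dots> = (\<Sum>e\<in>bridges \<Gamma> V0 E. (int_vec (\<tau> e) \<bullet> \<omega>)\<^sup>2 / total_degree \<Gamma>)"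
    by (rule sum.mono_neutral_right) (use finite_E in \<open>auto simp: bridges_def int_vec_def inner_vec_def\<close>)
  finally show ?thesis by (simp add: sum_divide_distrib)
qed

lemma total_degree_pos: "total_degree \<Gamma> > 0"
  using W.sum_k_pos by (simp add: total_degree_def)

text \<open>
  The upper bound is Pythagoras for the decomposition of \<open>h\<close> into a cycle and a gradient.  The
  lower bound comes from the cycle that a bridge closes with a path in the tree.
\<close>

theorem effective_form_properties:
  defines "f \<equiv> \<lambda>\<epsilon>. band1 \<Gamma> V0 (\<epsilon> *\<^sub>R \<omega>)" and "\<mu> \<equiv> effective_form \<Gamma> V0 \<omega>"
  shows "\<mu> = (cvec_norm E (Pstar \<Gamma> E (hvec \<Gamma> V0 E \<omega>)))\<^sup>2"
    and "(\<lambda>\<epsilon>. f \<epsilon> - \<epsilon>\<^sup>2 * \<mu>) \<in> O[at_right 0](\<lambda>\<epsilon>. \<epsilon> ^ 3)"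
    and "\<forall>\<^sub>F \<epsilon> in nhds 0. f differentiable (at \<epsilon>)"
    and "deriv f differentiable (at 0)"
    and "deriv (deriv f) 0 = 2 * \<mu>"
    and "\<mu> \<le> (cvec_norm E (hvec \<Gamma> V0 E \<omega>))\<^sup>2"
    and "e0 \<in> bridges \<Gamma> V0 E \<Longrightarrow>
      (int_vec (\<tau> e0) \<bullet> \<omega>)\<^sup>2 / (total_degree \<Gamma> * real (card verts_F)) \<le> \<mu>"
proof -
  let ?h = "hvec \<Gamma> V0 E \<omega>"
  define y where "y = Pstar \<Gamma> E ?h"
  obtain g where g: "cvec_inner verts_F g W.ground = 0"
    and y: "\<And>e. e \<in> E \<Longrightarrow> y e = ?h e + W.twist 0 g e"
    and orth: "\<And>w. cvec_inner E y (W.twist 0 w) = 0"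
    using Pstar_decomposition unfolding y_def by blast
  have y': "y e = \<i> * of_real (int_vec (\<tau> e) \<bullet> \<omega>) / of_real (sqrt (sum (fund_degree \<Gamma>) verts_F)) + W.twist 0 g e"
    if "e \<in> E" for e
    using y[OF that] that by (simp add: hvec_def total_degree_def)
  have f: "f = W.lam"
    by (simp add: f_def band1_def floquet_eq_fiber W.lam_def fun_eq_iff)
  note near = W.lam_near_0[OF g y' orth]
  show \<mu>: "\<mu> = (cvec_norm E y)\<^sup>2"
    unfolding \<mu>_def by (rule effective_form_eqI) (use near(1) in \<open>simp add: f[symmetric] f_def\<close>)
  show "(\<lambda>\<epsilon>. f \<epsilon> - \<epsilon>\<^sup>2 * \<mu>) \<in> O[at_right 0](\<lambda>\<epsilon>. \<epsilon> ^ 3)"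
    "\<forall>\<^sub>F \<epsilon> in nhds 0. f differentiable (at \<epsilon>)" "deriv f differentiable (at 0)"
    "deriv (deriv f) 0 = 2 * \<mu>"
    using near by (simp_all add: f \<mu>)
  have "cvec_inner E ?h ?h = cvec_inner E (\<lambda>e. y e - W.twist 0 g e) (\<lambda>e. y e - W.twist 0 g e)"
    by (rule cvec_inner_cong) (simp_all add: y)
  also have "\<dots> = cvec_inner E y y - cvec_inner E y (W.twist 0 g) - cvec_inner E (W.twist 0 g) y
      + cvec_inner E (W.twist 0 g) (W.twist 0 g)"
    by (simp add: cvec_inner_def sum_subtractf[symmetric] sum.distrib[symmetric] algebra_simps)
  also have "cvec_inner E (W.twist 0 g) y = 0" using orth[of g] by (metis cvec_inner_commute complex_cnj_zero)
  finally have "complex_of_real ((cvec_norm E ?h)\<^sup>2) = of_real ((cvec_norm E y)\<^sup>2 + (cvec_norm E (W.twist 0 g))\<^sup>2)"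
    using orth[of g] by (simp add: cvec_inner_self)
  then have "(cvec_norm E ?h)\<^sup>2 = (cvec_norm E y)\<^sup>2 + (cvec_norm E (W.twist 0 g))\<^sup>2"
    by (simp only: of_real_eq_iff)
  then show "\<mu> \<le> (cvec_norm E ?h)\<^sup>2" by (simp add: \<mu>)
  assume "e0 \<in> bridges \<Gamma> V0 E"
  then have e0: "e0 \<in> E" "\<tau> e0 \<noteq> 0" by (auto simp: bridges_def)
  obtain S where path: "zero_path S (tail_F e0) (head_F e0)" and card: "card S + 1 \<le> card verts_F"
    using zero_path_exists[OF W.s_V[OF e0(1)] W.t_V[OF e0(1)]] by blast
  show "(int_vec (\<tau> e0) \<bullet> \<omega>)\<^sup>2 / (total_degree \<Gamma> * real (card verts_F)) \<le> \<mu>"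
    unfolding \<mu> total_degree_def
  proof (rule W.harmonic_lower_bound[OF y' e0(1) _ _ card])
    have zero: "\<forall>e\<in>S. \<tau> e = 0" and "S \<subseteq> E" using path by (simp_all add: zero_path_def)
    then show "e0 \<notin> S" "S \<subseteq> E" "\<forall>e\<in>S. int_vec (\<tau> e) \<bullet> \<omega> = 0"
      using bspec[OF zero, of e0] e0(2) by (auto simp: int_vec_def inner_vec_def)
    show "cmod (G (head_F e0) - G (tail_F e0)) \<le> (\<Sum>e\<in>S. cmod (G (head_F e) - G (tail_F e)))"
      for G :: "'v set \<Rightarrow> complex"
      by (rule zero_pathD[OF path])
  qed
qed

end

end

theorem theorem1p2:
  fixes \<Gamma> :: "('v, 'a, 'd::finite) periodic_data"
    and T :: "('v, 'a) pre_digraph"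
    and E :: "'a set set"
    and b :: "'d \<Rightarrow> 'a set"
  assumes d: "CARD('d) \<ge> 2"
    and \<Gamma>: "periodic_graph \<Gamma>"
    and T: "fundamental_tree \<Gamma> T"
    and E: "is_orientation (fund_graph \<Gamma>) (fund_flip \<Gamma>) E"
    and b: "range b \<subseteq> bridges \<Gamma> (verts T) E"
    and b_inj: "inj (\<lambda>j. int_vec (index \<Gamma> (verts T) (b j)))"
    and b_indep: "independent (range (\<lambda>j. int_vec (index \<Gamma> (verts T) (b j))))"
  shows "let
      V0 = verts T;
      B = bridges \<Gamma> V0 E;
      \<tau> = index \<Gamma> V0;
      \<kappa> = total_degree \<Gamma>;
      \<nu> = real (card (verts (fund_graph \<Gamma>)));
      d = real CARD('d);
      \<mu> = effective_form \<Gamma> V0;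
      h = hvec \<Gamma> V0 E;
      \<Lambda>0 = Lambda0 \<Gamma> V0 b;
      \<Lambda>1 = Lambda1 \<Gamma> V0 E;
      C = (\<Sum>j\<in>UNIV. (norm (int_vec (\<tau> (b j))))^2)
    in
      (\<forall>\<omega>::real^'d. norm \<omega> = 1 \<longrightarrow>
         (let f = (\<lambda>\<epsilon>::real. band1 \<Gamma> V0 (\<epsilon> *\<^sub>R \<omega>)) in
           (\<lambda>\<epsilon>. f \<epsilon> - \<epsilon>^2 * \<mu> \<omega>) \<in> O[at_right 0](\<lambda>\<epsilon>. \<epsilon>^3) \<and>
           (\<forall>\<^sub>F \<epsilon> in nhds 0. f differentiable (at \<epsilon>)) \<and>
           deriv f differentiable (at 0) \<and>
           \<mu> \<omega> = 1 / 2 * deriv (deriv f) 0) \<and>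
         \<mu> \<omega> = (cvec_norm E (Pstar \<Gamma> E (h \<omega>)))^2 \<and>
         0 < \<Lambda>0 / (\<kappa> * \<nu> * d) \<and>
         \<Lambda>0 / (\<kappa> * \<nu> * d) \<le> \<mu> \<omega> \<and>
         \<mu> \<omega> \<le> (cvec_norm E (h \<omega>))^2 \<and>
         (cvec_norm E (h \<omega>))^2 = 1 / \<kappa> * (\<Sum>e\<in>B. (int_vec (\<tau> e) \<bullet> \<omega>)^2) \<and>
         1 / \<kappa> * (\<Sum>e\<in>B. (int_vec (\<tau> e) \<bullet> \<omega>)^2) \<le> \<Lambda>1 / \<kappa>) \<and>
      ((d - 1) / C) ^ (CARD('d) - 1) \<le> \<Lambda>0 \<and>
      \<Lambda>0 \<le> \<Lambda>1 \<and>
      \<Lambda>1 \<le> (MAX e0\<in>B. abs_vec (\<tau> e0) \<bullet> (\<Sum>e\<in>B. abs_vec (\<tau> e)))"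
proof -
  interpret periodic_graph \<Gamma> by (rule \<Gamma>)
  interpret periodic_tree \<Gamma> T E by unfold_locales (rule T E)+
  let ?B = "bridges \<Gamma> V0 E" and ?\<kappa> = "total_degree \<Gamma>" and ?\<nu> = "real (card verts_F)"
    and ?d = "real CARD('d)" and ?L0 = "Lambda0 \<Gamma> V0 b" and ?L1 = "Lambda1 \<Gamma> V0 E"
  have L0: "?L0 = smallest_eigenvalue UNIV (gram UNIV (\<lambda>j. \<tau> (b j)))"
    by (simp add: Lambda0_def Let_def)
  have L1: "?L1 = largest_eigenvalue UNIV (gram ?B \<tau>)"
    by (simp add: Lambda1_def Let_def)
  have bB: "b j \<in> ?B" for j using b by blast
  have finB: "finite ?B" using finite_E by (simp add: bridges_def)
  have B_ne: "?B \<noteq> {}" using bB by blast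
  have E_ne: "E \<noteq> {}" using bB by (auto simp: bridges_def)
  have inj: "inj b" using b_inj by (auto simp: inj_def)
  have \<kappa>: "?\<kappa> > 0" by (rule total_degree_pos[OF E_ne])
  have \<nu>: "?\<nu> > 0" using verts_F_ne finite_fund_verts by (simp add: card_gt_0_iff)
  have d0: "?d > 0" by simp
  have lower: "((?d - 1) / (\<Sum>j\<in>UNIV. (norm (int_vec (\<tau> (b j))))\<^sup>2)) ^ (CARD('d) - 1) \<le> ?L0"
    and L0_pos: "0 < ?L0"
    unfolding L0 using smallest_gram_lower_bound[OF d b_inj b_indep] by auto
  have chosen: "?L0 * (norm \<omega>)\<^sup>2 \<le> (\<Sum>j\<in>UNIV. (int_vec (\<tau> (b j)) \<bullet> \<omega>)\<^sup>2)" for \<omega>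
    unfolding L0 by (rule smallest_gram_le_quadratic_form)
  have all: "(\<Sum>e\<in>?B. (int_vec (\<tau> e) \<bullet> \<omega>)\<^sup>2) \<le> ?L1 * (norm \<omega>)\<^sup>2" for \<omega>
    unfolding L1 by (rule quadratic_form_le_largest_gram)
  have "(\<Sum>j\<in>UNIV. (int_vec (\<tau> (b j)) \<bullet> \<omega>)\<^sup>2) \<le> (\<Sum>e\<in>?B. (int_vec (\<tau> e) \<bullet> \<omega>)\<^sup>2)" for \<omega>
  proof -
    have "(\<Sum>j\<in>UNIV. (int_vec (\<tau> (b j)) \<bullet> \<omega>)\<^sup>2) = (\<Sum>e\<in>range b. (int_vec (\<tau> e) \<bullet> \<omega>)\<^sup>2)"
      by (simp add: sum.reindex[OF inj])
    also have "\<dots> \<le> (\<Sum>e\<in>?B. (int_vec (\<tau> e) \<bullet> \<omega>)\<^sup>2)"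
      by (rule sum_mono2) (use finB b in auto)
    finally show ?thesis .
  qed
  \<comment> \<open>Both quadratic forms are compared at one unit vector.\<close>
  from order_trans[OF chosen order_trans[OF this all], of "axis undefined 1"]
  have L0_L1: "?L0 \<le> ?L1" by simp
  have upper: "?L1 \<le> (MAX e0\<in>?B. abs_vec (\<tau> e0) \<bullet> (\<Sum>e\<in>?B. abs_vec (\<tau> e)))"
    unfolding L1 by (rule largest_gram_le[OF finB B_ne])
  \<comment> \<open>Averaging over the chosen bridges brings in the smallest eigenvalue and the factor \<open>d\<close>.\<close>
  have main: "?L0 / (?\<kappa> * ?\<nu> * ?d) \<le> effective_form \<Gamma> V0 \<omega>" if "norm \<omega> = 1" for \<omega>
  proof -
    have "?L0 \<le> (\<Sum>j\<in>UNIV. (int_vec (\<tau> (b j)) \<bullet> \<omega>)\<^sup>2)" using chosen[of \<omega>] that by simp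
    also have "\<dots> \<le> (\<Sum>j\<in>(UNIV :: 'd set). ?\<kappa> * ?\<nu> * effective_form \<Gamma> V0 \<omega>)"
      using effective_form_properties(7)[OF E_ne bB] \<kappa> \<nu>
      by (intro sum_mono) (simp add: pos_divide_le_eq mult_ac)
    finally show ?thesis using \<kappa> \<nu> d0 by (simp add: pos_divide_le_eq mult_ac)
  qed
  have pos: "0 < ?L0 / (?\<kappa> * ?\<nu> * ?d)" using L0_pos \<kappa> \<nu> d0 by simp
  have last: "1 / ?\<kappa> * (\<Sum>e\<in>?B. (int_vec (\<tau> e) \<bullet> \<omega>)\<^sup>2) \<le> ?L1 / ?\<kappa>" if "norm \<omega> = 1" for \<omega>
    using all[of \<omega>] that \<kappa> by (simp add: divide_right_mono)
  show ?thesis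
    unfolding Let_def
    by (intro conjI allI impI lower L0_L1 upper pos main last hvec_norm[OF E_ne]
        effective_form_properties(1-4,6)[OF E_ne])
      (simp_all add: effective_form_properties(5)[OF E_ne])
qed

end
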